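(* If $f:X\to Y$ is a morphism in $\mathcal{C}/\mathcal{T}$ then the following are equivalent. (1) $f$ is an epimorphism in $\mathcal{C}/\mathcal{T}$. (2) The induced mapping $\mathrm{Hom}_{\mathcal{C}/\mathcal{T}}(Y,\tau S)\to\mathrm{Hom}_{\mathcal{C}/\mathcal{T}}(X,\tau S)$ is a monomorphism for all $S\in\mathcal{T}$. (3) The induced map $\mathrm{Hom}_{\mathcal{C}/\mathcal{T}}(\tau^{-1}S,X)\to\mathrm{Hom}_{\mathcal{C}/\mathcal{T}}(\tau^{-1}S,Y)$ is an epimorphism for all $S\in\mathcal{T}$.
   Context: Fix a field $K$. All categories are $K$-linear Krull–Schmidt categories: every object is a finite formal direct sum of indecomposable objects with local endomorphism rings. The category $\mathcal{B}$ has indecomposable objects the pairs $(x,y)\in\mathbb{R}^2$, with $\mathrm{Hom}_{\mathcal{B}}((x,y),(x',y'))=K$ if $x\le x'$ and $y\le y'$, and $0$ otherwise; composition is multiplication of scalars; the morphism corresponding to $1\in K$ is the basic morphism. Let $\mathcal{B}_\pi$ be the full additive subcategory generated by all $(x,y)$ with $|y-x|\ge\pi$. The continuous derived category $\mathcal{D}$ is the full additive subcategory of $\mathcal{B}/\mathcal{B}_\pi$ (quotient by the ideal of morphisms factoring through objects of $\mathcal{B}_\pi$) generated by the $(x,y)$ with $|y-x|<\pi$. The doubled category $\mathcal{D}^{(2)}$ is obtained by adding a second copy $(x,y)'$ of every indecomposable $(x,y)$ together with an isomorphism $\eta:(x,y)'\cong(x,y)$; put $(x,y)''=(x,y)$.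 Let $F$ be the automorphism of $\mathcal{D}^{(2)}$ given on objects by $F(x,y)=(y+\pi,x+\pi)'$, taking basic morphisms to basic morphisms. The continuous cluster category $\mathcal{C}=\mathcal{C}_\pi$ is the orbit category $\mathcal{D}^{(2)}/F$, with $\mathrm{Hom}_{\mathcal{C}}(X,Y)=\bigoplus_{k\in\mathbb{Z}}\mathrm{Hom}_{\mathcal{D}^{(2)}}(X,F^kY)$. The orbit of $(x,y)$ is denoted $M(x,y)$ (and that of $(x,y)'$ is $M(x,y)'\cong M(x,y)$), so $M(x,y)=M(y+\pi,x+\pi)'$. The standard cluster $\mathcal{T}$ is the set of objects $M\left(\frac{m\pi}{2^n},\pi+\frac{(m-1)\pi}{2^n}\right)$ for integers $n\ge0$, $0\le m<2^{n+1}$ (omitting $(\pi,\pi)$, which repeats $(0,0)$). $\mathcal{C}/\mathcal{T}$ is the quotient of $\mathcal{C}$ by the ideal of morphisms which factor through an object of $\mathrm{add}\,\mathcal{T}$ (finite direct sums of objects of $\mathcal{T}$, up to isomorphism). For $S=M(x,y)\in\mathcal{T}$ and small $\epsilon>0$ let $S_\epsilon=M(x+\epsilon,y+\epsilon)$ and $S_{-\epsilon}=M(x-\epsilon,y-\epsilon)$. For an object $X$, $\mathrm{Hom}_{\mathcal{C}/\mathcal{T}}(\tau^{-1}S,X):=\lim_{\epsilon\to0+}\mathrm{Hom}_{\mathcal{C}/\mathcal{T}}(S_\epsilon,X)$ and $\mathrm{Hom}_{\mathcal{C}/\mathcal{T}}(X,\tau S):=\lim_{\epsilon\to0+}\mathrm{Hom}_{\mathcal{C}/\mathcal{T}}(X,S_{-\epsilon})$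 (direct limits along composition with the basic morphisms $S_\epsilon\to S_\delta$ and $S_{-\delta}\to S_{-\epsilon}$ for $\epsilon<\delta$); these are respectively covariant and contravariant functors of $X\in\mathcal{C}/\mathcal{T}$. *)

theory Defs
  imports Complex_Main "HOL-Algebra.AbelCoset" "HOL-Algebra.Module" "Jordan_Normal_Form.Matrix"
begin

text \<open>Linear categories over a field 'k. Each hom space is a module in the sense of the algebra
  library over the field given by the type; the fields mult and one of that record are not used.
  \<open>Comp C X Y Z g f\<close> is the composite of \<open>f : X \<rightarrow> Y\<close> and \<open>g : Y \<rightarrow> Z\<close>.\<close>

record ('k, 'o, 'm) lin_cat =
  Obj :: "'o set"
  Hom :: "'o \<Rightarrow> 'o \<Rightarrow> ('k, 'm) module"
  Idn :: "'o \<Rightarrow> 'm"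
  Comp :: "'o \<Rightarrow> 'o \<Rightarrow> 'o \<Rightarrow> 'm \<Rightarrow> 'm \<Rightarrow> 'm"

definition isomorphic_in :: "('k, 'o, 'm) lin_cat \<Rightarrow> 'o \<Rightarrow> 'o \<Rightarrow> bool" where
  "isomorphic_in C X Y \<longleftrightarrow> (\<exists>f \<in> carrier (Hom C X Y). \<exists>g \<in> carrier (Hom C Y X).
     Comp C X Y X g f = Idn C X \<and> Comp C Y X Y f g = Idn C Y)"

definition epi_in :: "('k, 'o, 'm) lin_cat \<Rightarrow> 'o \<Rightarrow> 'o \<Rightarrow> 'm \<Rightarrow> bool" where
  "epi_in C X Y f \<longleftrightarrow> f \<in> carrier (Hom C X Y) \<and>
     (\<forall>Z \<in> Obj C. \<forall>g \<in> carrier (Hom C Y Z). \<forall>h \<in> carrier (Hom C Y Z).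
        Comp C X Y Z g f = Comp C X Y Z h f \<longrightarrow> g = h)"

definition full_sub :: "('k, 'o, 'm) lin_cat \<Rightarrow> 'o set \<Rightarrow> ('k, 'o, 'm) lin_cat" where
  "full_sub C P = C\<lparr>Obj := Obj C \<inter> P\<rparr>"

definition factor_ideal :: "('k, 'o, 'm) lin_cat \<Rightarrow> 'o set \<Rightarrow> 'o \<Rightarrow> 'o \<Rightarrow> 'm set" where
  "factor_ideal C P X Y =
     {Comp C X Z Y g f | Z f g. Z \<in> P \<and> f \<in> carrier (Hom C X Z) \<and> g \<in> carrier (Hom C Z Y)}"

definition quot_mor :: "('k, 'o, 'm) lin_cat \<Rightarrow> 'o set \<Rightarrow> 'o \<Rightarrow> 'o \<Rightarrow> 'm \<Rightarrow> 'm set" where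
  "quot_mor C P X Y f = factor_ideal C P X Y +>\<^bsub>Hom C X Y\<^esub> f"

definition quot_cat :: "('k, 'o, 'm) lin_cat \<Rightarrow> 'o set \<Rightarrow> ('k, 'o, 'm set) lin_cat" where
  "quot_cat C P = \<lparr>
     Obj = Obj C,
     Hom = (\<lambda>X Y. \<lparr>
       carrier = quot_mor C P X Y ` carrier (Hom C X Y),
       monoid.mult = undefined,
       one = undefined,
       zero = factor_ideal C P X Y,
       add = (\<lambda>A B. A <+>\<^bsub>Hom C X Y\<^esub> B),
       smult = (\<lambda>a A. \<Union>f\<in>A. quot_mor C P X Y (a \<odot>\<^bsub>Hom C X Y\<^esub> f))\<rparr>),
     Idn = (\<lambda>X. quot_mor C P X X (Idn C X)),
     Comp = (\<lambda>X Y Z B A. \<Union>g\<in>B. \<Union>f\<in>A. quot_mor C P X Z (Comp C X Y Z g f))\<rparr>"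

definition zpow :: "('a \<Rightarrow> 'a) \<Rightarrow> int \<Rightarrow> 'a \<Rightarrow> 'a" where
  "zpow h k = (if k \<ge> 0 then h ^^ nat k else inv_into UNIV h ^^ nat (- k))"

text \<open>The orbit category of an automorphism acting as \<open>F\<close> on objects and as \<open>\<Phi>\<close> on morphisms:
  it has the objects of \<open>C\<close> (an object standing for its orbit), and a morphism \<open>X \<rightarrow> Y\<close> is a
  finitely supported family of morphisms \<open>X \<rightarrow> F\<^sup>k Y\<close>. The composite of \<open>\<phi>\<close> and \<open>\<psi>\<close> has
  component \<open>\<Sum>k. F\<^sup>k(\<psi> (n - k)) \<circ> \<phi> k\<close> in degree \<open>n\<close>.\<close>

definition orbit_cat ::
  "('k, 'o, 'm) lin_cat \<Rightarrow> ('o \<Rightarrow> 'o) \<Rightarrow> ('m \<Rightarrow> 'm) \<Rightarrow> ('k, 'o, int \<Rightarrow> 'm) lin_cat" where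
  "orbit_cat C F \<Phi> = \<lparr>
     Obj = Obj C,
     Hom = (\<lambda>X Y. \<lparr>
       carrier = {\<phi>. (\<forall>k. \<phi> k \<in> carrier (Hom C X (zpow F k Y))) \<and>
                     finite {k. \<phi> k \<noteq> \<zero>\<^bsub>Hom C X (zpow F k Y)\<^esub>}},
       monoid.mult = undefined,
       one = undefined,
       zero = (\<lambda>k. \<zero>\<^bsub>Hom C X (zpow F k Y)\<^esub>),
       add = (\<lambda>\<phi> \<psi> k. \<phi> k \<oplus>\<^bsub>Hom C X (zpow F k Y)\<^esub> \<psi> k),
       smult = (\<lambda>a \<phi> k. a \<odot>\<^bsub>Hom C X (zpow F k Y)\<^esub> \<phi> k)\<rparr>),
     Idn = (\<lambda>X k. if k = 0 then Idn C X else \<zero>\<^bsub>Hom C X (zpow F k X)\<^esub>),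
     Comp = (\<lambda>X Y Z \<psi> \<phi> n. finsum (Hom C X (zpow F n Z))
       (\<lambda>k. Comp C X (zpow F k Y) (zpow F n Z) (zpow \<Phi> k (\<psi> (n - k))) (\<phi> k))
       {k. \<phi> k \<noteq> \<zero>\<^bsub>Hom C X (zpow F k Y)\<^esub>})\<rparr>"

definition orbit_mor ::
  "('k, 'o, 'm) lin_cat \<Rightarrow> ('o \<Rightarrow> 'o) \<Rightarrow> 'o \<Rightarrow> 'o \<Rightarrow> 'm \<Rightarrow> int \<Rightarrow> 'm" where
  "orbit_mor C F X Y f = (\<lambda>k. if k = 0 then f else \<zero>\<^bsub>Hom C X (zpow F k Y)\<^esub>)"

text \<open>A finite formal direct sum is the list of its summands. A morphism \<open>X \<rightarrow> Y\<close> is a matrix of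
  scalars with rows indexed by \<open>Y\<close> and columns by \<open>X\<close>, where the scalar \<open>c\<close> stands for \<open>c\<close> times
  the basic morphism, and entries in zero hom spaces vanish.\<close>

type_synonym point = "real \<times> real"

definition hom_supp :: "point \<Rightarrow> point \<Rightarrow> bool" where
  "hom_supp p q \<longleftrightarrow> fst p \<le> fst q \<and> snd p \<le> snd q"

definition cat_B :: "('k::field, point list, 'k mat) lin_cat" where
  "cat_B = \<lparr>
     Obj = UNIV,
     Hom = (\<lambda>X Y. (module_mat TYPE('k) (length Y) (length X))
       \<lparr>carrier := {A \<in> carrier_mat (length Y) (length X).
          \<forall>j<length Y. \<forall>i<length X. A $$ (j, i) \<noteq> 0 \<longrightarrow> hom_supp (X ! i) (Y ! j)}\<rparr>),
     Idn = (\<lambda>X. 1\<^sub>m (length X)),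
     Comp = (\<lambda>X Y Z B A. B * A)\<rparr>"

definition B_pi :: "point list set" where
  "B_pi = {X. \<forall>p \<in> set X. \<bar>snd p - fst p\<bar> \<ge> pi}"

definition cat_D :: "('k::field, point list, 'k mat set) lin_cat" where
  "cat_D = full_sub (quot_cat cat_B B_pi) {X. \<forall>p \<in> set X. \<bar>snd p - fst p\<bar> < pi}"

text \<open>In the doubled category \<open>(p, False)\<close> is \<open>p\<close> and \<open>(p, True)\<close> is the second copy \<open>p'\<close>. Morphisms
  between copies are identified with morphisms between originals via \<open>\<eta>\<close>, so \<open>\<eta>\<close> is represented by
  an identity.\<close>

type_synonym dpoint = "point \<times> bool"

definition cat_D2 :: "('k::field, dpoint list, 'k mat set) lin_cat" where
  "cat_D2 = \<lparr>
     Obj = {X. map fst X \<in> Obj (cat_D :: ('k, point list, 'k mat set) lin_cat)},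
     Hom = (\<lambda>X Y. Hom cat_D (map fst X) (map fst Y)),
     Idn = (\<lambda>X. Idn cat_D (map fst X)),
     Comp = (\<lambda>X Y Z. Comp cat_D (map fst X) (map fst Y) (map fst Z))\<rparr>"

definition F_obj :: "dpoint list \<Rightarrow> dpoint list" where
  "F_obj = map (\<lambda>((x, y), b). ((y + pi, x + pi), \<not> b))"

text \<open>Since \<open>F\<close> is linear and takes basic morphisms to basic morphisms, it leaves the coefficient
  matrices unchanged. It also preserves the relation \<open>hom_supp\<close> and the condition defining \<open>B_pi\<close>,
  so the classes of a matrix modulo the ideal before and after applying \<open>F\<close> are the same set.\<close>

definition F_mor :: "'k mat set \<Rightarrow> 'k mat set" where
  "F_mor A = A"

definition cat_C :: "('k::field, dpoint list, int \<Rightarrow> 'k mat set) lin_cat" where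
  "cat_C = orbit_cat cat_D2 F_obj F_mor"

definition M :: "point \<Rightarrow> dpoint list" where
  "M p = [(p, False)]"

definition std_cluster :: "point set" where
  "std_cluster = {(real m * pi / 2 ^ n, pi + (real m - 1) * pi / 2 ^ n) | n m :: nat.
     m < 2 ^ (n + 1) \<and> (n, m) \<noteq> (0, 1)}"

definition add_T :: "'k::field itself \<Rightarrow> dpoint list set" where
  "add_T K = {Z \<in> Obj (cat_C :: ('k, dpoint list, int \<Rightarrow> 'k mat set) lin_cat).
     \<exists>ps. set ps \<subseteq> std_cluster \<and>
       isomorphic_in (cat_C :: ('k, dpoint list, int \<Rightarrow> 'k mat set) lin_cat) Z (concat (map M ps))}"

definition cat_CT :: "('k::field, dpoint list, (int \<Rightarrow> 'k mat set) set) lin_cat" where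
  "cat_CT = quot_cat cat_C (add_T TYPE('k))"

text \<open>The image in \<open>cat_CT\<close> of the basic morphism \<open>p \<rightarrow> q\<close> of \<open>cat_B\<close>, when \<open>hom_supp p q\<close>.\<close>

definition basic_mor :: "point \<Rightarrow> point \<Rightarrow> (int \<Rightarrow> 'k::field mat set) set" where
  "basic_mor p q = quot_mor cat_C (add_T TYPE('k)) (M p) (M q)
     (orbit_mor cat_D2 F_obj (M p) (M q) (quot_mor cat_B B_pi [p] [q] (1\<^sub>m 1)))"

text \<open>Direct limits as \<open>\<epsilon> \<rightarrow> 0+\<close> of a system \<open>V \<epsilon>\<close> (\<open>\<epsilon> > 0\<close>) with transition maps
  \<open>t \<epsilon> \<gamma> : V \<epsilon> \<rightarrow> V \<gamma>\<close> for \<open>\<gamma> < \<epsilon>\<close>. Restricting to small \<open>\<epsilon>\<close> passes to a cofinal subsystem, so it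
  does not change the limit.\<close>

definition lim_class ::
  "(real \<Rightarrow> 'm set) \<Rightarrow> (real \<Rightarrow> real \<Rightarrow> 'm \<Rightarrow> 'm) \<Rightarrow> real \<Rightarrow> 'm \<Rightarrow> (real \<times> 'm) set" where
  "lim_class V t \<epsilon> v = {(\<delta>, w). \<delta> > 0 \<and> w \<in> V \<delta> \<and> (\<exists>\<gamma>>0. \<gamma> < \<epsilon> \<and> \<gamma> < \<delta> \<and> t \<epsilon> \<gamma> v = t \<delta> \<gamma> w)}"

definition dir_lim ::
  "(real \<Rightarrow> 'm set) \<Rightarrow> (real \<Rightarrow> real \<Rightarrow> 'm \<Rightarrow> 'm) \<Rightarrow> (real \<times> 'm) set set" where
  "dir_lim V t = {lim_class V t \<epsilon> v | \<epsilon> v. \<epsilon> > 0 \<and> v \<in> V \<epsilon>}"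

definition lim_map ::
  "(real \<Rightarrow> 'm set) \<Rightarrow> (real \<Rightarrow> real \<Rightarrow> 'm \<Rightarrow> 'm) \<Rightarrow> (real \<Rightarrow> 'm \<Rightarrow> 'm)
     \<Rightarrow> (real \<times> 'm) set \<Rightarrow> (real \<times> 'm) set" where
  "lim_map W s \<phi> c = (\<Union>(\<epsilon>, v)\<in>c. lim_class W s \<epsilon> (\<phi> \<epsilon> v))"

definition shift :: "point \<Rightarrow> real \<Rightarrow> point" where
  "shift p e = (fst p + e, snd p + e)"

text \<open>\<open>Hom(\<tau>\<^sup>-\<^sup>1 S, X)\<close>, where \<open>S = M p\<close>.\<close>

definition from_sys :: "point \<Rightarrow> dpoint list \<Rightarrow> real \<Rightarrow> (int \<Rightarrow> 'k::field mat set) set set" where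
  "from_sys p X \<epsilon> = carrier (Hom cat_CT (M (shift p \<epsilon>)) X)"

definition from_trans :: "point \<Rightarrow> dpoint list \<Rightarrow> real \<Rightarrow> real
    \<Rightarrow> (int \<Rightarrow> 'k::field mat set) set \<Rightarrow> (int \<Rightarrow> 'k mat set) set" where
  "from_trans p X \<epsilon> \<gamma> g =
     Comp cat_CT (M (shift p \<gamma>)) (M (shift p \<epsilon>)) X g (basic_mor (shift p \<gamma>) (shift p \<epsilon>))"

definition hom_from_tau_inv :: "point \<Rightarrow> dpoint list
    \<Rightarrow> (real \<times> (int \<Rightarrow> 'k::field mat set) set) set set" where
  "hom_from_tau_inv p X = dir_lim (from_sys p X) (from_trans p X)"

definition hom_from_tau_inv_map :: "point \<Rightarrow> dpoint list \<Rightarrow> dpoint list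
    \<Rightarrow> (int \<Rightarrow> 'k::field mat set) set
    \<Rightarrow> (real \<times> (int \<Rightarrow> 'k mat set) set) set \<Rightarrow> (real \<times> (int \<Rightarrow> 'k mat set) set) set" where
  "hom_from_tau_inv_map p X Y f =
     lim_map (from_sys p Y) (from_trans p Y) (\<lambda>\<epsilon> g. Comp cat_CT (M (shift p \<epsilon>)) X Y f g)"

text \<open>\<open>Hom(X, \<tau> S)\<close>, where \<open>S = M p\<close>.\<close>

definition to_sys :: "dpoint list \<Rightarrow> point \<Rightarrow> real \<Rightarrow> (int \<Rightarrow> 'k::field mat set) set set" where
  "to_sys X p \<epsilon> = carrier (Hom cat_CT X (M (shift p (- \<epsilon>))))"

definition to_trans :: "dpoint list \<Rightarrow> point \<Rightarrow> real \<Rightarrow> real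
    \<Rightarrow> (int \<Rightarrow> 'k::field mat set) set \<Rightarrow> (int \<Rightarrow> 'k mat set) set" where
  "to_trans X p \<epsilon> \<gamma> g =
     Comp cat_CT X (M (shift p (- \<epsilon>))) (M (shift p (- \<gamma>)))
       (basic_mor (shift p (- \<epsilon>)) (shift p (- \<gamma>))) g"

definition hom_to_tau :: "dpoint list \<Rightarrow> point
    \<Rightarrow> (real \<times> (int \<Rightarrow> 'k::field mat set) set) set set" where
  "hom_to_tau X p = dir_lim (to_sys X p) (to_trans X p)"

definition hom_to_tau_map :: "dpoint list \<Rightarrow> dpoint list \<Rightarrow> point
    \<Rightarrow> (int \<Rightarrow> 'k::field mat set) set
    \<Rightarrow> (real \<times> (int \<Rightarrow> 'k mat set) set) set \<Rightarrow> (real \<times> (int \<Rightarrow> 'k mat set) set) set" where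
  "hom_to_tau_map X Y p f =
     lim_map (to_sys X p) (to_trans X p) (\<lambda>\<epsilon> g. Comp cat_CT X Y (M (shift p (- \<epsilon>))) g f)"

end

theory Submission
  imports Defs
begin

text \<open>
  An indecomposable object \<open>(x, y)\<close> is best read as the chord of the circle \<open>\<real>/2\<pi>\<int>\<close> with endpoints
  \<open>a = x\<close> and \<open>b = y + \<pi>\<close>, where \<open>a < b < a + 2\<pi>\<close>; the functor \<open>F\<close> sends \<open>(a, b)\<close> to
  \<open>(b, a + 2\<pi>)\<close>, so an orbit is an unordered pair of distinct points. There is a nonzero morphism
  \<open>(a, b) \<rightarrow> (a', b')\<close> in \<open>\<D>\<close> iff \<open>a \<le> a' < b \<le> b' < a + 2\<pi>\<close>. The objects of \<open>\<T>\<close> are the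
  chords of the dyadic triangulation of the disc, no two of which cross, and the basic morphism above
  survives in \<open>\<C>/\<T>\<close> iff no chord of \<open>\<T>\<close> joins the arc \<open>[a, a']\<close> to the arc \<open>[b, b']\<close>.

  For a chord \<open>S\<close> of \<open>\<T>\<close> and small \<open>\<epsilon> > 0\<close>, the spaces of morphisms from \<open>S\<^sub>\<epsilon>\<close> to a chord \<open>q\<close>
  and from \<open>q\<close> to \<open>S\<close> moved back by \<open>\<epsilon>\<close> are both \<open>K\<close> if \<open>q\<close> crosses \<open>S\<close>, and both \<open>0\<close>
  otherwise, and in the first case the composite through \<open>q\<close> is nonzero (\<open>pairing_near_cluster\<close>).
  Hence composition is a perfect pairing of \<open>Hom(\<tau>\<^sup>-\<^sup>1S, X)\<close> with \<open>Hom(X, \<tau>S)\<close>, for which the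
  maps induced by \<open>f\<close> on the two sides are transposes of each other, and so (2) implies (3) by
  linear algebra (\<open>solvable_if_rows_independent\<close>). That (1) implies (2) is formal: an epimorphism
  induces injections on all contravariant Hom spaces, and direct limits preserve injectivity.

  For (3) implies (1), suppose that \<open>g f = h f\<close> but \<open>g\<close> and \<open>h\<close> differ in the component
  \<open>Y\<^sub>j \<rightarrow> Z\<^sub>k\<close>. Some \<open>S\<close> in \<open>\<T>\<close> detects this component: the basic morphism \<open>Y\<^sub>j \<rightarrow> Z\<^sub>k\<close>
  stays nonzero after composing it with a morphism from \<open>Z\<^sub>k\<close> to \<open>\<tau>S\<close>
  (\<open>basic_morphism_detected_by_cluster\<close>). By the pairing, it also stays nonzero on the
  morphism \<open>\<tau>\<^sup>-\<^sup>1S \<rightarrow> Y\<^sub>j\<close>. By (3) the latter factors through \<open>f\<close>, which contradicts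
  \<open>g f = h f\<close>. The detecting chord comes from a combinatorial fact about the triangulation: if
  no chord of \<open>\<T>\<close> joins the arcs \<open>[a, a']\<close> and \<open>[b, b']\<close>, then some chord of \<open>\<T>\<close> joins the
  two complementary open arcs (\<open>chord_between_open_arcs\<close>).

  To turn statements about these categories into statements about chords, each of them is presented
  as a category of matrices of scalars that is governed by two relations: which basic morphisms are
  nonzero, and which composites of two basic morphisms are again basic (\<open>matrix_model\<close>). Such a
  presentation is inherited by quotients by ideals of morphisms factoring through given objects,
  and by orbit categories. It is started at \<open>\<B>\<close> and carried along to \<open>\<C>/\<T>\<close>.
\<close>

section \<open>Chords of the dyadic triangulation\<close>

text \<open>The second alternative is the first one with the two endpoints interchanged, that is, the image of
  a dyadic interval under \<open>(a, b) \<mapsto> (b, a + 2\<pi>)\<close>.\<close>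

definition dyadic_chord :: "real \<Rightarrow> real \<Rightarrow> bool" where
  "dyadic_chord a b \<longleftrightarrow> (\<exists>(n::nat) (m::int).
     (a = m * (pi / 2 ^ n) \<and> b = (real_of_int m + 1) * (pi / 2 ^ n)) \<or>
     (a = m * (pi / 2 ^ n) \<and> b = (real_of_int m - 1) * (pi / 2 ^ n) + 2 * pi))"

definition dyadic_interval :: "real \<Rightarrow> real \<Rightarrow> bool" where
  "dyadic_interval a b \<longleftrightarrow> (\<exists>(n::nat) (m::int). a = m * (pi / 2 ^ n) \<and> b = (real_of_int m + 1) * (pi / 2 ^ n))"

lemma dyadic_chord_iff:
  "dyadic_chord a b \<longleftrightarrow> dyadic_interval a b \<or> dyadic_interval (b - 2 * pi) a"
proof -
  have "dyadic_interval (b - 2 * pi) a \<longleftrightarrow>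
      (\<exists>(n::nat) (m::int). a = m * (pi / 2 ^ n) \<and> b = (real_of_int m - 1) * (pi / 2 ^ n) + 2 * pi)" (is "?l \<longleftrightarrow> ?r")
  proof
    assume ?l
    then obtain n :: nat and m :: int where
      "b - 2 * pi = m * (pi / 2 ^ n)" "a = (real_of_int m + 1) * (pi / 2 ^ n)"
      unfolding dyadic_interval_def by blast
    then have "a = real_of_int (m + 1) * (pi / 2 ^ n) \<and> b = (real_of_int (m + 1) - 1) * (pi / 2 ^ n) + 2 * pi"
      by simp
    then show ?r by blast
  next
    assume ?r
    then obtain n :: nat and m :: int where
      "a = m * (pi / 2 ^ n)" "b = (real_of_int m - 1) * (pi / 2 ^ n) + 2 * pi" by blast
    then have "b - 2 * pi = real_of_int (m - 1) * (pi / 2 ^ n) \<and> a = (real_of_int (m - 1) + 1) * (pi / 2 ^ n)"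
      by simp
    then show ?l unfolding dyadic_interval_def by blast
  qed
  then show ?thesis unfolding dyadic_chord_def dyadic_interval_def by blast
qed

lemma dyadic_interval_shift:
  assumes "dyadic_interval a b"
  shows "dyadic_interval (a + 2 * pi * of_int k) (b + 2 * pi * of_int k)"
proof -
  obtain n :: nat and m :: int where
    "a = m * (pi / 2 ^ n)" "b = (real_of_int m + 1) * (pi / 2 ^ n)"
    using assms unfolding dyadic_interval_def by blast
  then have "a + 2 * pi * k = real_of_int (m + 2 * 2 ^ n * k) * (pi / 2 ^ n) \<and>
    b + 2 * pi * k = (real_of_int (m + 2 * 2 ^ n * k) + 1) * (pi / 2 ^ n)"
    by (simp add: field_simps)
  then show ?thesis unfolding dyadic_interval_def by blast
qed

lemma dyadic_chord_turn: "dyadic_chord b (a + 2 * pi) \<longleftrightarrow> dyadic_chord a b"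
proof -
  have "dyadic_interval b (a + 2 * pi) \<longleftrightarrow> dyadic_interval (b - 2 * pi) a"
    using dyadic_interval_shift[of b "a + 2 * pi" "-1"] dyadic_interval_shift[of "b - 2 * pi" a 1]
    by auto
  then show ?thesis by (auto simp: dyadic_chord_iff)
qed

lemma dyadic_chord_turn_back: "dyadic_chord (b - 2 * pi) a \<longleftrightarrow> dyadic_chord a b"
  using dyadic_chord_turn[of a "b - 2 * pi"] by simp

lemma dyadic_interval_length:
  assumes "dyadic_interval a b" shows "a < b" "b \<le> a + pi"
proof -
  obtain n :: nat and m :: int where
    e: "a = m * (pi / 2 ^ n)" "b = (real_of_int m + 1) * (pi / 2 ^ n)"
    using assms unfolding dyadic_interval_def by blast
  have "b - a = pi / 2 ^ n" using e by (simp add: field_simps)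
  moreover have "pi / 2 ^ n \<le> pi" by (simp add: divide_le_eq)
  moreover have "pi / 2 ^ n > 0" by simp
  ultimately show "a < b" "b \<le> a + pi" by linarith+
qed

lemma dyadic_chord_length:
  assumes "dyadic_chord a b" shows "a < b" "b < a + 2 * pi"
  using assms dyadic_interval_length[of a b] dyadic_interval_length[of "b - 2 * pi" a] pi_gt_zero
  by (force simp: dyadic_chord_iff)+

lemma pi_power_le: "n \<le> n' \<Longrightarrow> pi / 2 ^ n = (2 ^ (n' - n) :: int) * (pi / 2 ^ n')"
  by (simp add: field_simps flip: power_add)

lemma dyadic_intervals_do_not_overlap:
  assumes "dyadic_interval u v" "dyadic_interval u' v'" "u < u'" "u' < v" "v < v'"
  shows False
proof -
  obtain n :: nat and m :: int where
    e: "u = m * (pi / 2 ^ n)" "v = (real_of_int m + 1) * (pi / 2 ^ n)"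
    using assms(1) unfolding dyadic_interval_def by blast
  obtain n' :: nat and m' :: int where
    e': "u' = m' * (pi / 2 ^ n')" "v' = (real_of_int m' + 1) * (pi / 2 ^ n')"
    using assms(2) unfolding dyadic_interval_def by blast
  show False
  proof (cases "n \<le> n'")
    case True
    define h where "h = pi / 2 ^ n'"
    define K :: int where "K = 2 ^ (n' - n)"
    have h: "pi / 2 ^ n = K * h" "h > 0" using pi_power_le[OF True] by (simp_all add: K_def h_def)
    have "v = ((m + 1) * K :: int) * h" using e h by simp
    moreover have "u' = m' * h" "v' = (m' + 1 :: int) * h" using e' h_def by simp_all
    ultimately have "real_of_int m' < real_of_int ((m + 1) * K)"
      "real_of_int ((m + 1) * K) < real_of_int (m' + 1)"
      using assms h(2) by (metis mult_less_cancel_right_pos)+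
    then show False unfolding of_int_less_iff by linarith
  next
    case False
    then have le: "n' \<le> n" by simp
    define h where "h = pi / 2 ^ n"
    define K :: int where "K = 2 ^ (n - n')"
    have h: "pi / 2 ^ n' = K * h" "h > 0" using pi_power_le[OF le] by (simp_all add: K_def h_def)
    have "u' = (m' * K :: int) * h" using e' h by simp
    moreover have "u = m * h" "v = (m + 1 :: int) * h" using e h_def by simp_all
    ultimately have "real_of_int m < real_of_int (m' * K)"
      "real_of_int (m' * K) < real_of_int (m + 1)"
      using assms h(2) by (metis mult_less_cancel_right_pos)+
    then show False unfolding of_int_less_iff by linarith
  qed
qed

text \<open>Turning a chord by \<open>(a, b) \<mapsto> (b, a + 2\<pi>)\<close> makes it an interval without changing whether it
  crosses another chord, and two dyadic intervals are nested or have disjoint interiors.\<close>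

lemma dyadic_chords_do_not_cross:
  assumes "dyadic_chord u v" "dyadic_chord u' v'" "u < u'" "u' < v" "v < v'" "v' < u + 2 * pi"
  shows False
proof -
  have sh: "dyadic_interval (v' - 2 * pi) u' \<Longrightarrow> dyadic_interval v' (u' + 2 * pi)"
    using dyadic_interval_shift[of "v' - 2 * pi" u' 1] by auto
  have sh2: "dyadic_interval (v - 2 * pi) u \<Longrightarrow> dyadic_interval v (u + 2 * pi)"
    using dyadic_interval_shift[of "v - 2 * pi" u 1] by auto
  consider "dyadic_interval u v" "dyadic_interval u' v'"
    | "dyadic_interval u v" "dyadic_interval (v' - 2 * pi) u'"
    | "dyadic_interval (v - 2 * pi) u" "dyadic_interval u' v'"
    | "dyadic_interval (v - 2 * pi) u" "dyadic_interval (v' - 2 * pi) u'"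
    using assms(1,2) dyadic_chord_iff by blast
  then show False
  proof cases
    case 1 then show ?thesis using dyadic_intervals_do_not_overlap assms by blast
  next
    case 2 then show ?thesis
      using dyadic_intervals_do_not_overlap[of "v' - 2 * pi" u' u v] assms by argo
  next
    case 3 then show ?thesis
      using dyadic_intervals_do_not_overlap[of u' v' v "u + 2 * pi"] sh2 assms by argo
  next
    case 4 then show ?thesis
      using dyadic_intervals_do_not_overlap[of "v - 2 * pi" u "v' - 2 * pi" u'] assms by argo
  qed
qed

text \<open>Bisection: one of the two halves of \<open>[0, 2\<pi>]\<close> has colour difference at least 2. If it is never
  exactly 2, then it is at least 3, and one half of such an interval again has difference at least 2.
  So there would be arbitrarily short dyadic intervals with difference at least 3.\<close>

lemma dyadic_interval_of_color_difference_2: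
  fixes c :: "real \<Rightarrow> int"
  assumes period: "c (2 * pi) = c 0 + 4"
    and sparse: "\<mu> > 0" "\<And>u v. u < v \<Longrightarrow> c v \<ge> c u + 3 \<Longrightarrow> v - u \<ge> \<mu>"
  shows "\<exists>u v. dyadic_interval u v \<and> c v = c u + 2"
proof (rule ccontr)
  assume no: "\<not> ?thesis"
  define p where "p n m = real_of_int m * (pi / 2 ^ n)" for n :: nat and m
  have I: "dyadic_interval (p n m) (p n (m + 1))" for n m
    unfolding dyadic_interval_def p_def by fastforce
  have ex: "\<exists>m. c (p n (m + 1)) \<ge> c (p n m) + 3" for n
  proof (induction n)
    case 0
    have "p 0 0 = 0" "p 0 (0 + 1) = pi" "p 0 1 = pi" "p 0 (1 + 1) = 2 * pi"
      unfolding p_def by (simp_all del: one_add_one)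
    moreover have "c (p 0 (0 + 1)) \<noteq> c (p 0 0) + 2" "c (p 0 (1 + 1)) \<noteq> c (p 0 1) + 2"
      using no I by blast+
    ultimately have "c (p 0 (0 + 1)) \<ge> c (p 0 0) + 3 \<or> c (p 0 (1 + 1)) \<ge> c (p 0 1) + 3"
      using period by (smt (verit, best))
    then show ?case by blast
  next
    case (Suc n)
    then obtain m where m: "c (p n (m + 1)) \<ge> c (p n m) + 3" by blast
    have "p (Suc n) (2 * m) = p n m" "p (Suc n) (2 * m + 1 + 1) = p n (m + 1)"
      by (simp_all add: p_def field_simps)
    then have "c (p (Suc n) (2 * m)) = c (p n m)" "c (p (Suc n) (2 * m + 1 + 1)) = c (p n (m + 1))"
      by simp_all
    moreover have "c (p (Suc n) (2 * m + 1)) \<noteq> c (p (Suc n) (2 * m)) + 2"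
      "c (p (Suc n) (2 * m + 1 + 1)) \<noteq> c (p (Suc n) (2 * m + 1)) + 2"
      using no I by blast+
    ultimately have "c (p (Suc n) (2 * m + 1)) \<ge> c (p (Suc n) (2 * m)) + 3 \<or>
      c (p (Suc n) (2 * m + 1 + 1)) \<ge> c (p (Suc n) (2 * m + 1)) + 3"
      using m by linarith
    then show ?case by blast
  qed
  obtain n where n: "(1 / 2) ^ n < \<mu> / pi"
    using real_arch_pow_inv[of "\<mu> / pi" "1 / 2"] sparse(1) by auto
  obtain m where m: "c (p n (m + 1)) \<ge> c (p n m) + 3" using ex by blast
  have "p n (m + 1) - p n m = pi / 2 ^ n" by (simp add: p_def field_simps)
  also have "\<dots> < \<mu>" using n by (simp add: field_simps power_one_over)
  finally show False
    using sparse(2)[OF _ m] dyadic_interval_length(1)[OF I] by fastforce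
qed

lemma floor_shift: "\<lfloor>(t + 2 * pi - s) / (2 * pi)\<rfloor> = \<lfloor>(t - s) / (2 * pi)\<rfloor> + 1"
proof -
  have "(t + 2 * pi - s) / (2 * pi) = (t - s) / (2 * pi) + 1" by (simp add: field_simps)
  then show ?thesis by simp
qed

lemma ceiling_shift: "\<lceil>(t + 2 * pi - s) / (2 * pi)\<rceil> = \<lceil>(t - s) / (2 * pi)\<rceil> + 1"
proof -
  have "(t + 2 * pi - s) / (2 * pi) = (t - s) / (2 * pi) + 1" by (simp add: field_simps)
  then show ?thesis by simp
qed

lemma reduce_to_period: "\<exists>k::int. a \<le> t + 2 * pi * k \<and> t + 2 * pi * k < a + 2 * pi"
proof -
  define k where "k = - \<lfloor>(t - a) / (2 * pi)\<rfloor>"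
  have "of_int (- k) \<le> (t - a) / (2 * pi)" "(t - a) / (2 * pi) < of_int (- k) + 1"
    unfolding k_def by linarith+
  then have "a \<le> t + 2 * pi * k \<and> t + 2 * pi * k < a + 2 * pi"
    by (simp add: field_simps)
  then show ?thesis by blast
qed

text \<open>The points \<open>a, a', b, b'\<close> cut the circle into two closed and two open arcs. Colour the real line
  by numbering the successive lifts of these arcs. Each closed arc is opposite to the other closed arc,
  and each open arc to the other open one, so a chord with colour difference 2 joins opposite arcs;
  and an interval with difference at least 3 contains a whole open arc, hence is not too short.\<close>

lemma chord_between_open_arcs:
  assumes "a \<le> a'" "a' < b" "b \<le> b'" "b' < a + 2 * pi"
    and none: "\<And>u v. dyadic_chord u v \<Longrightarrow> a \<le> u \<Longrightarrow> u \<le> a' \<Longrightarrow> b \<le> v \<Longrightarrow> v \<le> b' \<Longrightarrow> False"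
  shows "\<exists>u v. dyadic_chord u v \<and> a' < u \<and> u < b \<and> b' < v \<and> v < a + 2 * pi"
proof -
  \<comment> \<open>A floor jumps at the left end of a closed arc, a ceiling just behind its right end.\<close>
  define c where "c t = \<lfloor>(t - a) / (2 * pi)\<rfloor> + \<lceil>(t - a') / (2 * pi)\<rceil> +
    \<lfloor>(t - b) / (2 * pi)\<rfloor> + \<lceil>(t - b') / (2 * pi)\<rceil>" for t
  have period: "c (t + 2 * pi) = c t + 4" for t
    unfolding c_def floor_shift ceiling_shift by simp
  have cval: "c t = -1 + (if t > a' then 1 else 0) + (if t \<ge> b then 1 else 0) + (if t > b' then 1 else 0)"
    if t: "a \<le> t" "t < a + 2 * pi" for t
  proof -
    have "\<lfloor>(t - a) / (2 * pi)\<rfloor> = 0" using t by (simp add: floor_eq_iff)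
    moreover have "\<lceil>(t - a') / (2 * pi)\<rceil> = (if t > a' then 1 else 0)"
      using t assms by (auto simp: ceiling_eq_iff field_simps)
    moreover have "\<lfloor>(t - b) / (2 * pi)\<rfloor> = (if t \<ge> b then 0 else -1)"
      using t assms by (auto simp: floor_eq_iff field_simps)
    moreover have "\<lceil>(t - b') / (2 * pi)\<rceil> = (if t > b' then 1 else 0)"
      using t assms by (auto simp: ceiling_eq_iff field_simps)
    ultimately show ?thesis unfolding c_def by simp
  qed
  have period': "c (t + 2 * pi * of_int k) = c t + 4 * k" for t and k :: int
  proof (induction k rule: int_induct[where k = 0])
    case base then show ?case by simp
  next
    case (step1 i)
    have "c (t + 2 * pi * of_int (i + 1)) = c ((t + 2 * pi * of_int i) + 2 * pi)"
      by (simp add: algebra_simps)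
    then show ?case using step1 period by simp
  next
    case (step2 i)
    have "c (t + 2 * pi * of_int i) = c ((t + 2 * pi * of_int (i - 1)) + 2 * pi)"
      by (simp add: algebra_simps)
    also have "\<dots> = c (t + 2 * pi * of_int (i - 1)) + 4" by (rule period)
    finally have "c (t + 2 * pi * of_int (i - 1)) = c t + 4 * i - 4"
      using step2(2) by (metis add_diff_cancel_right')
    then show ?case by (simp only: right_diff_distrib mult_1_right)
  qed
  \<comment> \<open>The length of the shorter open arc.\<close>
  define \<mu> where "\<mu> = min (b - a') (a + 2 * pi - b')"
  have sparse: "v - u \<ge> \<mu>" if "u < v" "c v \<ge> c u + 3" for u v
  proof -
    obtain k :: int where k: "a \<le> u + 2 * pi * k" "u + 2 * pi * k < a + 2 * pi"
      using reduce_to_period by blast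
    define u' v' where "u' = u + 2 * pi * k" and "v' = v + 2 * pi * k"
    have *: "u' < v'" "c v' \<ge> c u' + 3" "a \<le> u'" "u' < a + 2 * pi" "v' - u' = v - u"
      using that k period' by (simp_all add: u'_def v'_def)
    show ?thesis
    proof (cases "v' < a + 2 * pi")
      case True
      then show ?thesis
        using * cval[of u'] cval[of v'] assms unfolding \<mu>_def by (auto split: if_splits)
    next
      case v1: False
      show ?thesis
      proof (cases "v' < a + 4 * pi")
        case True
        have "c v' = c (v' - 2 * pi) + 4" using period[of "v' - 2 * pi"] by simp
        then show ?thesis
          using * cval[of u'] cval[of "v' - 2 * pi"] v1 True assms unfolding \<mu>_def
          by (auto split: if_splits)
      next
        case False
        then show ?thesis using * assms unfolding \<mu>_def by auto
      qed
    qed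
  qed
  have "\<mu> > 0" using assms by (simp add: \<mu>_def)
  moreover have "c (2 * pi) = c 0 + 4" using period[of 0] by simp
  ultimately obtain u v where uv: "dyadic_interval u v" "c v = c u + 2"
    using dyadic_interval_of_color_difference_2[of c \<mu>] sparse by blast
  obtain k :: int where k: "a \<le> u + 2 * pi * k" "u + 2 * pi * k < a + 2 * pi"
    using reduce_to_period by blast
  define u' v' where "u' = u + 2 * pi * k" and "v' = v + 2 * pi * k"
  have I1: "dyadic_interval u' v'"
    using dyadic_interval_shift[OF uv(1)] by (simp add: u'_def v'_def)
  have I2: "dyadic_chord u' v'" using I1 dyadic_chord_iff by blast
  note I = I1 I2 dyadic_chord_turn_back[THEN iffD2, OF I2]
  have *: "u' < v'" "v' \<le> u' + pi" "c v' = c u' + 2" "a \<le> u'" "u' < a + 2 * pi"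
    using dyadic_interval_length[OF I(1)] uv k period' by (simp_all add: u'_def v'_def)
  show ?thesis
  proof (cases "v' < a + 2 * pi")
    case True
    have "\<not> (a \<le> u' \<and> u' \<le> a' \<and> b \<le> v' \<and> v' \<le> b')" using none I(2) by blast
    then have "a' < u' \<and> u' < b \<and> b' < v'"
      using * cval[of u'] cval[of v'] True assms by (auto split: if_splits)
    then show ?thesis using True I by blast
  next
    case False
    have "c v' = c (v' - 2 * pi) + 4" using period[of "v' - 2 * pi"] by simp
    moreover have "v' - 2 * pi < a + 2 * pi" using * pi_gt_zero by argo
    moreover have "\<not> (a \<le> v' - 2 * pi \<and> v' - 2 * pi \<le> a' \<and> b \<le> u' \<and> u' \<le> b')"
      using none I(3) by blast
    ultimately have "a' < v' - 2 * pi \<and> v' - 2 * pi < b \<and> b' < u' \<and> u' < a + 2 * pi"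
      using * cval[of u'] cval[of "v' - 2 * pi"] False assms by (auto split: if_splits)
    then show ?thesis using I by blast
  qed
qed

section \<open>Supports of the morphisms in D and in C/T\<close>

text \<open>The \<open>k\<close>-th power of the functor \<open>F\<close> on points.\<close>

definition rot :: "int \<Rightarrow> point \<Rightarrow> point" where
  "rot k p = (if even k then (fst p + k * pi, snd p + k * pi) else (snd p + k * pi, fst p + k * pi))"

lemma rot_0 [simp]: "rot 0 p = p"
  by (simp add: rot_def)

lemma rot_add: "rot (k + l) p = rot k (rot l p)"
  by (auto simp: rot_def algebra_simps)

lemma rot_minus [simp]: "rot k (rot (- k) p) = p" "rot (- k) (rot k p) = p"
  by (simp_all flip: rot_add)

definition in_strip :: "point \<Rightarrow> bool" where
  "in_strip p \<longleftrightarrow> \<bar>snd p - fst p\<bar> < pi"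

lemma in_strip_rot [simp]: "in_strip (rot k p) = in_strip p"
  by (auto simp: in_strip_def rot_def)

lemma hom_supp_rot [simp]: "hom_supp (rot k p) (rot k q) = hom_supp p q"
  by (auto simp: hom_supp_def rot_def)

lemma hom_supp_trans: "hom_supp p q \<Longrightarrow> hom_supp q r \<Longrightarrow> hom_supp p r"
  by (auto simp: hom_supp_def)

lemma hom_supp_refl [simp]: "hom_supp p p"
  by (auto simp: hom_supp_def)

definition supp_D :: "point \<Rightarrow> point \<Rightarrow> bool" where
  "supp_D p q \<longleftrightarrow> fst p \<le> fst q \<and> fst q < snd p + pi \<and> snd p \<le> snd q \<and> snd q < fst p + pi"

lemma supp_D_rot [simp]: "supp_D (rot k p) (rot k q) = supp_D p q"
  by (auto simp: supp_D_def rot_def)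

lemma supp_D_hom_supp: "supp_D p q \<Longrightarrow> hom_supp p q"
  by (simp add: supp_D_def hom_supp_def)

text \<open>If a basic morphism factors through some point outside of the strip, then it factors through one of
  the other two corners of the rectangle spanned by its source and target.\<close>

lemma supp_D_iff_not_factoring:
  "supp_D p q \<longleftrightarrow> hom_supp p q \<and> (\<forall>z. \<not> in_strip z \<longrightarrow> \<not> (hom_supp p z \<and> hom_supp z q))"
proof
  assume "supp_D p q"
  then show "hom_supp p q \<and> (\<forall>z. \<not> in_strip z \<longrightarrow> \<not> (hom_supp p z \<and> hom_supp z q))"
    by (auto simp: supp_D_def hom_supp_def in_strip_def)
next
  assume r: "hom_supp p q \<and> (\<forall>z. \<not> in_strip z \<longrightarrow> \<not> (hom_supp p z \<and> hom_supp z q))"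
  then have "in_strip (fst q, snd p)" "in_strip (fst p, snd q)"
    by (force simp: hom_supp_def)+
  then show "supp_D p q" using r by (auto simp: supp_D_def hom_supp_def in_strip_def)
qed

lemma supp_D_between:
  assumes "supp_D p r" "hom_supp p q" "hom_supp q r" shows "supp_D p q" "supp_D q r"
  using assms by (auto simp: supp_D_def hom_supp_def)

lemma supp_D_rot_self:
  assumes "supp_D p q" "supp_D p (rot m q)" shows "m = 0"
proof (rule ccontr)
  assume m: "m \<noteq> 0"
  show False
  proof (cases "m > 0")
    case True
    then have "real_of_int m * pi \<ge> 1 * pi" by (intro mult_right_mono) auto
    then obtain r where "real_of_int m * pi = r" "r \<ge> 1 * pi" by blast
    then show False using assms by (auto simp: supp_D_def rot_def split: if_splits)
  next
    case False
    then have "real_of_int m * pi \<le> - 1 * pi" using m by (intro mult_right_mono) auto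
    then obtain r where "real_of_int m * pi = r" "r \<le> - 1 * pi" by blast
    then show False using assms by (auto simp: supp_D_def rot_def split: if_splits)
  qed
qed

text \<open>This makes the morphism spaces of the orbit category at most one-dimensional.\<close>

lemma supp_D_rot_unique:
  assumes "supp_D p (rot k q)" "supp_D p (rot l q)" shows "k = l"
proof -
  have "rot (l - k) (rot k q) = rot l q" by (simp flip: rot_add)
  then show ?thesis using supp_D_rot_self[of p "rot k q" "l - k"] assms by simp
qed

text \<open>The points whose orbit belongs to the cluster.\<close>

definition cluster_lift :: "point \<Rightarrow> bool" where
  "cluster_lift p \<longleftrightarrow> dyadic_chord (fst p) (snd p + pi)"

lemma cluster_lift_rot_1: "cluster_lift (rot 1 p) = cluster_lift p"
  using dyadic_chord_turn[of "snd p + pi" "fst p"]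
  by (simp add: cluster_lift_def rot_def add.assoc)

lemma cluster_lift_rot [simp]: "cluster_lift (rot k p) = cluster_lift p"
proof (induction k rule: int_induct[where k = 0])
  case base then show ?case by simp
next
  case (step1 i)
  then show ?case using cluster_lift_rot_1[of "rot i p"] by (simp add: add.commute flip: rot_add)
next
  case (step2 i)
  then show ?case using cluster_lift_rot_1[of "rot (i - 1) p"] by (simp flip: rot_add)
qed

lemma cluster_lift_in_strip: "cluster_lift p \<Longrightarrow> in_strip p"
  using dyadic_chord_length[of "fst p" "snd p + pi"] by (auto simp: cluster_lift_def in_strip_def)

lemma std_cluster_lift:
  assumes "p \<in> std_cluster" shows "cluster_lift p"
proof -
  obtain n m :: nat where p: "p = (real m * pi / 2 ^ n, pi + (real m - 1) * pi / 2 ^ n)"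
    using assms by (auto simp: std_cluster_def)
  then have "fst p = real_of_int (int m) * (pi / 2 ^ n) \<and>
    snd p + pi = (real_of_int (int m) - 1) * (pi / 2 ^ n) + 2 * pi" by simp
  then show ?thesis unfolding cluster_lift_def dyadic_chord_def by blast
qed

lemma cluster_lift_std:
  assumes "cluster_lift p" shows "\<exists>k. \<exists>t\<in>std_cluster. p = rot k t"
proof -
  have long: "\<exists>k. \<exists>t\<in>std_cluster. q = rot k t"
    if q: "fst q = real_of_int m * (pi / 2 ^ n)" "snd q + pi = (real_of_int m - 1) * (pi / 2 ^ n) + 2 * pi"
    for q and n :: nat and m :: int
  proof -
    define N :: int where "N = 2 ^ (n + 1)"
    define j where "j = m div N"
    define m0 where "m0 = nat (m mod N)"
    have "N > 0" by (simp add: N_def)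
    then have m0: "int m0 = m mod N" "int m0 < N" by (simp_all add: m0_def)
    have lt: "m0 < 2 ^ (n + 1)" using m0(2) unfolding N_def by (metis of_nat_less_iff of_nat_numeral of_nat_power)
    have m: "m = j * N + int m0" unfolding m0 j_def by simp
    have mr: "real_of_int m = real_of_int j * (2 * 2 ^ n) + real m0" unfolding m by (simp add: N_def)
    define t where "t = (real m0 * pi / 2 ^ n, pi + (real m0 - 1) * pi / 2 ^ n)"
    have qt: "q = rot (2 * j) t"
      using q by (auto simp: prod_eq_iff rot_def t_def mr field_simps)
    show ?thesis
    proof (cases "n = 0 \<and> m0 = 1")
      case False
      then have "t \<in> std_cluster" using lt unfolding t_def std_cluster_def by blast
      then show ?thesis using qt by blast
    next
      case True
      have "(0, 0) \<in> std_cluster"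
        unfolding std_cluster_def by (rule CollectI, rule exI[of _ 0], rule exI[of _ 0]) simp
      moreover have "t = rot 1 (0, 0)" using True by (simp add: t_def rot_def)
      ultimately show ?thesis using qt rot_add by metis
    qed
  qed
  obtain n :: nat and m :: int where
    "fst p = real_of_int m * (pi / 2 ^ n) \<and> snd p + pi = (real_of_int m + 1) * (pi / 2 ^ n) \<or>
     fst p = real_of_int m * (pi / 2 ^ n) \<and> snd p + pi = (real_of_int m - 1) * (pi / 2 ^ n) + 2 * pi"
    using assms unfolding cluster_lift_def dyadic_chord_def by blast
  then show ?thesis
  proof
    assume "fst p = real_of_int m * (pi / 2 ^ n) \<and> snd p + pi = (real_of_int m - 1) * (pi / 2 ^ n) + 2 * pi"
    then show ?thesis using long by blast
  next
    assume s: "fst p = real_of_int m * (pi / 2 ^ n) \<and> snd p + pi = (real_of_int m + 1) * (pi / 2 ^ n)"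
    have "\<exists>k. \<exists>t\<in>std_cluster. rot 1 p = rot k t"
      by (rule long[of _ "m + 1" n]) (use s in \<open>auto simp: rot_def\<close>)
    then obtain k t where "t \<in> std_cluster" "rot 1 p = rot k t" by blast
    then have "p = rot (-1 + k) t" unfolding rot_add by (metis rot_minus(2))
    then show ?thesis using \<open>t \<in> std_cluster\<close> by blast
  qed
qed

text \<open>All lifts of the cluster count: a morphism of degree 0 in the orbit category can factor through an
  object of the cluster by two morphisms of other, opposite degrees.\<close>

definition supp_T :: "point \<Rightarrow> point \<Rightarrow> bool" where
  "supp_T p q \<longleftrightarrow> supp_D p q \<and> \<not> (\<exists>t. cluster_lift t \<and> hom_supp p t \<and> hom_supp t q)"

lemma supp_T_rot [simp]: "supp_T (rot k p) (rot k q) = supp_T p q"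
proof -
  have "(\<exists>t. cluster_lift t \<and> hom_supp (rot k p) t \<and> hom_supp t (rot k q)) \<longleftrightarrow>
        (\<exists>t. cluster_lift t \<and> hom_supp p t \<and> hom_supp t q)"
    by (metis cluster_lift_rot hom_supp_rot rot_minus(1))
  then show ?thesis by (simp add: supp_T_def)
qed

lemma supp_T_between:
  assumes "supp_T p r" "hom_supp p q" "hom_supp q r" shows "supp_T p q" "supp_T q r"
  using assms supp_D_between[of p r q] hom_supp_trans unfolding supp_T_def by blast+

lemma supp_T_supp_D: "supp_T p q \<Longrightarrow> supp_D p q" by (simp add: supp_T_def)

lemma supp_T_hom_supp: "supp_T p q \<Longrightarrow> hom_supp p q"
  using supp_D_hom_supp supp_T_supp_D by blast

text \<open>The chords of \<open>q\<close> and \<open>t\<close> have interlacing endpoints, and \<open>t\<close> is the lift that starts between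
  the endpoints of \<open>q\<close>.\<close>

definition crosses :: "point \<Rightarrow> point \<Rightarrow> bool" where
  "crosses q t \<longleftrightarrow> fst q < fst t \<and> fst t < snd q + pi \<and> snd q < snd t \<and> snd t < fst q + pi"

lemma cluster_lift_no_cross:
  assumes "cluster_lift s" "cluster_lift t" "crosses s t" shows False
  using assms dyadic_chords_do_not_cross[of "fst s" "snd s + pi" "fst t" "snd t + pi"]
  by (auto simp: cluster_lift_def crosses_def)

lemma shift_rot: "rot k (shift p e) = shift (rot k p) e"
  by (auto simp: rot_def shift_def)

lemma in_strip_shift [simp]: "in_strip (shift p e) = in_strip p"
  by (simp add: in_strip_def shift_def)

lemma hom_supp_shift: "e \<le> e' \<Longrightarrow> hom_supp (shift p e) (shift p e')"
  by (simp add: hom_supp_def shift_def)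

lemma supp_T_detected:
  assumes "supp_T p q"
  shows "\<exists>t. cluster_lift t \<and> crosses p t \<and> crosses q t \<and> fst t < snd p + pi \<and> snd t < fst p + pi"
proof -
  have D: "supp_D p q" using assms supp_T_supp_D by blast
  have none: False if "dyadic_chord u v" "fst p \<le> u" "u \<le> fst q" "snd p + pi \<le> v" "v \<le> snd q + pi" for u v
  proof -
    have "cluster_lift (u, v - pi) \<and> hom_supp p (u, v - pi) \<and> hom_supp (u, v - pi) q"
      using that by (auto simp: cluster_lift_def hom_supp_def)
    then show False using assms unfolding supp_T_def by blast
  qed
  have "\<exists>u v. dyadic_chord u v \<and> fst q < u \<and> u < snd p + pi \<and> snd q + pi < v \<and> v < fst p + 2 * pi"
    by (rule chord_between_open_arcs[OF _ _ _ _ none]) (use D in \<open>auto simp: supp_D_def\<close>)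
  then obtain u v where "dyadic_chord u v \<and> fst q < u \<and> u < snd p + pi \<and> snd q + pi < v \<and> v < fst p + 2 * pi"
    by blast
  then have "cluster_lift (u, v - pi) \<and> crosses p (u, v - pi) \<and> crosses q (u, v - pi)
    \<and> fst (u, v - pi) < snd p + pi \<and> snd (u, v - pi) < fst p + pi"
    using D by (auto simp: cluster_lift_def crosses_def supp_D_def)
  then show ?thesis by blast
qed

text \<open>A cluster chord through which \<open>q \<rightarrow> shift t (- e)\<close> factored would cross \<open>t\<close>.\<close>

lemma crosses_supp_T_to:
  assumes "cluster_lift t" "crosses q t" "hom_supp q (shift t (- e))" "e > 0"
  shows "supp_T q (shift t (- e))"
proof -
  have "supp_D q (shift t (- e))"
    using assms by (auto simp: supp_D_def crosses_def hom_supp_def shift_def)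
  moreover have "crosses s t" if "hom_supp q s" "hom_supp s (shift t (- e))" for s
    using that assms by (auto simp: crosses_def hom_supp_def shift_def)
  ultimately show ?thesis using cluster_lift_no_cross assms unfolding supp_T_def by blast
qed

text \<open>The morphism from \<open>\<tau>\<^sup>-\<^sup>1S\<close> to \<open>\<tau>S\<close>: it leads from just behind the lift of \<open>S\<close> that precedes \<open>t\<close>
  to just before \<open>t\<close>, and every cluster chord in between would cross \<open>t\<close>.\<close>

lemma supp_T_around:
  assumes "cluster_lift t" "in_strip t" "e > 0" "e' > 0"
    "hom_supp (shift (rot (-1) t) e) (shift t (- e'))"
  shows "supp_T (shift (rot (-1) t) e) (shift t (- e'))"
proof -
  have "supp_D (shift (rot (-1) t) e) (shift t (- e'))"
    using assms by (auto simp: supp_D_def in_strip_def hom_supp_def shift_def rot_def)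
  moreover have "crosses s t" if "hom_supp (shift (rot (-1) t) e) s" "hom_supp s (shift t (- e'))" for s
    using that assms by (auto simp: crosses_def hom_supp_def shift_def rot_def)
  ultimately show ?thesis using cluster_lift_no_cross assms unfolding supp_T_def by blast
qed

section \<open>Morphisms near an object of the cluster\<close>

definition supp_CT :: "point \<Rightarrow> point \<Rightarrow> bool" where
  "supp_CT p q \<longleftrightarrow> (\<exists>k. supp_T p (rot k q))"

text \<open>The composite of the basic morphisms \<open>p \<rightarrow> q \<rightarrow> r\<close> is the basic one: for suitable lifts of \<open>q\<close>
  and \<open>r\<close>, the target stays within the support of \<open>p\<close>.\<close>

definition comp_CT :: "point \<Rightarrow> point \<Rightarrow> point \<Rightarrow> bool" where
  "comp_CT p q r \<longleftrightarrow> (\<exists>k l. hom_supp p (rot k q) \<and> hom_supp (rot k q) (rot l r) \<and> supp_T p (rot l r))"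

lemma comp_CT_I:
  assumes "hom_supp (rot j p) (rot k q)" "hom_supp (rot k q) (rot l r)" "supp_T (rot j p) (rot l r)"
  shows "comp_CT p q r"
proof -
  have "hom_supp (rot (-j) (rot j p)) (rot (-j) (rot k q))"
    "hom_supp (rot (-j) (rot k q)) (rot (-j) (rot l r))"
    "supp_T (rot (-j) (rot j p)) (rot (-j) (rot l r))"
    using assms unfolding hom_supp_rot supp_T_rot by simp_all
  then have "hom_supp p (rot (-j + k) q) \<and> hom_supp (rot (-j + k) q) (rot (-j + l) r) \<and> supp_T p (rot (-j + l) r)"
    unfolding rot_add by simp
  then show ?thesis unfolding comp_CT_def by blast
qed

lemma eventually_dyadic:
  assumes "c = real_of_int m * (pi / 2 ^ n)" "n \<le> n'"
  shows "dyadic_interval (c + of_int k * pi) (c + of_int k * pi + pi / 2 ^ n')"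
    "dyadic_interval (c + of_int k * pi - pi / 2 ^ n') (c + of_int k * pi)"
proof -
  define M :: int where "M = m * 2 ^ (n' - n) + k * 2 ^ n'"
  define H where "H = pi / 2 ^ n'"
  have "real_of_int m * (pi / 2 ^ n) = (real_of_int m * 2 ^ (n' - n)) * (pi / 2 ^ n')"
    using pi_power_le[OF assms(2)] by simp
  then have c: "c + of_int k * pi = of_int M * H"
    unfolding assms(1) M_def H_def by (simp add: algebra_simps)
  then have "c + of_int k * pi + H = (of_int M + 1) * H"
    "c + of_int k * pi - H = of_int (M - 1) * H"
    "c + of_int k * pi = (of_int (M - 1) + 1) * H"
    by (simp_all add: algebra_simps)
  then show "dyadic_interval (c + of_int k * pi) (c + of_int k * pi + pi / 2 ^ n')"
    "dyadic_interval (c + of_int k * pi - pi / 2 ^ n') (c + of_int k * pi)"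
    using c unfolding dyadic_interval_def H_def by blast+
qed

lemma cluster_lift_coordinates:
  assumes "cluster_lift p"
  shows "\<exists>n (m::int) (m'::int). fst p = m * (pi / 2 ^ n) \<and> snd p = m' * (pi / 2 ^ n)"
proof -
  obtain n :: nat and m :: int where
    "fst p = real_of_int m * (pi / 2 ^ n) \<and> snd p + pi = (real_of_int m + 1) * (pi / 2 ^ n) \<or>
     fst p = real_of_int m * (pi / 2 ^ n) \<and> snd p + pi = (real_of_int m - 1) * (pi / 2 ^ n) + 2 * pi"
    using assms unfolding cluster_lift_def dyadic_chord_def by blast
  then have "fst p = real_of_int m * (pi / 2 ^ n) \<and> snd p = of_int (m + 1 - 2 ^ n) * (pi / 2 ^ n) \<or>
     fst p = real_of_int m * (pi / 2 ^ n) \<and> snd p = of_int (m - 1 + 2 ^ n) * (pi / 2 ^ n)"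
    by (auto simp: field_simps)
  then show ?thesis by blast
qed

lemma progression_gap_above: "\<exists>e>0. \<forall>k::int. s + k * pi - r \<le> 0 \<or> e \<le> s + k * pi - r"
proof -
  define j where "j = \<lfloor>(r - s) / pi\<rfloor>"
  define e where "e = s + (j + 1) * pi - r"
  have 1: "of_int j \<le> (r - s) / pi" "(r - s) / pi < of_int j + 1" unfolding j_def by linarith+
  then have e: "e > 0" unfolding e_def by (simp add: field_simps)
  have "s + k * pi - r \<le> 0 \<or> e \<le> s + k * pi - r" for k :: int
  proof (cases "k \<le> j")
    case True
    then have "of_int k * pi \<le> of_int j * pi" by simp
    moreover have "of_int j * pi \<le> r - s" using 1 by (simp add: field_simps)
    ultimately show ?thesis by argo
  next
    case False
    then have "of_int (j + 1) * pi \<le> of_int k * pi" by (intro mult_right_mono) auto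
    then show ?thesis unfolding e_def by simp
  qed
  then show ?thesis using e by blast
qed

lemma progression_gap:
  "\<exists>e>0. \<forall>k::int. (s + k * pi \<le> r \<or> r + e \<le> s + k * pi) \<and> (r \<le> s + k * pi \<or> s + k * pi + e \<le> r)"
proof -
  obtain e1 where e1: "e1 > 0" "\<And>k::int. s + k * pi - r \<le> 0 \<or> e1 \<le> s + k * pi - r"
    using progression_gap_above by blast
  obtain e2 where e2: "e2 > 0" "\<And>k::int. - s + k * pi - (- r) \<le> 0 \<or> e2 \<le> - s + k * pi - (- r)"
    using progression_gap_above by blast
  have "(s + k * pi \<le> r \<or> r + min e1 e2 \<le> s + k * pi) \<and> (r \<le> s + k * pi \<or> s + k * pi + min e1 e2 \<le> r)"
    for k :: int
    using e1(2)[of k] e2(2)[of "- k"] by auto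
  then show ?thesis using e1(1) e2(1) by (intro exI[of _ "min e1 e2"]) auto
qed

lemma rot_coordinates:
  "\<exists>s\<in>{fst p, snd p}. fst (rot k p) = s + k * pi"
  "\<exists>s\<in>{fst p, snd p}. snd (rot k p) = s + k * pi"
  by (auto simp: rot_def)

lemma orbit_gap:
  "\<exists>e>0. \<forall>k (j::int). \<forall>x\<in>{fst (rot k p), snd (rot k p)}. \<forall>r\<in>{fst q, snd q}.
     (x \<le> r + j * pi \<or> r + j * pi + e \<le> x) \<and> (r + j * pi \<le> x \<or> x + e \<le> r + j * pi)"
proof -
  obtain e where e: "\<And>s r. e s r > 0"
    "\<And>s r (k::int). (s + k * pi \<le> r \<or> r + e s r \<le> s + k * pi) \<and> (r \<le> s + k * pi \<or> s + k * pi + e s r \<le> r)"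
    using progression_gap by metis
  define e0 where "e0 = min (min (e (fst p) (fst q)) (e (fst p) (snd q))) (min (e (snd p) (fst q)) (e (snd p) (snd q)))"
  have e0: "e0 > 0" "\<And>s r. s \<in> {fst p, snd p} \<Longrightarrow> r \<in> {fst q, snd q} \<Longrightarrow> e0 \<le> e s r"
    using e(1) by (auto simp: e0_def)
  have "(x \<le> r + j * pi \<or> r + j * pi + e0 \<le> x) \<and> (r + j * pi \<le> x \<or> x + e0 \<le> r + j * pi)"
    if x: "x \<in> {fst (rot k p), snd (rot k p)}" and r: "r \<in> {fst q, snd q}" for k and j :: int and x r
  proof -
    obtain s where s: "s \<in> {fst p, snd p}" "x = s + k * pi"
      using x rot_coordinates[where p = p and k = k] by auto
    have "x = (s + (k - j :: int) * pi) + j * pi" unfolding s(2) by (simp add: algebra_simps)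
    then show ?thesis using e(2)[of s "k - j" r] e0(2)[OF s(1) r] by argo
  qed
  then show ?thesis using e0(1) by blast
qed

text \<open>Chords \<open>q\<close> that share an endpoint with \<open>p\<close> are the delicate case. There are arbitrarily short
  chords of the cluster at each endpoint of \<open>p\<close>, and the morphism between \<open>q\<close> and the moved chord
  factors through one of them, provided that \<open>\<epsilon>\<close> is smaller than its length. For all other chords
  it is enough that \<open>\<epsilon>\<close> is smaller than the gaps between the endpoints of \<open>q\<close> and of \<open>p\<close>.\<close>

lemma crossing_near_cluster:
  assumes p: "cluster_lift p" and q: "in_strip q"
  shows "\<exists>e>0. \<forall>\<epsilon> k. 0 < \<epsilon> \<longrightarrow> \<epsilon> < e \<longrightarrow>
    (supp_T q (shift (rot k p) (- \<epsilon>)) \<longrightarrow> crosses q (rot k p)) \<and>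
    (supp_T (shift (rot k p) \<epsilon>) q \<longrightarrow> crosses q (rot (k + 1) p)) \<and>
    (crosses q (rot k p) \<longrightarrow> hom_supp q (shift (rot k p) (- \<epsilon>)) \<and> hom_supp (shift (rot (k - 1) p) \<epsilon>) q)"
proof -
  obtain e where e: "e > 0" "\<And>k (j::int) x r. x \<in> {fst (rot k p), snd (rot k p)} \<Longrightarrow> r \<in> {fst q, snd q} \<Longrightarrow>
     (x \<le> r + j * pi \<or> r + j * pi + e \<le> x) \<and> (r + j * pi \<le> x \<or> x + e \<le> r + j * pi)"
    using orbit_gap[of p q] by blast
  \<comment> \<open>The length of the shorter arc cut off by \<open>q\<close>, so that chords of length \<open>h < w\<close> fit into both.\<close>
  define w where "w = min (snd q + pi - fst q) (fst q + pi - snd q)"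
  have w: "w > 0" using q by (auto simp: w_def in_strip_def)
  obtain N and m m' :: int where N: "fst p = m * (pi / 2 ^ N)" "snd p = m' * (pi / 2 ^ N)"
    using cluster_lift_coordinates[OF p] by blast
  obtain n0 where n0: "(1 / 2) ^ n0 < w / pi"
    using real_arch_pow_inv[of "w / pi" "1 / 2"] w by auto
  define n where "n = max N n0"
  define h where "h = pi / 2 ^ n"
  have "(1 / 2 :: real) ^ n \<le> (1 / 2) ^ n0" by (rule power_decreasing) (auto simp: n_def)
  then have "(1 / 2) ^ n < w / pi" using n0 by linarith
  then have "(1 / 2) ^ n * pi < w" by (simp only: pos_less_divide_eq[OF pi_gt_zero])
  then have h: "h > 0" "h < w" by (simp_all add: h_def power_one_over field_simps)
  have dy: "dyadic_interval x (x + h)" "dyadic_interval (x - h) x"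
    if x: "x = fst (rot k p) + of_int j * pi \<or> x = snd (rot k p) + of_int j * pi" for x k and j :: int
  proof -
    have Nn: "N \<le> n" by (simp add: n_def)
    obtain s where s: "s = fst p \<or> s = snd p" "x = s + real_of_int (k + j) * pi"
      using x rot_coordinates[where p = p and k = k] by (auto simp: algebra_simps)
    obtain mm :: int where mm: "s = mm * (pi / 2 ^ N)" using s(1) N by blast
    show "dyadic_interval x (x + h)" "dyadic_interval (x - h) x"
      using eventually_dyadic[OF mm Nn, of "k + j"] unfolding s(2) h_def by blast+
  qed
  define e' where "e' = min e h"
  have "(supp_T q (shift (rot k p) (- \<epsilon>)) \<longrightarrow> crosses q (rot k p)) \<and>
    (supp_T (shift (rot k p) \<epsilon>) q \<longrightarrow> crosses q (rot (k + 1) p)) \<and>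
    (crosses q (rot k p) \<longrightarrow> hom_supp q (shift (rot k p) (- \<epsilon>)) \<and> hom_supp (shift (rot (k - 1) p) \<epsilon>) q)"
    if \<epsilon>: "0 < \<epsilon>" "\<epsilon> < e'" for \<epsilon> k
  proof -
    define c y where "c = fst (rot k p)" and "y = snd (rot k p)"
    define a b where "a = fst q" and "b = snd q"
    have g: "c \<le> b + pi \<or> b + pi + e \<le> c" "y \<le> a + pi \<or> a + pi + e \<le> y"
      "a - pi \<le> y \<or> y + e \<le> a - pi" "b - pi \<le> c \<or> c + e \<le> b - pi"
      "c \<le> a \<or> a + e \<le> c" "y \<le> b \<or> b + e \<le> y"
      "b + pi \<le> c \<or> c + e \<le> b + pi" "a + pi \<le> y \<or> y + e \<le> a + pi"
      using e(2)[of c k b 1] e(2)[of y k a 1] e(2)[of y k a "-1"] e(2)[of c k b "-1"]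
        e(2)[of c k a 0] e(2)[of y k b 0]
      by (simp_all add: c_def y_def a_def b_def)
    have \<epsilon>': "\<epsilon> < e" "\<epsilon> < h" using \<epsilon> by (simp_all add: e'_def)
    have hw: "h < b + pi - a" "h < a + pi - b" using h by (simp_all add: w_def a_def b_def)
    have blocked: False if "supp_T r s" "dyadic_chord u v" "fst r \<le> u" "u \<le> fst s" "snd r + pi \<le> v" "v \<le> snd s + pi"
      for u v r s
    proof -
      have "cluster_lift (u, v - pi) \<and> hom_supp r (u, v - pi) \<and> hom_supp (u, v - pi) s"
        using that by (auto simp: cluster_lift_def hom_supp_def)
      then show False using that unfolding supp_T_def by blast
    qed
    have 1: "crosses q (rot k p)" if T: "supp_T q (shift (rot k p) (- \<epsilon>))"
    proof -
      have D: "a \<le> c - \<epsilon>" "c - \<epsilon> < b + pi" "b \<le> y - \<epsilon>" "y - \<epsilon> < a + pi"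
        using supp_T_supp_D[OF T] by (auto simp: supp_D_def shift_def c_def y_def a_def b_def)
      have "c \<noteq> b + pi"
      proof
        assume c: "c = b + pi"
        have "dyadic_interval (c - h) c" using dy[of c k 0] by (simp add: c_def)
        then have "dyadic_chord (c - h) c" using dyadic_chord_iff by blast
        then show False
          using blocked[OF T, of "c - h" c] D \<epsilon>' hw c
          by (auto simp: shift_def c_def[symmetric] y_def[symmetric] a_def[symmetric] b_def[symmetric])
      qed
      moreover have "y \<noteq> a + pi"
      proof
        assume y: "y = a + pi"
        have "dyadic_interval (a - h) a" using dy[of a k "-1"] y by (simp add: y_def)
        then have "dyadic_chord a (a - h + 2 * pi)" using dyadic_chord_iff by simp
        then show False
          using blocked[OF T, of a "a - h + 2 * pi"] D \<epsilon>' hw y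
          by (auto simp: shift_def c_def[symmetric] y_def[symmetric] a_def[symmetric] b_def[symmetric])
      qed
      ultimately show ?thesis using D \<epsilon> g \<epsilon>'
        by (auto simp: crosses_def c_def[symmetric] y_def[symmetric] a_def[symmetric] b_def[symmetric])
    qed
    have 2: "crosses q (rot (k + 1) p)" if T: "supp_T (shift (rot k p) \<epsilon>) q"
    proof -
      have D: "c + \<epsilon> \<le> a" "a < y + \<epsilon> + pi" "y + \<epsilon> \<le> b" "b < c + \<epsilon> + pi"
        using supp_T_supp_D[OF T] by (auto simp: supp_D_def shift_def c_def y_def a_def b_def)
      have r: "rot (k + 1) p = (y + pi, c + pi)"
        using rot_add[of 1 k p] by (simp add: add.commute rot_def[of 1] c_def y_def)
      have "a \<noteq> y + pi"
      proof
        assume a: "a = y + pi"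
        have "dyadic_interval a (a + h)" using dy[of a k 1] a by (simp add: y_def)
        then have "dyadic_chord a (a + h)" using dyadic_chord_iff by blast
        then show False
          using blocked[OF T, of a "a + h"] D \<epsilon>' hw a
          by (auto simp: shift_def c_def[symmetric] y_def[symmetric] a_def[symmetric] b_def[symmetric])
      qed
      moreover have "b \<noteq> c + pi"
      proof
        assume b: "b = c + pi"
        have "dyadic_interval c (c + h)" using dy[of c k 0] by (simp add: c_def)
        then have "dyadic_chord (c + h) (c + 2 * pi)" using dyadic_chord_iff by simp
        then show False
          using blocked[OF T, of "c + h" "c + 2 * pi"] D \<epsilon>' hw b
          by (auto simp: shift_def c_def[symmetric] y_def[symmetric] a_def[symmetric] b_def[symmetric])
      qed
      ultimately show ?thesis using D \<epsilon> g \<epsilon>' unfolding r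
        by (auto simp: crosses_def a_def[symmetric] b_def[symmetric])
    qed
    have 3: "hom_supp q (shift (rot k p) (- \<epsilon>)) \<and> hom_supp (shift (rot (k - 1) p) \<epsilon>) q"
      if T: "crosses q (rot k p)"
    proof -
      have D: "a < c" "c < b + pi" "b < y" "y < a + pi"
        using T by (auto simp: crosses_def c_def y_def a_def b_def)
      have "rot (k - 1) p = rot (-1) (rot k p)" using rot_add[of "-1" k p] by simp
      then have r: "rot (k - 1) p = (y - pi, c - pi)"
        by (simp add: rot_def[of "-1"] c_def y_def)
      show ?thesis using D \<epsilon>' g unfolding r
        by (auto simp: hom_supp_def shift_def c_def[symmetric] y_def[symmetric] a_def[symmetric] b_def[symmetric])
    qed
    show ?thesis using 1 2 3 by blast
  qed
  moreover have "e' > 0" using e h by (simp add: e'_def)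
  ultimately show ?thesis by blast
qed

text \<open>A chord of the cluster lying between two small translates of \<open>p\<close> in the same direction would
  cross \<open>p\<close>.\<close>

lemma supp_T_near_cluster:
  assumes p: "cluster_lift p"
  shows "\<exists>e>0. \<forall>\<epsilon> \<gamma>. 0 < \<gamma> \<longrightarrow> \<gamma> < \<epsilon> \<longrightarrow> \<epsilon> < e \<longrightarrow>
     supp_T (shift p (- \<epsilon>)) (shift p (- \<gamma>)) \<and> supp_T (shift p \<gamma>) (shift p \<epsilon>)"
proof -
  define w where "w = min (snd p + pi - fst p) (fst p + pi - snd p)"
  have w: "w > 0" using cluster_lift_in_strip[OF p] by (auto simp: w_def in_strip_def)
  have "supp_T (shift p (- \<epsilon>)) (shift p (- \<gamma>)) \<and> supp_T (shift p \<gamma>) (shift p \<epsilon>)"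
    if "0 < \<gamma>" "\<gamma> < \<epsilon>" "\<epsilon> < w" for \<gamma> \<epsilon>
  proof -
    have "supp_D (shift p (- \<epsilon>)) (shift p (- \<gamma>))" "supp_D (shift p \<gamma>) (shift p \<epsilon>)"
      using that by (auto simp: supp_D_def shift_def w_def)
    moreover have "crosses s p" if "hom_supp (shift p (- \<epsilon>)) s" "hom_supp s (shift p (- \<gamma>))" for s
      using that \<open>0 < \<gamma>\<close> \<open>\<gamma> < \<epsilon>\<close> \<open>\<epsilon> < w\<close> by (auto simp: crosses_def hom_supp_def shift_def w_def)
    moreover have "crosses p s" if "hom_supp (shift p \<gamma>) s" "hom_supp s (shift p \<epsilon>)" for s
      using that \<open>0 < \<gamma>\<close> \<open>\<gamma> < \<epsilon>\<close> \<open>\<epsilon> < w\<close> by (auto simp: crosses_def hom_supp_def shift_def w_def)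
    ultimately show ?thesis unfolding supp_T_def using cluster_lift_no_cross p by blast
  qed
  then show ?thesis using w by blast
qed

text \<open>The property behind the duality between \<open>Hom(\<tau>\<^sup>-\<^sup>1S, q)\<close> and \<open>Hom(q, \<tau>S)\<close>: as soon as one of
  the two spaces is nonzero, the composite through \<open>q\<close> is nonzero, and the systems that define the
  two limits are constant from there on.\<close>

definition paired_within :: "point \<Rightarrow> point \<Rightarrow> real \<Rightarrow> bool" where
  "paired_within p q e \<longleftrightarrow> (\<forall>\<epsilon> \<gamma>. 0 < \<epsilon> \<longrightarrow> \<epsilon> < e \<longrightarrow> 0 < \<gamma> \<longrightarrow> \<gamma> < e \<longrightarrow>
     supp_CT q (shift p (- \<epsilon>)) \<or> supp_CT (shift p \<epsilon>) q \<longrightarrow>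
       comp_CT (shift p \<epsilon>) q (shift p (- \<gamma>)) \<and>
       (\<gamma> < \<epsilon> \<longrightarrow> comp_CT q (shift p (- \<epsilon>)) (shift p (- \<gamma>)) \<and> comp_CT (shift p \<gamma>) (shift p \<epsilon>) q))"

text \<open>Either condition on supports forces \<open>q\<close> to cross a lift of \<open>p\<close>, and then all the
  composites lie on the way from just behind one lift of \<open>p\<close> through \<open>q\<close> to just before the next one.\<close>

lemma pairing_near_cluster:
  assumes p: "cluster_lift p" and q: "in_strip q"
  shows "\<exists>e>0. paired_within p q e"
proof -
  obtain e where e: "e > 0" "\<And>\<epsilon> k. 0 < \<epsilon> \<Longrightarrow> \<epsilon> < e \<Longrightarrow>
    (supp_T q (shift (rot k p) (- \<epsilon>)) \<longrightarrow> crosses q (rot k p)) \<and>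
    (supp_T (shift (rot k p) \<epsilon>) q \<longrightarrow> crosses q (rot (k + 1) p)) \<and>
    (crosses q (rot k p) \<longrightarrow> hom_supp q (shift (rot k p) (- \<epsilon>)) \<and> hom_supp (shift (rot (k - 1) p) \<epsilon>) q)"
    using crossing_near_cluster[OF p q] by blast
  have "comp_CT (shift p \<epsilon>) q (shift p (- \<gamma>)) \<and>
        (\<gamma> < \<epsilon> \<longrightarrow> comp_CT q (shift p (- \<epsilon>)) (shift p (- \<gamma>)) \<and> comp_CT (shift p \<gamma>) (shift p \<epsilon>) q)"
    if *: "0 < \<epsilon>" "\<epsilon> < e" "0 < \<gamma>" "\<gamma> < e" and s: "supp_CT q (shift p (- \<epsilon>)) \<or> supp_CT (shift p \<epsilon>) q"
    for \<epsilon> \<gamma>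
  proof -
    from s have "\<exists>k. crosses q (rot k p)"
    proof
      assume "supp_CT q (shift p (- \<epsilon>))"
      then show ?thesis using e(2)[OF *(1,2)] unfolding supp_CT_def shift_rot by blast
    next
      assume "supp_CT (shift p \<epsilon>) q"
      then obtain k where "supp_T (shift p \<epsilon>) (rot k q)" unfolding supp_CT_def by blast
      then have "supp_T (rot (-k) (shift p \<epsilon>)) (rot (-k) (rot k q))" unfolding supp_T_rot by simp
      then have "supp_T (shift (rot (-k) p) \<epsilon>) q" unfolding shift_rot by simp
      then show ?thesis using e(2)[OF *(1,2)] by blast
    qed
    then obtain k where k: "crosses q (rot k p)" by blast
    have t: "cluster_lift (rot k p)" "in_strip (rot k p)" using p cluster_lift_in_strip by simp_all
    have r: "rot (k - 1) p = rot (-1) (rot k p)" using rot_add[of "-1" k p] by simp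
    have h: "hom_supp q (shift (rot k p) (- \<delta>))" "hom_supp (shift (rot (k - 1) p) \<delta>) q"
      if "0 < \<delta>" "\<delta> < e" for \<delta>
      using e(2)[OF that] k by blast+
    have T: "supp_T (shift (rot (k - 1) p) \<delta>) (shift (rot k p) (- \<delta>'))"
      if "0 < \<delta>" "\<delta> < e" "0 < \<delta>'" "\<delta>' < e" for \<delta> \<delta>'
      unfolding r
      by (rule supp_T_around) (use t that h[of \<delta>] h[of \<delta>'] hom_supp_trans r in auto)
    have Tq: "supp_T q (shift (rot k p) (- \<gamma>))" "supp_T (shift (rot (k - 1) p) \<gamma>) q"
      using supp_T_between[OF T[of \<gamma> \<gamma>] h(2)[of \<gamma>] h(1)[of \<gamma>]] * by blast+
    have 1: "comp_CT (shift p \<epsilon>) q (shift p (- \<gamma>))"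
      by (rule comp_CT_I[of "k - 1" _ 0 _ k])
         (use T h * in \<open>simp_all add: shift_rot\<close>)
    have 2: "comp_CT q (shift p (- \<epsilon>)) (shift p (- \<gamma>))" if "\<gamma> < \<epsilon>"
      by (rule comp_CT_I[of 0 _ k _ k])
         (use h * that Tq in \<open>simp_all add: shift_rot hom_supp_shift\<close>)
    have 3: "comp_CT (shift p \<gamma>) (shift p \<epsilon>) q" if "\<gamma> < \<epsilon>"
      by (rule comp_CT_I[of "k - 1" _ "k - 1" _ 0])
         (use h * that Tq in \<open>simp_all add: shift_rot hom_supp_shift\<close>)
    show ?thesis using 1 2 3 by blast
  qed
  then show ?thesis using e(1) unfolding paired_within_def by blast
qed

lemma pairing_near_cluster_finite:
  assumes p: "cluster_lift p" and "finite Q" "\<And>q. q \<in> Q \<Longrightarrow> in_strip q"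
  shows "\<exists>e>0. \<forall>q\<in>Q. paired_within p q e"
  using assms(2,3)
proof (induction Q rule: finite_induct)
  case empty
  show ?case by (intro exI[of _ 1]) simp
next
  case (insert q Q)
  obtain e where e: "e > 0" "\<forall>q\<in>Q. paired_within p q e" using insert by blast
  obtain e' where e': "e' > 0" "paired_within p q e'" using pairing_near_cluster[OF p, of q] insert by blast
  have "paired_within p r (min e e')" if "r \<in> insert q Q" for r
    using that e(2) e'(2) by (auto simp: paired_within_def)
  then show ?case using e(1) e'(1) by (intro exI[of _ "min e e'"]) auto
qed

text \<open>The detecting chord crosses both \<open>p\<close> and \<open>q\<close>, and this rules out every cluster chord through
  which the composite \<open>p \<rightarrow> q \<rightarrow> \<tau>S\<close> could factor.\<close>

lemma basic_morphism_detected_by_cluster: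
  assumes "supp_CT p q" "in_strip q"
  shows "\<exists>t\<in>std_cluster. \<exists>e>0. \<forall>\<epsilon>. 0 < \<epsilon> \<longrightarrow> \<epsilon> < e \<longrightarrow> comp_CT p q (shift t (- \<epsilon>))"
proof -
  obtain k where k: "supp_T p (rot k q)" using assms(1) unfolding supp_CT_def by blast
  obtain s where s: "cluster_lift s" "crosses p s" "crosses (rot k q) s"
    using supp_T_detected[OF k] by blast
  obtain l t where t: "t \<in> std_cluster" "s = rot l t" using cluster_lift_std[OF s(1)] by blast
  obtain e where e: "e > 0" "\<And>\<epsilon> l. 0 < \<epsilon> \<Longrightarrow> \<epsilon> < e \<Longrightarrow>
     crosses (rot k q) (rot l t) \<longrightarrow> hom_supp (rot k q) (shift (rot l t) (- \<epsilon>))"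
    using crossing_near_cluster[OF std_cluster_lift[OF t(1)], of "rot k q"] assms(2) by auto
  have "comp_CT p q (shift t (- \<epsilon>))" if "0 < \<epsilon>" "\<epsilon> < e" for \<epsilon>
  proof -
    have 1: "hom_supp (rot k q) (shift s (- \<epsilon>))" using e(2)[OF that] s(3) t(2) by blast
    have 2: "hom_supp p (rot k q)" using k supp_T_hom_supp by blast
    have 3: "supp_T p (shift s (- \<epsilon>))"
      using crosses_supp_T_to[OF s(1,2) _ that(1)] hom_supp_trans[OF 2 1] by blast
    show ?thesis using 1 2 3 unfolding comp_CT_def t(2) shift_rot[symmetric] by blast
  qed
  then show ?thesis using t(1) e(1) by blast
qed

section \<open>Categories of matrices and their quotients\<close>

definition supported :: "('p \<Rightarrow> 'p \<Rightarrow> bool) \<Rightarrow> 'p list \<Rightarrow> 'p list \<Rightarrow> (nat \<Rightarrow> nat \<Rightarrow> 'k::field) \<Rightarrow> bool" where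
  "supported s X Y A \<longleftrightarrow> (\<forall>j i. A j i \<noteq> 0 \<longrightarrow> i < length X \<and> j < length Y \<and> s (X ! i) (Y ! j))"

text \<open>Matrix multiplication in which the products belonging to non-basic, hence zero, composites of
  basic morphisms are left out.\<close>

definition coeff_comp :: "('p \<Rightarrow> 'p \<Rightarrow> 'p \<Rightarrow> bool) \<Rightarrow> 'p list \<Rightarrow> 'p list \<Rightarrow> 'p list \<Rightarrow>
    (nat \<Rightarrow> nat \<Rightarrow> 'k::field) \<Rightarrow> (nat \<Rightarrow> nat \<Rightarrow> 'k) \<Rightarrow> nat \<Rightarrow> nat \<Rightarrow> 'k" where
  "coeff_comp c X Y Z B A j i = (\<Sum>k<length Y. if c (X ! i) (Y ! k) (Z ! j) then B j k * A k i else 0)"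

definition coeff_id :: "('p \<Rightarrow> 'p \<Rightarrow> bool) \<Rightarrow> 'p list \<Rightarrow> nat \<Rightarrow> nat \<Rightarrow> 'k::field" where
  "coeff_id s X j i = (if j = i \<and> i < length X \<and> s (X ! i) (X ! i) then 1 else 0)"

definition coeff_cut :: "('p \<Rightarrow> 'p \<Rightarrow> bool) \<Rightarrow> 'p list \<Rightarrow> 'p list \<Rightarrow> (nat \<Rightarrow> nat \<Rightarrow> 'k::field) \<Rightarrow> nat \<Rightarrow> nat \<Rightarrow> 'k" where
  "coeff_cut s X Y A j i = (if i < length X \<and> j < length Y \<and> s (X ! i) (Y ! j) then A j i else 0)"

lemma coeff_cut_supported: "supported s X Y (coeff_cut s X Y A)"
  by (simp add: supported_def coeff_cut_def)

lemma coeff_cut_id: "supported s X Y A \<Longrightarrow> coeff_cut s X Y A = A"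
  by (auto simp: supported_def coeff_cut_def fun_eq_iff)

lemma coeff_cut_add: "coeff_cut s X Y (\<lambda>j i. A j i + B j i) = (\<lambda>j i. coeff_cut s X Y A j i + coeff_cut s X Y B j i)"
  by (auto simp: coeff_cut_def fun_eq_iff)

lemma coeff_cut_diff: "coeff_cut s X Y (\<lambda>j i. A j i - B j i) = (\<lambda>j i. coeff_cut s X Y A j i - coeff_cut s X Y B j i)"
  by (auto simp: coeff_cut_def fun_eq_iff)

lemma supported_diff: "supported s X Y A \<Longrightarrow> supported s X Y B \<Longrightarrow> supported s X Y (\<lambda>j i. A j i - B j i)"
  unfolding supported_def by (metis diff_self)

lemma supported_zero: "supported s X Y (\<lambda>j i. 0)"
  by (simp add: supported_def)

text \<open>Here \<open>s p q\<close> says that the basic morphism \<open>p \<rightarrow> q\<close> is nonzero, and \<open>c p q r\<close> that the composite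
  of \<open>p \<rightarrow> q\<close> and \<open>q \<rightarrow> r\<close> is the nonzero basic morphism \<open>p \<rightarrow> r\<close>. Any other composite vanishes.
  In an orbit category \<open>c\<close> is not determined by \<open>s\<close>: a composite of nonzero morphisms can lie in
  the wrong degree and vanish although \<open>s p r\<close> holds.\<close>

locale basic_morphisms =
  fixes V :: "'p set" and s :: "'p \<Rightarrow> 'p \<Rightarrow> bool" and c :: "'p \<Rightarrow> 'p \<Rightarrow> 'p \<Rightarrow> bool"
  assumes comp_supp: "p \<in> V \<Longrightarrow> q \<in> V \<Longrightarrow> r \<in> V \<Longrightarrow> c p q r \<Longrightarrow> s p q \<and> s q r \<and> s p r"
    and comp_unit: "p \<in> V \<Longrightarrow> q \<in> V \<Longrightarrow> s p q \<Longrightarrow> c p p q \<and> c p q q"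
    and comp_assoc: "p \<in> V \<Longrightarrow> q \<in> V \<Longrightarrow> r \<in> V \<Longrightarrow> t \<in> V \<Longrightarrow>
      (c p q r \<and> c p r t) = (c q r t \<and> c p q t)"
begin

lemma coeff_comp_assoc:
  assumes V: "set X \<subseteq> V" "set Y \<subseteq> V" "set Z \<subseteq> V" "set W \<subseteq> V"
    and S: "supported s X Y A" "supported s Z W D"
  shows "coeff_comp c X Z W D (coeff_comp c X Y Z B A) = coeff_comp c X Y W (coeff_comp c Y Z W D B) A"
proof (intro ext)
  fix j i
  show "coeff_comp c X Z W D (coeff_comp c X Y Z B A) j i = coeff_comp c X Y W (coeff_comp c Y Z W D B) A j i"
  proof (cases "i < length X \<and> j < length W")
    case True
    have *: "(c (X ! i) (Z ! k) (W ! j) \<and> c (X ! i) (Y ! l) (Z ! k)) =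
        (c (X ! i) (Y ! l) (W ! j) \<and> c (Y ! l) (Z ! k) (W ! j))" if "k < length Z" "l < length Y" for k l
      using comp_assoc[of "X ! i" "Y ! l" "Z ! k" "W ! j"] V True that by (auto simp: subset_iff)
    have "coeff_comp c X Z W D (coeff_comp c X Y Z B A) j i =
       (\<Sum>k<length Z. \<Sum>l<length Y. if c (X ! i) (Z ! k) (W ! j) \<and> c (X ! i) (Y ! l) (Z ! k) then D j k * B k l * A l i else 0)"
      unfolding coeff_comp_def by (intro sum.cong refl) (auto simp: sum_distrib_left mult.assoc intro!: sum.cong)
    also have "\<dots> = (\<Sum>k<length Z. \<Sum>l<length Y. if c (X ! i) (Y ! l) (W ! j) \<and> c (Y ! l) (Z ! k) (W ! j) then D j k * B k l * A l i else 0)"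
      by (intro sum.cong refl) (simp only: * lessThan_iff)
    also have "\<dots> = (\<Sum>l<length Y. \<Sum>k<length Z. if c (X ! i) (Y ! l) (W ! j) \<and> c (Y ! l) (Z ! k) (W ! j) then D j k * B k l * A l i else 0)"
      by (rule sum.swap)
    also have "\<dots> = coeff_comp c X Y W (coeff_comp c Y Z W D B) A j i"
      unfolding coeff_comp_def by (intro sum.cong refl) (auto simp: sum_distrib_right intro!: sum.cong)
    finally show ?thesis .
  next
    case False
    then have "(\<forall>k. A k i = 0) \<or> (\<forall>k. D j k = 0)" using S unfolding supported_def by blast
    then show ?thesis by (auto simp: coeff_comp_def cong: if_cong)
  qed
qed

lemma coeff_comp_id_right:
  assumes "set X \<subseteq> V" "set Y \<subseteq> V" "supported s X Y A"
  shows "coeff_comp c X X Y A (coeff_id s X) = A"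
proof (intro ext)
  fix j i
  show "coeff_comp c X X Y A (coeff_id s X) j i = A j i"
  proof (cases "A j i = 0")
    case True
    then show ?thesis by (auto simp: coeff_comp_def coeff_id_def intro!: sum.neutral)
  next
    case False
    then have *: "i < length X" "j < length Y" "s (X ! i) (Y ! j)" using assms(3) by (auto simp: supported_def)
    then have "X ! i \<in> V" "Y ! j \<in> V" using assms by (auto simp: subset_iff)
    then have "c (X ! i) (X ! i) (Y ! j)" "s (X ! i) (X ! i)"
      using comp_unit[of "X ! i" "Y ! j"] comp_supp[of "X ! i" "X ! i" "Y ! j"] * by blast+
    then have "coeff_comp c X X Y A (coeff_id s X) j i = (\<Sum>k<length X. if k = i then A j i else 0)"
      unfolding coeff_comp_def coeff_id_def by (intro sum.cong refl) (use * in auto)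
    then show ?thesis using * by simp
  qed
qed

definition quot_supp :: "'p set \<Rightarrow> 'p \<Rightarrow> 'p \<Rightarrow> bool" where
  "quot_supp Q p q \<longleftrightarrow> s p q \<and> \<not> (\<exists>z\<in>Q. c p z q)"

definition quot_comp :: "'p set \<Rightarrow> 'p \<Rightarrow> 'p \<Rightarrow> 'p \<Rightarrow> bool" where
  "quot_comp Q p q r \<longleftrightarrow> c p q r \<and> quot_supp Q p r"

text \<open>Factors of a morphism outside of an ideal are outside of the ideal.\<close>

lemma quot_supp_comp:
  assumes "Q \<subseteq> V" "p \<in> V" "q \<in> V" "r \<in> V" "c p q r" "quot_supp Q p r"
  shows "quot_supp Q p q \<and> quot_supp Q q r"
proof -
  have "\<not> c p z q" if "z \<in> Q" for z
    using comp_assoc[of p z q r] that assms unfolding quot_supp_def by blast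
  moreover have "\<not> c q z r" if "z \<in> Q" for z
    using comp_assoc[of p q z r] that assms unfolding quot_supp_def by blast
  ultimately show ?thesis using comp_supp[of p q r] assms unfolding quot_supp_def by blast
qed

lemma quot_basic_morphisms:
  assumes "Q \<subseteq> V" shows "basic_morphisms V (quot_supp Q) (quot_comp Q)"
proof
  fix p q r assume "p \<in> V" "q \<in> V" "r \<in> V" "quot_comp Q p q r"
  then show "quot_supp Q p q \<and> quot_supp Q q r \<and> quot_supp Q p r"
    using quot_supp_comp[OF assms] unfolding quot_comp_def by blast
next
  fix p q assume "p \<in> V" "q \<in> V" "quot_supp Q p q"
  then show "quot_comp Q p p q \<and> quot_comp Q p q q"
    using comp_unit unfolding quot_comp_def quot_supp_def by blast
next
  fix p q r t assume "p \<in> V" "q \<in> V" "r \<in> V" "t \<in> V"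
  then show "(quot_comp Q p q r \<and> quot_comp Q p r t) = (quot_comp Q q r t \<and> quot_comp Q p q t)"
    using comp_assoc quot_supp_comp[OF assms, of p r t] quot_supp_comp[OF assms, of p q t]
    unfolding quot_comp_def by blast
qed

lemma coeff_cut_coeff_comp:
  assumes Q: "Q \<subseteq> V" and V: "set X \<subseteq> V" "set Y \<subseteq> V" "set Z \<subseteq> V"
  shows "coeff_cut (quot_supp Q) X Z (coeff_comp c X Y Z B A) =
    coeff_comp (quot_comp Q) X Y Z (coeff_cut (quot_supp Q) Y Z B) (coeff_cut (quot_supp Q) X Y A)"
proof (intro ext)
  fix j i
  show "coeff_cut (quot_supp Q) X Z (coeff_comp c X Y Z B A) j i =
    coeff_comp (quot_comp Q) X Y Z (coeff_cut (quot_supp Q) Y Z B) (coeff_cut (quot_supp Q) X Y A) j i"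
  proof (cases "i < length X \<and> j < length Z")
    case True
    show ?thesis
    proof (cases "quot_supp Q (X ! i) (Z ! j)")
      case s: True
      have "(if c (X ! i) (Y ! k) (Z ! j) then B j k * A k i else 0) =
        (if quot_comp Q (X ! i) (Y ! k) (Z ! j)
         then coeff_cut (quot_supp Q) Y Z B j k * coeff_cut (quot_supp Q) X Y A k i else 0)"
        if k: "k < length Y" for k
        using quot_supp_comp[OF Q, of "X ! i" "Y ! k" "Z ! j"] k True s V
        by (auto simp: quot_comp_def coeff_cut_def subset_iff)
      then show ?thesis using True s unfolding coeff_cut_def[of _ X Z] coeff_comp_def by simp
    next
      case False
      then show ?thesis by (simp add: coeff_cut_def coeff_comp_def quot_comp_def)
    qed
  next
    case False
    then show ?thesis by (auto simp: coeff_cut_def coeff_comp_def intro!: sum.neutral)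
  qed
qed

end

text \<open>The function \<open>ev X Y\<close> reads off the coefficients of a morphism with respect to the basic morphisms
  between the summands of \<open>X\<close> and \<open>Y\<close>.\<close>

locale matrix_model = basic_morphisms V s c
  for V :: "'p set" and s c +
  fixes C :: "('k::field, 'p list, 'm) lin_cat" and ev :: "'p list \<Rightarrow> 'p list \<Rightarrow> 'm \<Rightarrow> nat \<Rightarrow> nat \<Rightarrow> 'k"
  assumes Obj_iff: "X \<in> Obj C \<longleftrightarrow> set X \<subseteq> V"
    and ev_bij: "X \<in> Obj C \<Longrightarrow> Y \<in> Obj C \<Longrightarrow> bij_betw (ev X Y) (carrier (Hom C X Y)) {A. supported s X Y A}"
    and zero_mor: "X \<in> Obj C \<Longrightarrow> Y \<in> Obj C \<Longrightarrow>
      \<zero>\<^bsub>Hom C X Y\<^esub> \<in> carrier (Hom C X Y) \<and> ev X Y \<zero>\<^bsub>Hom C X Y\<^esub> = (\<lambda>j i. 0)"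
    and add_mor: "X \<in> Obj C \<Longrightarrow> Y \<in> Obj C \<Longrightarrow> f \<in> carrier (Hom C X Y) \<Longrightarrow> g \<in> carrier (Hom C X Y) \<Longrightarrow>
      f \<oplus>\<^bsub>Hom C X Y\<^esub> g \<in> carrier (Hom C X Y) \<and>
      ev X Y (f \<oplus>\<^bsub>Hom C X Y\<^esub> g) = (\<lambda>j i. ev X Y f j i + ev X Y g j i)"
    and id_mor: "X \<in> Obj C \<Longrightarrow> Idn C X \<in> carrier (Hom C X X) \<and> ev X X (Idn C X) = coeff_id s X"
    and comp_mor: "X \<in> Obj C \<Longrightarrow> Y \<in> Obj C \<Longrightarrow> Z \<in> Obj C \<Longrightarrow>
      f \<in> carrier (Hom C X Y) \<Longrightarrow> g \<in> carrier (Hom C Y Z) \<Longrightarrow>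
      Comp C X Y Z g f \<in> carrier (Hom C X Z) \<and>
      ev X Z (Comp C X Y Z g f) = coeff_comp c X Y Z (ev Y Z g) (ev X Y f)"
begin

lemma ev_supported: "X \<in> Obj C \<Longrightarrow> Y \<in> Obj C \<Longrightarrow> f \<in> carrier (Hom C X Y) \<Longrightarrow> supported s X Y (ev X Y f)"
  using ev_bij unfolding bij_betw_def by blast

lemma ev_eqI: "X \<in> Obj C \<Longrightarrow> Y \<in> Obj C \<Longrightarrow> f \<in> carrier (Hom C X Y) \<Longrightarrow> g \<in> carrier (Hom C X Y) \<Longrightarrow>
   ev X Y f = ev X Y g \<Longrightarrow> f = g"
  using ev_bij unfolding bij_betw_def inj_on_def by blast

lemma ev_obtain:
  assumes "X \<in> Obj C" "Y \<in> Obj C" "supported s X Y A"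
  obtains f where "f \<in> carrier (Hom C X Y)" "ev X Y f = A"
  using ev_bij[OF assms(1,2)] assms(3) unfolding bij_betw_def by (metis imageE mem_Collect_eq)

lemma comp_assoc_mor:
  assumes "X \<in> Obj C" "Y \<in> Obj C" "Z \<in> Obj C" "W \<in> Obj C"
    "f \<in> carrier (Hom C X Y)" "g \<in> carrier (Hom C Y Z)" "h \<in> carrier (Hom C Z W)"
  shows "Comp C X Z W h (Comp C X Y Z g f) = Comp C X Y W (Comp C Y Z W h g) f"
proof (rule ev_eqI[OF assms(1,4)])
  note gf = comp_mor[OF assms(1-3,5,6)] and hg = comp_mor[OF assms(2-4,6,7)]
  note hgf = comp_mor[OF assms(1,3,4) gf[THEN conjunct1] assms(7)]
    and hgf' = comp_mor[OF assms(1,2,4,5) hg[THEN conjunct1]]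
  show "Comp C X Z W h (Comp C X Y Z g f) \<in> carrier (Hom C X W)"
    "Comp C X Y W (Comp C Y Z W h g) f \<in> carrier (Hom C X W)"
    using hgf hgf' by simp_all
  show "ev X W (Comp C X Z W h (Comp C X Y Z g f)) = ev X W (Comp C X Y W (Comp C Y Z W h g) f)"
    using gf hg hgf hgf' coeff_comp_assoc[of X Y Z W] assms(1-4) Obj_iff
      ev_supported[OF assms(1,2,5)] ev_supported[OF assms(3,4,7)] by simp
qed

lemma comp_id_mor:
  assumes "X \<in> Obj C" "Y \<in> Obj C" "f \<in> carrier (Hom C X Y)"
  shows "Comp C X X Y f (Idn C X) = f"
proof (rule ev_eqI[OF assms(1,2)])
  note f1 = comp_mor[OF assms(1,1,2) id_mor[OF assms(1), THEN conjunct1] assms(3)]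
  show "Comp C X X Y f (Idn C X) \<in> carrier (Hom C X Y)" using f1 by simp
  show "ev X Y (Comp C X X Y f (Idn C X)) = ev X Y f"
    using f1 id_mor[OF assms(1)] coeff_comp_id_right[OF _ _ ev_supported[OF assms]] assms Obj_iff by simp
qed (fact assms)

lemma abelian_monoid_Hom:
  assumes X: "X \<in> Obj C" "Y \<in> Obj C" shows "abelian_monoid (Hom C X Y)"
proof (rule abelian_monoidI)
  show "x \<oplus>\<^bsub>Hom C X Y\<^esub> y \<oplus>\<^bsub>Hom C X Y\<^esub> z = x \<oplus>\<^bsub>Hom C X Y\<^esub> (y \<oplus>\<^bsub>Hom C X Y\<^esub> z)"
    if "x \<in> carrier (Hom C X Y)" "y \<in> carrier (Hom C X Y)" "z \<in> carrier (Hom C X Y)" for x y z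
    by (rule ev_eqI[OF X]) (use that add_mor[OF X] in \<open>simp_all add: add.assoc\<close>)
  show "\<zero>\<^bsub>Hom C X Y\<^esub> \<oplus>\<^bsub>Hom C X Y\<^esub> x = x" if "x \<in> carrier (Hom C X Y)" for x
    by (rule ev_eqI[OF X]) (use that add_mor[OF X] zero_mor[OF X] in simp_all)
  show "x \<oplus>\<^bsub>Hom C X Y\<^esub> y = y \<oplus>\<^bsub>Hom C X Y\<^esub> x"
    if "x \<in> carrier (Hom C X Y)" "y \<in> carrier (Hom C X Y)" for x y
    by (rule ev_eqI[OF X]) (use that add_mor[OF X] in \<open>simp_all add: add.commute\<close>)
qed (use add_mor[OF X] zero_mor[OF X] in simp_all)

lemma finsum_mor:
  assumes X: "X \<in> Obj C" "Y \<in> Obj C" and "finite S" "\<And>a. a \<in> S \<Longrightarrow> f a \<in> carrier (Hom C X Y)"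
  shows "finsum (Hom C X Y) f S \<in> carrier (Hom C X Y) \<and>
    ev X Y (finsum (Hom C X Y) f S) = (\<lambda>j i. \<Sum>a\<in>S. ev X Y (f a) j i)"
  using assms(3,4)
proof (induction S rule: finite_induct)
  case empty
  interpret abelian_monoid "Hom C X Y" by (rule abelian_monoid_Hom[OF X])
  show ?case using zero_mor[OF X] by simp
next
  case (insert a S)
  interpret abelian_monoid "Hom C X Y" by (rule abelian_monoid_Hom[OF X])
  have "finsum (Hom C X Y) f (insert a S) = f a \<oplus>\<^bsub>Hom C X Y\<^esub> finsum (Hom C X Y) f S"
    using insert by (intro finsum_insert) auto
  then show ?case using insert add_mor[OF X] by simp
qed

definition quot_ev :: "'p set \<Rightarrow> 'p list \<Rightarrow> 'p list \<Rightarrow> 'm set \<Rightarrow> nat \<Rightarrow> nat \<Rightarrow> 'k" where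
  "quot_ev Q X Y F = coeff_cut (quot_supp Q) X Y (ev X Y (SOME f. f \<in> F))"

end

text \<open>The objects in \<open>P\<close> only have to be retracts of sums of points of \<open>Q\<close>; this covers classes of
  objects that are closed under isomorphism.\<close>

locale quotient_model = matrix_model V s c C ev
  for V :: "'p set" and s c and C :: "('k::field, 'p list, 'm) lin_cat" and ev +
  fixes P :: "'p list set" and Q :: "'p set"
  assumes Q_sub: "Q \<subseteq> V" and Q_ne: "Q \<noteq> {}" and Q_P: "\<And>Z. set Z \<subseteq> Q \<Longrightarrow> Z \<in> P"
    and P_retract: "\<And>Z. Z \<in> P \<Longrightarrow> Z \<in> Obj C \<and> (\<exists>Z'. set Z' \<subseteq> Q \<and>
      (\<exists>u\<in>carrier (Hom C Z Z'). \<exists>v\<in>carrier (Hom C Z' Z). Comp C Z Z' Z v u = Idn C Z))"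
begin

abbreviation "s' \<equiv> quot_supp Q"
abbreviation "c' \<equiv> quot_comp Q"
abbreviation "tr X Y f \<equiv> coeff_cut s' X Y (ev X Y f)"

lemma tr_comp:
  assumes X: "X \<in> Obj C" "Y \<in> Obj C" "Z \<in> Obj C" and f: "f \<in> carrier (Hom C X Y)" "g \<in> carrier (Hom C Y Z)"
  shows "tr X Z (Comp C X Y Z g f) = coeff_comp c' X Y Z (tr Y Z g) (tr X Y f)"
  using comp_mor[OF X f] coeff_cut_coeff_comp[OF Q_sub] X Obj_iff by simp

lemma factor_through_Q:
  assumes "X \<in> Obj C" "Y \<in> Obj C" "set Z \<subseteq> Q" "f \<in> carrier (Hom C X Z)" "g \<in> carrier (Hom C Z Y)"
  shows "tr X Y (Comp C X Z Y g f) = (\<lambda>j i. 0)"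
proof -
  have Z: "Z \<in> Obj C" using assms(3) Q_sub Obj_iff by blast
  have "\<not> c' (X ! i) (Z ! k) (Y ! j)" if "k < length Z" for i j k
    using that assms(3) unfolding quot_comp_def quot_supp_def by (metis nth_mem subset_iff)
  then have "coeff_comp c' X Z Y B A = (\<lambda>j i. 0)" for A B :: "nat \<Rightarrow> nat \<Rightarrow> 'k"
    by (simp add: coeff_comp_def fun_eq_iff)
  then show ?thesis using tr_comp[OF assms(1) Z assms(2,4,5)] by simp
qed

lemma factor_ideal_subset:
  assumes X: "X \<in> Obj C" "Y \<in> Obj C" and h: "h \<in> factor_ideal C P X Y"
  shows "h \<in> carrier (Hom C X Y) \<and> tr X Y h = (\<lambda>j i. 0)"
proof -
  obtain Z f g where Z: "Z \<in> P" "f \<in> carrier (Hom C X Z)" "g \<in> carrier (Hom C Z Y)" "h = Comp C X Z Y g f"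
    using h unfolding factor_ideal_def by blast
  obtain Z' u v where Z': "Z \<in> Obj C" "set Z' \<subseteq> Q" "u \<in> carrier (Hom C Z Z')" "v \<in> carrier (Hom C Z' Z)"
    "Comp C Z Z' Z v u = Idn C Z" using P_retract[OF Z(1)] by blast
  have O: "Z' \<in> Obj C" using Z'(2) Q_sub Obj_iff by blast
  have gvu: "g = Comp C Z Z' Y (Comp C Z' Z Y g v) u"
    using comp_assoc_mor[OF Z'(1) O Z'(1) X(2) Z'(3,4) Z(3)] Z'(5) comp_id_mor[OF Z'(1) X(2) Z(3)] by simp
  have "h = Comp C X Z' Y (Comp C Z' Z Y g v) (Comp C X Z Z' u f)"
    unfolding Z(4)
    by (subst gvu, rule comp_assoc_mor[symmetric])
       (use X Z' O Z comp_mor in blast)+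
  moreover have "Comp C Z' Z Y g v \<in> carrier (Hom C Z' Y)" "Comp C X Z Z' u f \<in> carrier (Hom C X Z')"
    using comp_mor X Z Z' O by blast+
  ultimately show ?thesis using factor_through_Q[OF X Z'(2)] comp_mor X O by simp
qed

text \<open>The coefficients of \<open>h\<close> are supported on pairs \<open>(j, i)\<close> for which some point of \<open>Q\<close> lies between
  \<open>X\<^sub>i\<close> and \<open>Y\<^sub>j\<close>. The direct sum of one such point for each pair, in the order given by
  \<open>k = j n + i\<close>, is an object through which \<open>h\<close> factors.\<close>

lemma factor_ideal_superset:
  assumes X: "X \<in> Obj C" "Y \<in> Obj C" and h: "h \<in> carrier (Hom C X Y)" "tr X Y h = (\<lambda>j i. 0)"
  shows "h \<in> factor_ideal C P X Y"
proof -
  define m n where "m = length Y" and "n = length X"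
  define H where "H = ev X Y h"
  have Hs: "supported s X Y H" using ev_supported X h by (simp add: H_def)
  obtain z0 where z0: "z0 \<in> Q" using Q_ne by blast
  define z where "z j i = (if \<exists>z\<in>Q. c (X ! i) z (Y ! j) then SOME z. z \<in> Q \<and> c (X ! i) z (Y ! j) else z0)" for j i
  have zQ: "z j i \<in> Q" for j i
    unfolding z_def using z0 someI_ex[of "\<lambda>z. z \<in> Q \<and> c (X ! i) z (Y ! j)"] by auto
  have zc: "c (X ! i) (z j i) (Y ! j)" if "H j i \<noteq> 0" for j i
  proof -
    have ij: "i < length X" "j < length Y" "s (X ! i) (Y ! j)" using Hs that by (auto simp: supported_def)
    have "tr X Y h j i = 0" using h(2) by simp
    then have "\<not> s' (X ! i) (Y ! j)" using ij that by (auto simp: coeff_cut_def H_def)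
    then have "\<exists>z\<in>Q. c (X ! i) z (Y ! j)" using ij unfolding quot_supp_def by blast
    then show ?thesis
      unfolding z_def using someI_ex[of "\<lambda>z. z \<in> Q \<and> c (X ! i) z (Y ! j)"] by auto
  qed
  define Z where "Z = map (\<lambda>k. z (k div n) (k mod n)) [0..<m * n]"
  have lenZ: "length Z = m * n" by (simp add: Z_def)
  have nthZ: "Z ! k = z (k div n) (k mod n)" if "k < m * n" for k using that by (simp add: Z_def)
  have ZQ: "set Z \<subseteq> Q" using zQ by (auto simp: Z_def)
  then have ZO: "Z \<in> Obj C" and ZV: "set Z \<subseteq> V" using Q_sub Obj_iff by blast+
  define A where "A k i = (if k < m * n \<and> i = k mod n \<and> H (k div n) i \<noteq> 0 then 1 else (0::'k))" for k i
  define B where "B j k = (if k < m * n \<and> j = k div n then H j (k mod n) else 0)" for j k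
  have zs: "s (X ! i) (z j i) \<and> s (z j i) (Y ! j) \<and> i < n \<and> j < m" if "H j i \<noteq> 0" for j i
  proof -
    have ij: "i < n" "j < m" using Hs that by (auto simp: supported_def m_def n_def)
    then have "X ! i \<in> V" "Y ! j \<in> V" "z j i \<in> V" using X Obj_iff Q_sub zQ
      by (auto simp: subset_iff m_def n_def)
    then show ?thesis using comp_supp zc[OF that] ij by blast
  qed
  have A: "supported s X Z A" unfolding supported_def
  proof (intro allI impI)
    fix k i assume "A k i \<noteq> 0"
    then have *: "k < m * n" "i = k mod n" "H (k div n) i \<noteq> 0" by (auto simp: A_def split: if_splits)
    show "i < length X \<and> k < length Z \<and> s (X ! i) (Z ! k)"
      using zs[OF *(3)] * nthZ[OF *(1)] lenZ by (simp add: n_def)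
  qed
  have B: "supported s Z Y B" unfolding supported_def
  proof (intro allI impI)
    fix j k assume "B j k \<noteq> 0"
    then have *: "k < m * n" "j = k div n" "H j (k mod n) \<noteq> 0" by (auto simp: B_def split: if_splits)
    show "k < length Z \<and> j < length Y \<and> s (Z ! k) (Y ! j)"
      using zs[OF *(3)] * nthZ[OF *(1)] lenZ by (simp add: m_def)
  qed
  obtain f where f: "f \<in> carrier (Hom C X Z)" "ev X Z f = A" using ev_obtain[OF X(1) ZO A] .
  obtain g where g: "g \<in> carrier (Hom C Z Y)" "ev Z Y g = B" using ev_obtain[OF ZO X(2) B] .
  have "coeff_comp c X Z Y B A j i = H j i" for j i
  proof (cases "H j i = 0")
    case True
    have "(if c (X ! i) (Z ! k) (Y ! j) then B j k * A k i else 0) = 0" for k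
      using True by (auto simp: A_def B_def)
    then show ?thesis using True by (simp add: coeff_comp_def)
  next
    case False
    have ij: "i < n" "j < m" using zs[OF False] by auto
    \<comment> \<open>The only middle summand that contributes to the entry \<open>(j, i)\<close>.\<close>
    define k0 where "k0 = j * n + i"
    have "(j + 1) * n \<le> m * n" using ij(2) by (intro mult_right_mono) auto
    then have k0: "k0 < m * n" "k0 div n = j" "k0 mod n = i" using ij by (auto simp: k0_def)
    have "(if c (X ! i) (Z ! k) (Y ! j) then B j k * A k i else 0) = (if k = k0 then H j i else 0)"
      if k: "k < m * n" for k
    proof (cases "k = k0")
      case True
      then show ?thesis using k0 zc[OF False] nthZ[OF k0(1)] False by (simp add: A_def B_def)
    next
      case ne: False
      then have "\<not> (j = k div n \<and> i = k mod n)" using div_mult_mod_eq[of k n] k0_def by metis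
      then show ?thesis using ne by (auto simp: A_def B_def)
    qed
    then show ?thesis using k0(1) unfolding coeff_comp_def lenZ by simp
  qed
  then have "ev X Y (Comp C X Z Y g f) = ev X Y h"
    using comp_mor[OF X(1) ZO X(2) f(1) g(1)] f g by (auto simp: H_def fun_eq_iff)
  then have "h = Comp C X Z Y g f"
    using ev_eqI[OF X h(1)] comp_mor[OF X(1) ZO X(2) f(1) g(1)] by simp
  then show ?thesis unfolding factor_ideal_def using Q_P[OF ZQ] f(1) g(1) by blast
qed

lemma factor_ideal_eq:
  assumes "X \<in> Obj C" "Y \<in> Obj C"
  shows "factor_ideal C P X Y = {h \<in> carrier (Hom C X Y). tr X Y h = (\<lambda>j i. 0)}"
  using factor_ideal_subset[OF assms] factor_ideal_superset[OF assms] by blast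

lemma mor_diff:
  assumes X: "X \<in> Obj C" "Y \<in> Obj C" and "h \<in> carrier (Hom C X Y)" "f \<in> carrier (Hom C X Y)"
  obtains d where "d \<in> carrier (Hom C X Y)" "d \<oplus>\<^bsub>Hom C X Y\<^esub> f = h"
    "ev X Y d = (\<lambda>j i. ev X Y h j i - ev X Y f j i)"
proof -
  have "supported s X Y (\<lambda>j i. ev X Y h j i - ev X Y f j i)"
    using assms ev_supported supported_diff by blast
  then obtain d where d: "d \<in> carrier (Hom C X Y)" "ev X Y d = (\<lambda>j i. ev X Y h j i - ev X Y f j i)"
    using ev_obtain[OF X] by blast
  moreover have "d \<oplus>\<^bsub>Hom C X Y\<^esub> f = h"
    by (rule ev_eqI[OF X]) (use add_mor[OF X d(1) assms(4)] assms d in simp_all)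
  ultimately show ?thesis using that by blast
qed

lemma quot_mor_eq:
  assumes X: "X \<in> Obj C" "Y \<in> Obj C" and f: "f \<in> carrier (Hom C X Y)"
  shows "quot_mor C P X Y f = {h \<in> carrier (Hom C X Y). tr X Y h = tr X Y f}"
proof (intro equalityI subsetI)
  fix h assume "h \<in> quot_mor C P X Y f"
  then obtain k where k: "k \<in> carrier (Hom C X Y)" "tr X Y k = (\<lambda>j i. 0)" "h = k \<oplus>\<^bsub>Hom C X Y\<^esub> f"
    unfolding quot_mor_def a_r_coset_def' factor_ideal_eq[OF X] by blast
  then show "h \<in> {h \<in> carrier (Hom C X Y). tr X Y h = tr X Y f}"
    using add_mor[OF X k(1) f] k(2,3) by (simp add: coeff_cut_add)
next
  fix h assume h: "h \<in> {h \<in> carrier (Hom C X Y). tr X Y h = tr X Y f}"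
  then obtain d where d: "d \<in> carrier (Hom C X Y)" "d \<oplus>\<^bsub>Hom C X Y\<^esub> f = h"
    "ev X Y d = (\<lambda>j i. ev X Y h j i - ev X Y f j i)" using mor_diff[OF X _ f] by blast
  then have "tr X Y d = (\<lambda>j i. 0)" using h by (simp add: coeff_cut_diff)
  then show "h \<in> quot_mor C P X Y f"
    unfolding quot_mor_def a_r_coset_def' factor_ideal_eq[OF X] using d by blast
qed

lemma quot_ev_quot_mor:
  assumes X: "X \<in> Obj C" "Y \<in> Obj C" and f: "f \<in> carrier (Hom C X Y)"
  shows "quot_ev Q X Y (quot_mor C P X Y f) = tr X Y f"
proof -
  have "f \<in> quot_mor C P X Y f" using quot_mor_eq[OF assms] f by simp
  then have "(SOME g. g \<in> quot_mor C P X Y f) \<in> quot_mor C P X Y f" by (metis someI)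
  then show ?thesis unfolding quot_ev_def using quot_mor_eq[OF assms] by simp
qed

lemma Obj_quot [simp]: "Obj (quot_cat C P) = Obj C"
  by (simp add: quot_cat_def)

lemma carrier_quot: "carrier (Hom (quot_cat C P) X Y) = quot_mor C P X Y ` carrier (Hom C X Y)"
  by (simp add: quot_cat_def)

lemma quot_add:
  assumes X: "X \<in> Obj C" "Y \<in> Obj C" and f: "f \<in> carrier (Hom C X Y)" "g \<in> carrier (Hom C X Y)"
  shows "quot_mor C P X Y f \<oplus>\<^bsub>Hom (quot_cat C P) X Y\<^esub> quot_mor C P X Y g = quot_mor C P X Y (f \<oplus>\<^bsub>Hom C X Y\<^esub> g)"
proof -
  have fg: "f \<oplus>\<^bsub>Hom C X Y\<^esub> g \<in> carrier (Hom C X Y)"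
    "tr X Y (f \<oplus>\<^bsub>Hom C X Y\<^esub> g) = (\<lambda>j i. tr X Y f j i + tr X Y g j i)"
    using add_mor[OF X f] by (simp_all add: coeff_cut_add)
  have "quot_mor C P X Y f <+>\<^bsub>Hom C X Y\<^esub> quot_mor C P X Y g = quot_mor C P X Y (f \<oplus>\<^bsub>Hom C X Y\<^esub> g)"
  proof (intro equalityI subsetI)
    fix h assume "h \<in> quot_mor C P X Y f <+>\<^bsub>Hom C X Y\<^esub> quot_mor C P X Y g"
    then obtain a b where ab: "a \<in> quot_mor C P X Y f" "b \<in> quot_mor C P X Y g" "h = a \<oplus>\<^bsub>Hom C X Y\<^esub> b"
      unfolding set_add_def' by blast
    then have "a \<in> carrier (Hom C X Y)" "b \<in> carrier (Hom C X Y)" "tr X Y a = tr X Y f" "tr X Y b = tr X Y g"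
      using quot_mor_eq[OF X f(1)] quot_mor_eq[OF X f(2)] by auto
    then show "h \<in> quot_mor C P X Y (f \<oplus>\<^bsub>Hom C X Y\<^esub> g)"
      unfolding quot_mor_eq[OF X fg(1)] fg(2) ab(3) using add_mor[OF X, of a b] by (simp add: coeff_cut_add)
  next
    fix h assume "h \<in> quot_mor C P X Y (f \<oplus>\<^bsub>Hom C X Y\<^esub> g)"
    then have h: "h \<in> carrier (Hom C X Y)" "tr X Y h = (\<lambda>j i. tr X Y f j i + tr X Y g j i)"
      using quot_mor_eq[OF X fg(1)] fg(2) by auto
    obtain d where d: "d \<in> carrier (Hom C X Y)" "d \<oplus>\<^bsub>Hom C X Y\<^esub> g = h"
      "ev X Y d = (\<lambda>j i. ev X Y h j i - ev X Y g j i)" using mor_diff[OF X h(1) f(2)] by blast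
    then have "tr X Y d = tr X Y f" using h(2) by (simp add: coeff_cut_diff)
    then have "d \<in> quot_mor C P X Y f" "g \<in> quot_mor C P X Y g"
      using d(1) f(2) quot_mor_eq[OF X f(1)] quot_mor_eq[OF X f(2)] by auto
    then show "h \<in> quot_mor C P X Y f <+>\<^bsub>Hom C X Y\<^esub> quot_mor C P X Y g"
      unfolding set_add_def' using d(2) by blast
  qed
  then show ?thesis by (simp add: quot_cat_def)
qed

lemma quot_mor_cong:
  assumes X: "X \<in> Obj C" "Y \<in> Obj C" and f: "f \<in> carrier (Hom C X Y)" "g \<in> carrier (Hom C X Y)"
  shows "quot_mor C P X Y f = quot_mor C P X Y g \<longleftrightarrow> tr X Y f = tr X Y g"
  using quot_mor_eq[OF X f(1)] quot_mor_eq[OF X f(2)] f by auto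

lemma quot_Comp:
  assumes X: "X \<in> Obj C" "Y \<in> Obj C" "Z \<in> Obj C" and f: "f \<in> carrier (Hom C X Y)" "g \<in> carrier (Hom C Y Z)"
  shows "Comp (quot_cat C P) X Y Z (quot_mor C P Y Z g) (quot_mor C P X Y f) = quot_mor C P X Z (Comp C X Y Z g f)"
proof -
  have "quot_mor C P X Z (Comp C X Y Z g' f') = quot_mor C P X Z (Comp C X Y Z g f)"
    if "g' \<in> quot_mor C P Y Z g" "f' \<in> quot_mor C P X Y f" for g' f'
  proof -
    have *: "f' \<in> carrier (Hom C X Y)" "g' \<in> carrier (Hom C Y Z)" "tr X Y f' = tr X Y f" "tr Y Z g' = tr Y Z g"
      using that quot_mor_eq X f by auto
    then show ?thesis using tr_comp[OF X *(1,2)] tr_comp[OF X f] quot_mor_cong[OF X(1,3)] comp_mor X f by simp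
  qed
  moreover have "f \<in> quot_mor C P X Y f" "g \<in> quot_mor C P Y Z g" using quot_mor_eq X f by auto
  ultimately have "(\<Union>g'\<in>quot_mor C P Y Z g. \<Union>f'\<in>quot_mor C P X Y f. quot_mor C P X Z (Comp C X Y Z g' f')) =
    quot_mor C P X Z (Comp C X Y Z g f)" by blast
  then show ?thesis by (simp add: quot_cat_def)
qed

lemma quotient_is_matrix_model: "matrix_model V s' c' (quot_cat C P) (quot_ev Q)"
proof -
  interpret q: basic_morphisms V s' c' by (rule quot_basic_morphisms[OF Q_sub])
  show ?thesis
  proof
    show "X \<in> Obj (quot_cat C P) \<longleftrightarrow> set X \<subseteq> V" for X using Obj_iff by simp
  next
    fix X Y assume "X \<in> Obj (quot_cat C P)" "Y \<in> Obj (quot_cat C P)"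
    then have X: "X \<in> Obj C" "Y \<in> Obj C" by simp_all
    show "bij_betw (quot_ev Q X Y) (carrier (Hom (quot_cat C P) X Y)) {A. supported s' X Y A}"
      unfolding bij_betw_def carrier_quot
    proof (rule conjI[OF inj_onI equalityI[OF subsetI subsetI]])
      fix F G assume "F \<in> quot_mor C P X Y ` carrier (Hom C X Y)" "G \<in> quot_mor C P X Y ` carrier (Hom C X Y)"
        "quot_ev Q X Y F = quot_ev Q X Y G"
      then obtain f g where fg: "f \<in> carrier (Hom C X Y)" "g \<in> carrier (Hom C X Y)"
        "F = quot_mor C P X Y f" "G = quot_mor C P X Y g" "quot_ev Q X Y F = quot_ev Q X Y G" by blast
      then show "F = G"
        using quot_ev_quot_mor[OF X fg(1)] quot_ev_quot_mor[OF X fg(2)] quot_mor_cong[OF X fg(1,2)] by simp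
    next
      fix A :: "nat \<Rightarrow> nat \<Rightarrow> 'k" assume "A \<in> quot_ev Q X Y ` quot_mor C P X Y ` carrier (Hom C X Y)"
      then show "A \<in> {A. supported s' X Y A}" using quot_ev_quot_mor[OF X] coeff_cut_supported by auto
    next
      fix A :: "nat \<Rightarrow> nat \<Rightarrow> 'k" assume A: "A \<in> {A. supported s' X Y A}"
      then have "supported s X Y A" by (auto simp: supported_def quot_supp_def)
      then obtain f where f: "f \<in> carrier (Hom C X Y)" "ev X Y f = A" using ev_obtain[OF X] by blast
      then have "quot_ev Q X Y (quot_mor C P X Y f) = A" using quot_ev_quot_mor[OF X] coeff_cut_id A by simp
      then show "A \<in> quot_ev Q X Y ` quot_mor C P X Y ` carrier (Hom C X Y)" using f(1) by blast
    qed
    have z: "\<zero>\<^bsub>Hom (quot_cat C P) X Y\<^esub> = quot_mor C P X Y \<zero>\<^bsub>Hom C X Y\<^esub>"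
    proof -
      have "tr X Y \<zero>\<^bsub>Hom C X Y\<^esub> = (\<lambda>j i. 0)" using zero_mor[OF X] by (simp add: coeff_cut_def fun_eq_iff)
      then show ?thesis
        using quot_mor_eq[OF X] zero_mor[OF X] factor_ideal_eq[OF X] by (simp add: quot_cat_def)
    qed
    show "\<zero>\<^bsub>Hom (quot_cat C P) X Y\<^esub> \<in> carrier (Hom (quot_cat C P) X Y) \<and>
      quot_ev Q X Y \<zero>\<^bsub>Hom (quot_cat C P) X Y\<^esub> = (\<lambda>j i. 0)"
      unfolding z carrier_quot using quot_ev_quot_mor[OF X] zero_mor[OF X] by (simp add: coeff_cut_def fun_eq_iff)
    fix F G assume "F \<in> carrier (Hom (quot_cat C P) X Y)" "G \<in> carrier (Hom (quot_cat C P) X Y)"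
    then obtain f g where fg: "f \<in> carrier (Hom C X Y)" "g \<in> carrier (Hom C X Y)"
      "F = quot_mor C P X Y f" "G = quot_mor C P X Y g" unfolding carrier_quot by blast
    show "F \<oplus>\<^bsub>Hom (quot_cat C P) X Y\<^esub> G \<in> carrier (Hom (quot_cat C P) X Y) \<and>
       quot_ev Q X Y (F \<oplus>\<^bsub>Hom (quot_cat C P) X Y\<^esub> G) = (\<lambda>j i. quot_ev Q X Y F j i + quot_ev Q X Y G j i)"
      unfolding fg(3,4) quot_add[OF X fg(1,2)] carrier_quot
      using add_mor[OF X fg(1,2)] quot_ev_quot_mor[OF X] fg(1,2) by (simp add: coeff_cut_add)
  next
    fix X assume "X \<in> Obj (quot_cat C P)"
    then have X: "X \<in> Obj C" by simp
    have "coeff_cut s' X X (coeff_id s X) = coeff_id s' X"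
      using comp_unit by (auto simp: coeff_cut_def coeff_id_def quot_supp_def fun_eq_iff)
    then show "Idn (quot_cat C P) X \<in> carrier (Hom (quot_cat C P) X X) \<and>
       quot_ev Q X X (Idn (quot_cat C P) X) = coeff_id s' X"
      unfolding carrier_quot using quot_ev_quot_mor[OF X X] id_mor[OF X] by (simp add: quot_cat_def)
  next
    fix X Y Z F G
    assume "X \<in> Obj (quot_cat C P)" "Y \<in> Obj (quot_cat C P)" "Z \<in> Obj (quot_cat C P)"
      "F \<in> carrier (Hom (quot_cat C P) X Y)" "G \<in> carrier (Hom (quot_cat C P) Y Z)"
    then obtain f g where X: "X \<in> Obj C" "Y \<in> Obj C" "Z \<in> Obj C"
      and fg: "f \<in> carrier (Hom C X Y)" "g \<in> carrier (Hom C Y Z)"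
      "F = quot_mor C P X Y f" "G = quot_mor C P Y Z g" unfolding carrier_quot by auto
    show "Comp (quot_cat C P) X Y Z G F \<in> carrier (Hom (quot_cat C P) X Z) \<and>
       quot_ev Q X Z (Comp (quot_cat C P) X Y Z G F) = coeff_comp c' X Y Z (quot_ev Q Y Z G) (quot_ev Q X Y F)"
      unfolding fg(3,4) quot_Comp[OF X fg(1,2)] carrier_quot
      using comp_mor[OF X fg(1,2)] tr_comp[OF X fg(1,2)] quot_ev_quot_mor X fg(1,2) by simp
  qed
qed

end

section \<open>Full subcategories, doubled categories and orbit categories\<close>

lemma matrix_model_restrict:
  assumes "matrix_model V s c C ev" "V' \<subseteq> V"
  shows "matrix_model V' s c (full_sub C {X. set X \<subseteq> V'}) ev"
proof -
  interpret matrix_model V s c C ev by fact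
  have sub: "X \<in> Obj (full_sub C {X. set X \<subseteq> V'}) \<longleftrightarrow> set X \<subseteq> V'" for X
    using Obj_iff assms(2) by (auto simp: full_sub_def)
  then have O: "X \<in> Obj (full_sub C {X. set X \<subseteq> V'}) \<Longrightarrow> X \<in> Obj C" for X
    using Obj_iff assms(2) by blast
  have [simp]: "Hom (full_sub C {X. set X \<subseteq> V'}) = Hom C" "Idn (full_sub C {X. set X \<subseteq> V'}) = Idn C"
    "Comp (full_sub C {X. set X \<subseteq> V'}) = Comp C"
    by (simp_all add: full_sub_def)
  show ?thesis
  proof
    fix p q r assume "p \<in> V'" "q \<in> V'" "r \<in> V'" "c p q r"
    then show "s p q \<and> s q r \<and> s p r" using comp_supp assms(2) by blast
  next
    fix p q assume "p \<in> V'" "q \<in> V'" "s p q"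
    then show "c p p q \<and> c p q q" using comp_unit assms(2) by blast
  next
    fix p q r t assume "p \<in> V'" "q \<in> V'" "r \<in> V'" "t \<in> V'"
    then show "(c p q r \<and> c p r t) = (c q r t \<and> c p q t)" using comp_assoc assms(2) by blast
  qed (use sub O ev_bij zero_mor add_mor id_mor comp_mor in simp_all)
qed

lemma matrix_model_pullback:
  assumes "matrix_model V s c C ev"
    and C2: "C2 = \<lparr>Obj = {X. map h X \<in> Obj C}, Hom = (\<lambda>X Y. Hom C (map h X) (map h Y)),
      Idn = (\<lambda>X. Idn C (map h X)), Comp = (\<lambda>X Y Z. Comp C (map h X) (map h Y) (map h Z))\<rparr>"
  shows "matrix_model {p. h p \<in> V} (\<lambda>p q. s (h p) (h q)) (\<lambda>p q r. c (h p) (h q) (h r)) C2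
    (\<lambda>X Y. ev (map h X) (map h Y))"
proof -
  interpret matrix_model V s c C ev by fact
  have 1: "supported (\<lambda>p q. s (h p) (h q)) X Y A \<longleftrightarrow> supported s (map h X) (map h Y) A" for X Y A
    unfolding supported_def by (metis length_map nth_map)
  have 2: "coeff_id (\<lambda>p q. s (h p) (h q)) X = coeff_id s (map h X)" for X
    by (auto simp: coeff_id_def fun_eq_iff)
  have 3: "coeff_comp c (map h X) (map h Y) (map h Z) B A = coeff_comp (\<lambda>p q r. c (h p) (h q) (h r)) X Y Z B A"
    if "supported s (map h X) (map h Y) A" "supported s (map h Y) (map h Z) B" for X Y Z A B
  proof (intro ext)
    fix j i
    show "coeff_comp c (map h X) (map h Y) (map h Z) B A j i = coeff_comp (\<lambda>p q r. c (h p) (h q) (h r)) X Y Z B A j i"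
    proof (cases "i < length X \<and> j < length Z")
      case True
      then show ?thesis by (simp add: coeff_comp_def)
    next
      case False
      then have "(\<forall>k. A k i = 0) \<or> (\<forall>k. B j k = 0)" using that by (auto simp: supported_def)
      then show ?thesis by (auto simp: coeff_comp_def cong: if_cong)
    qed
  qed
  show ?thesis
  proof
    fix X Y Z f g
    assume "X \<in> Obj C2" "Y \<in> Obj C2" "Z \<in> Obj C2" "f \<in> carrier (Hom C2 X Y)" "g \<in> carrier (Hom C2 Y Z)"
    then have *: "map h X \<in> Obj C" "map h Y \<in> Obj C" "map h Z \<in> Obj C"
      "f \<in> carrier (Hom C (map h X) (map h Y))" "g \<in> carrier (Hom C (map h Y) (map h Z))"
      by (simp_all add: C2)
    show "Comp C2 X Y Z g f \<in> carrier (Hom C2 X Z) \<and> ev (map h X) (map h Z) (Comp C2 X Y Z g f) =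
      coeff_comp (\<lambda>p q r. c (h p) (h q) (h r)) X Y Z (ev (map h Y) (map h Z) g) (ev (map h X) (map h Y) f)"
      using comp_mor[OF *] 3[OF ev_supported[OF *(1,2,4)] ev_supported[OF *(2,3,5)]] by (simp add: C2)
  next
    fix X
    show "X \<in> Obj C2 \<longleftrightarrow> set X \<subseteq> {p. h p \<in> V}" using Obj_iff by (auto simp: C2)
  next
    fix p q r t
    assume "p \<in> {p. h p \<in> V}" "q \<in> {p. h p \<in> V}" "r \<in> {p. h p \<in> V}" "t \<in> {p. h p \<in> V}"
    then show "(c (h p) (h q) (h r) \<and> c (h p) (h r) (h t)) = (c (h q) (h r) (h t) \<and> c (h p) (h q) (h t))"
      using comp_assoc by blast
  next
    fix p q r assume "p \<in> {p. h p \<in> V}" "q \<in> {p. h p \<in> V}" "r \<in> {p. h p \<in> V}" "c (h p) (h q) (h r)"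
    then show "s (h p) (h q) \<and> s (h q) (h r) \<and> s (h p) (h r)" using comp_supp by blast
  next
    fix p q assume "p \<in> {p. h p \<in> V}" "q \<in> {p. h p \<in> V}" "s (h p) (h q)"
    then show "c (h p) (h p) (h q) \<and> c (h p) (h q) (h q)" using comp_unit by blast
  next
    fix X assume "X \<in> Obj C2"
    then have "map h X \<in> Obj C" by (simp add: C2)
    from id_mor[OF this]
    show "Idn C2 X \<in> carrier (Hom C2 X X) \<and> ev (map h X) (map h X) (Idn C2 X) = coeff_id (\<lambda>p q. s (h p) (h q)) X"
      by (simp add: C2 2)
  next
    fix X Y assume "X \<in> Obj C2" "Y \<in> Obj C2"
    then have O: "map h X \<in> Obj C" "map h Y \<in> Obj C" by (simp_all add: C2)
    have H: "Hom C2 X Y = Hom C (map h X) (map h Y)" by (simp add: C2)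
    show "bij_betw (ev (map h X) (map h Y)) (carrier (Hom C2 X Y)) {A. supported (\<lambda>p q. s (h p) (h q)) X Y A}"
      unfolding 1 H by (rule ev_bij[OF O])
    show "\<zero>\<^bsub>Hom C2 X Y\<^esub> \<in> carrier (Hom C2 X Y) \<and> ev (map h X) (map h Y) \<zero>\<^bsub>Hom C2 X Y\<^esub> = (\<lambda>j i. 0)"
      unfolding H by (rule zero_mor[OF O])
    fix f g assume "f \<in> carrier (Hom C2 X Y)" "g \<in> carrier (Hom C2 X Y)"
    then show "f \<oplus>\<^bsub>Hom C2 X Y\<^esub> g \<in> carrier (Hom C2 X Y) \<and>
       ev (map h X) (map h Y) (f \<oplus>\<^bsub>Hom C2 X Y\<^esub> g) =
       (\<lambda>j i. ev (map h X) (map h Y) f j i + ev (map h X) (map h Y) g j i)"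
      unfolding H by (rule add_mor[OF O])
  qed
qed

lemma zpow_of_action:
  assumes "\<And>x. H 0 x = x" "\<And>k l x. H (k + l) x = H k (H l x)" "h = H 1"
  shows "zpow h k = H k"
proof -
  have inv: "inv_into UNIV h = H (-1)"
  proof (rule inv_unique_comp)
    show "h \<circ> H (- 1) = id" using assms(2)[of 1 "-1"] assms(1,3) by (auto simp: fun_eq_iff)
    show "H (- 1) \<circ> h = id" using assms(2)[of "-1" 1] assms(1,3) by (auto simp: fun_eq_iff)
  qed
  have pos: "h ^^ n = H (int n)" for n
    by (induction n) (use assms in \<open>auto simp: fun_eq_iff\<close>)
  have neg: "H (- 1) ^^ n = H (- int n)" for n
  proof (induction n)
    case (Suc n)
    have "H (- int (Suc n)) x = H (- 1) (H (- int n) x)" for x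
      using assms(2)[of "-1" "- int n" x] by (simp add: algebra_simps)
    then show ?case using Suc by (auto simp: fun_eq_iff)
  qed (use assms in \<open>auto simp: fun_eq_iff\<close>)
  show ?thesis using pos[of "nat k"] neg[of "nat (- k)"] by (simp add: zpow_def inv)
qed

text \<open>The hypothesis \<open>s_unique\<close> says that at most one degree of the morphism space between the orbits of
  two points is nonzero, so that a single coefficient determines the whole family. The last two
  hypotheses say that \<open>F\<close> does nothing but rename the objects.\<close>

locale orbit_model = matrix_model V s c C ev
  for V :: "'p set" and s c and C :: "('k::field, 'p list, 'm) lin_cat" and ev +
  fixes G :: "int \<Rightarrow> 'p \<Rightarrow> 'p" and F :: "'p list \<Rightarrow> 'p list" and \<Phi> :: "'m \<Rightarrow> 'm"
  assumes G_0: "G 0 p = p" and G_add: "G (k + l) p = G k (G l p)"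
    and G_V: "G k p \<in> V \<longleftrightarrow> p \<in> V" and G_s: "s (G k p) (G k q) = s p q"
    and s_unique: "p \<in> V \<Longrightarrow> q \<in> V \<Longrightarrow> s p (G k q) \<Longrightarrow> s p (G l q) \<Longrightarrow> k = l"
    and c_iff: "c p q r \<longleftrightarrow> s p q \<and> s q r \<and> s p r"
    and F_eq: "F = map (G 1)" and \<Phi>_eq: "\<Phi> = id"
    and Hom_G: "X \<in> Obj C \<Longrightarrow> Y \<in> Obj C \<Longrightarrow>
      carrier (Hom C (map (G k) X) (map (G k) Y)) = carrier (Hom C X Y)"
    and ev_G: "X \<in> Obj C \<Longrightarrow> Y \<in> Obj C \<Longrightarrow> ev (map (G k) X) (map (G k) Y) = ev X Y"
begin

definition orb_supp :: "'p \<Rightarrow> 'p \<Rightarrow> bool" where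
  "orb_supp p q \<longleftrightarrow> (\<exists>k. s p (G k q))"

definition orb_comp :: "'p \<Rightarrow> 'p \<Rightarrow> 'p \<Rightarrow> bool" where
  "orb_comp p q r \<longleftrightarrow> (\<exists>k l. c p (G k q) (G l r))"

definition deg :: "'p \<Rightarrow> 'p \<Rightarrow> int" where
  "deg p q = (THE k. s p (G k q))"

definition orb_ev :: "'p list \<Rightarrow> 'p list \<Rightarrow> (int \<Rightarrow> 'm) \<Rightarrow> nat \<Rightarrow> nat \<Rightarrow> 'k" where
  "orb_ev X Y \<phi> j i = (if i < length X \<and> j < length Y \<and> orb_supp (X ! i) (Y ! j)
     then ev X (map (G (deg (X ! i) (Y ! j))) Y) (\<phi> (deg (X ! i) (Y ! j))) j i else 0)"

lemma deg_eq: "p \<in> V \<Longrightarrow> q \<in> V \<Longrightarrow> s p (G k q) \<Longrightarrow> deg p q = k"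
  unfolding deg_def using s_unique by blast

lemma zpow_F: "zpow F k = map (G k)"
proof (rule zpow_of_action[where H = "\<lambda>k. map (G k)"])
  show "F = map (G 1)" by (rule F_eq)
qed (simp_all add: G_0 G_add map_idI)

lemma zpow_\<Phi>: "zpow \<Phi> k = id"
  by (rule zpow_of_action[where H = "\<lambda>k. id"]) (simp_all add: \<Phi>_eq)

lemma G_shift: "G k (G (l - k) p) = G l p"
  by (simp flip: G_add)

lemma map_G_shift: "map (G k) (map (G (l - k)) X) = map (G l) X"
  by (simp add: G_shift)

lemma map_G_0: "map (G 0) X = X"
  by (simp add: G_0 map_idI)

lemma Obj_G: "X \<in> Obj C \<Longrightarrow> map (G k) X \<in> Obj C"
  using Obj_iff G_V by auto

lemma orb_basic_morphisms: "basic_morphisms V orb_supp orb_comp"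
proof
  fix p q r assume "p \<in> V" "q \<in> V" "r \<in> V" "orb_comp p q r"
  then obtain k l where kl: "s p (G k q)" "s (G k q) (G l r)" "s p (G l r)"
    unfolding orb_comp_def c_iff by blast
  have "s q (G (l - k) r)" using G_s[of k q "G (l - k) r"] kl(2) by (simp add: G_shift)
  then show "orb_supp p q \<and> orb_supp q r \<and> orb_supp p r" using kl unfolding orb_supp_def by blast
next
  fix p q assume pq: "p \<in> V" "q \<in> V" "orb_supp p q"
  then obtain k where k: "s p (G k q)" unfolding orb_supp_def by blast
  have "c p p (G k q) \<and> c p (G k q) (G k q)" using comp_unit[of p "G k q"] k pq G_V by blast
  then show "orb_comp p p q \<and> orb_comp p q q" unfolding orb_comp_def by (metis G_0)
next
  fix p q r t assume V: "p \<in> V" "q \<in> V" "r \<in> V" "t \<in> V"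
  show "(orb_comp p q r \<and> orb_comp p r t) = (orb_comp q r t \<and> orb_comp p q t)"
  proof
    assume "orb_comp p q r \<and> orb_comp p r t"
    then obtain k l l' m where 1: "c p (G k q) (G l r)" "c p (G l' r) (G m t)"
      unfolding orb_comp_def by blast
    then have "l' = l" using s_unique V c_iff by blast
    then have 2: "c (G k q) (G l r) (G m t)" "c p (G k q) (G m t)"
      using comp_assoc[of p "G k q" "G l r" "G m t"] 1 V G_V by blast+
    have "c q (G (l - k) r) (G (m - k) t)"
      using 2(1) G_s[of k q "G (l - k) r"] G_s[of k q "G (m - k) t"] G_s[of k "G (l - k) r" "G (m - k) t"]
      unfolding c_iff G_shift by blast
    then show "orb_comp q r t \<and> orb_comp p q t" using 2(2) unfolding orb_comp_def by blast
  next
    assume "orb_comp q r t \<and> orb_comp p q t"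
    then obtain l m k m' where 1: "c q (G l r) (G m t)" "c p (G k q) (G m' t)"
      unfolding orb_comp_def by blast
    have 2: "c (G k q) (G (k + l) r) (G (k + m) t)" using 1(1) unfolding c_iff G_add G_s .
    have "m' = k + m" using s_unique[of "G k q" t m' "k + m"] V G_V 1 2 c_iff by blast
    then have "c p (G k q) (G (k + l) r) \<and> c p (G (k + l) r) (G (k + m) t)"
      using comp_assoc[of p "G k q" "G (k + l) r" "G (k + m) t"] 1 2 V G_V by blast
    then show "orb_comp p q r \<and> orb_comp p r t" unfolding orb_comp_def by blast
  qed
qed

abbreviation "CO \<equiv> orbit_cat C F \<Phi>"

lemma in_V: "X \<in> Obj C \<Longrightarrow> i < length X \<Longrightarrow> X ! i \<in> V"
  using Obj_iff by (auto simp: subset_iff)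

lemma ev_component:
  assumes X: "X \<in> Obj C" "Y \<in> Obj C" and \<phi>: "\<And>k. \<phi> k \<in> carrier (Hom C X (map (G k) Y))"
  shows "ev X (map (G k) Y) (\<phi> k) j i =
    (if i < length X \<and> j < length Y \<and> s (X ! i) (G k (Y ! j)) then orb_ev X Y \<phi> j i else 0)"
proof (cases "i < length X \<and> j < length Y \<and> s (X ! i) (G k (Y ! j))")
  case True
  then have "deg (X ! i) (Y ! j) = k" using deg_eq in_V X by blast
  then show ?thesis using True unfolding orb_ev_def orb_supp_def by auto
next
  case False
  have "\<not> (i < length X \<and> j < length (map (G k) Y) \<and> s (X ! i) (map (G k) Y ! j))"
    using False by auto
  then have "ev X (map (G k) Y) (\<phi> k) j i = 0"
    using ev_supported[OF X(1) Obj_G[OF X(2)] \<phi>[of k]] unfolding supported_def by blast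
  then show ?thesis unfolding if_not_P[OF False] .
qed

text \<open>Only the finitely many degrees that belong to pairs of summands contribute.\<close>

lemma finite_degrees:
  assumes X: "X \<in> Obj C" "Y \<in> Obj C" and \<phi>: "\<And>k. \<phi> k \<in> carrier (Hom C X (map (G k) Y))"
  shows "finite {k. \<phi> k \<noteq> \<zero>\<^bsub>Hom C X (map (G k) Y)\<^esub>}"
proof (rule finite_subset)
  show "{k. \<phi> k \<noteq> \<zero>\<^bsub>Hom C X (map (G k) Y)\<^esub>} \<subseteq>
    (\<lambda>(j, i). deg (X ! i) (Y ! j)) ` ({..<length Y} \<times> {..<length X})"
  proof
    fix k assume "k \<in> {k. \<phi> k \<noteq> \<zero>\<^bsub>Hom C X (map (G k) Y)\<^esub>}"
    then have "ev X (map (G k) Y) (\<phi> k) \<noteq> (\<lambda>j i. 0)"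
      using ev_eqI[OF X(1) Obj_G[OF X(2)] \<phi>] zero_mor[OF X(1) Obj_G[OF X(2)]] by auto
    then obtain j i where "ev X (map (G k) Y) (\<phi> k) j i \<noteq> 0" by (auto simp: fun_eq_iff)
    then have *: "i < length X" "j < length Y" "s (X ! i) (G k (Y ! j))"
      unfolding ev_component[OF X \<phi>] by (auto split: if_splits)
    then have "deg (X ! i) (Y ! j) = k" using deg_eq in_V X by blast
    then show "k \<in> (\<lambda>(j, i). deg (X ! i) (Y ! j)) ` ({..<length Y} \<times> {..<length X})"
      using * by force
  qed
qed simp

lemma carrier_orbit:
  assumes X: "X \<in> Obj C" "Y \<in> Obj C"
  shows "\<phi> \<in> carrier (Hom CO X Y) \<longleftrightarrow> (\<forall>k. \<phi> k \<in> carrier (Hom C X (map (G k) Y)))"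
  using finite_degrees[OF X, of \<phi>] by (auto simp: orbit_cat_def zpow_F)

lemma Obj_orbit [simp]: "Obj CO = Obj C"
  by (simp add: orbit_cat_def)

lemma orb_ev_supported: "supported orb_supp X Y (orb_ev X Y \<phi>)"
  by (simp add: supported_def orb_ev_def)

lemma orb_bij:
  assumes X: "X \<in> Obj C" "Y \<in> Obj C"
  shows "bij_betw (orb_ev X Y) (carrier (Hom CO X Y)) {A. supported orb_supp X Y A}"
  unfolding bij_betw_def
proof (rule conjI[OF inj_onI equalityI[OF subsetI subsetI]])
  fix \<phi> \<psi> assume "\<phi> \<in> carrier (Hom CO X Y)" "\<psi> \<in> carrier (Hom CO X Y)"
    and e: "orb_ev X Y \<phi> = orb_ev X Y \<psi>"
  then have *: "\<And>k. \<phi> k \<in> carrier (Hom C X (map (G k) Y))" "\<And>k. \<psi> k \<in> carrier (Hom C X (map (G k) Y))"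
    using carrier_orbit[OF X] by auto
  have "ev X (map (G k) Y) (\<phi> k) = ev X (map (G k) Y) (\<psi> k)" for k
    by (intro ext) (simp only: ev_component[OF X *(1)] ev_component[OF X *(2)] e)
  then show "\<phi> = \<psi>" using ev_eqI[OF X(1) Obj_G[OF X(2)] * ] by blast
next
  fix A assume "A \<in> orb_ev X Y ` carrier (Hom CO X Y)"
  then show "A \<in> {A. supported orb_supp X Y A}" using orb_ev_supported by blast
next
  fix A :: "nat \<Rightarrow> nat \<Rightarrow> 'k" assume "A \<in> {A. supported orb_supp X Y A}"
  then have A: "supported orb_supp X Y A" by simp
  have "\<exists>f. f \<in> carrier (Hom C X (map (G k) Y)) \<and> ev X (map (G k) Y) f = coeff_cut s X (map (G k) Y) A" for k
    using ev_obtain[OF X(1) Obj_G[OF X(2)] coeff_cut_supported] by metis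
  then obtain \<phi> where \<phi>: "\<And>k. \<phi> k \<in> carrier (Hom C X (map (G k) Y))"
    "\<And>k. ev X (map (G k) Y) (\<phi> k) = coeff_cut s X (map (G k) Y) A" by metis
  have "orb_ev X Y \<phi> j i = A j i" for j i
  proof (cases "i < length X \<and> j < length Y \<and> orb_supp (X ! i) (Y ! j)")
    case True
    then obtain k where k: "s (X ! i) (G k (Y ! j))" unfolding orb_supp_def by blast
    then have "deg (X ! i) (Y ! j) = k" using deg_eq in_V X True by blast
    then show ?thesis using True k by (simp add: orb_ev_def \<phi>(2) coeff_cut_def)
  next
    case False
    then show ?thesis using A unfolding orb_ev_def supported_def by auto
  qed
  then have "orb_ev X Y \<phi> = A" by (intro ext)
  then show "A \<in> orb_ev X Y ` carrier (Hom CO X Y)" using carrier_orbit[OF X] \<phi>(1) by blast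
qed

text \<open>In the sum over all degrees that defines the composite, a summand \<open>Y\<^sub>m\<close> contributes only through
  the one degree in which \<open>X\<^sub>i \<rightarrow> Y\<^sub>m\<close> is nonzero.\<close>

lemma orb_comp_mor:
  assumes X: "X \<in> Obj C" "Y \<in> Obj C" "Z \<in> Obj C"
    and \<phi>: "\<phi> \<in> carrier (Hom CO X Y)" and \<psi>: "\<psi> \<in> carrier (Hom CO Y Z)"
  shows "Comp CO X Y Z \<psi> \<phi> \<in> carrier (Hom CO X Z) \<and>
    orb_ev X Z (Comp CO X Y Z \<psi> \<phi>) = coeff_comp orb_comp X Y Z (orb_ev Y Z \<psi>) (orb_ev X Y \<phi>)"
proof -
  have \<phi>': "\<And>k. \<phi> k \<in> carrier (Hom C X (map (G k) Y))" and \<psi>': "\<And>k. \<psi> k \<in> carrier (Hom C Y (map (G k) Z))"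
    using \<phi> \<psi> carrier_orbit X by auto
  define S where "S = {k. \<phi> k \<noteq> \<zero>\<^bsub>Hom C X (map (G k) Y)\<^esub>}"
  have S: "finite S" unfolding S_def by (rule finite_degrees[OF X(1,2) \<phi>'])
  define t where "t n = (\<lambda>k. Comp C X (map (G k) Y) (map (G n) Z) (\<psi> (n - k)) (\<phi> k))" for n
  have Comp_eq: "Comp CO X Y Z \<psi> \<phi> n = finsum (Hom C X (map (G n) Z)) (t n) S" for n
    by (simp add: orbit_cat_def zpow_F zpow_\<Phi> t_def S_def)
  have \<psi>k: "\<psi> (n - k) \<in> carrier (Hom C (map (G k) Y) (map (G n) Z))"
    "ev (map (G k) Y) (map (G n) Z) (\<psi> (n - k)) = ev Y (map (G (n - k)) Z) (\<psi> (n - k))" for n k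
    using Hom_G[OF X(2) Obj_G[OF X(3)], of k "n - k"] ev_G[OF X(2) Obj_G[OF X(3)], of k "n - k"]
      \<psi>'[of "n - k"] unfolding map_G_shift by simp_all
  have t: "t n k \<in> carrier (Hom C X (map (G n) Z)) \<and> ev X (map (G n) Z) (t n k) =
      coeff_comp c X (map (G k) Y) (map (G n) Z) (ev Y (map (G (n - k)) Z) (\<psi> (n - k))) (ev X (map (G k) Y) (\<phi> k))"
    for n k
    unfolding t_def
    using comp_mor[OF X(1) Obj_G[OF X(2)] Obj_G[OF X(3)] \<phi>' \<psi>k(1)] \<psi>k(2) by simp
  have f: "Comp CO X Y Z \<psi> \<phi> n \<in> carrier (Hom C X (map (G n) Z)) \<and>
      ev X (map (G n) Z) (Comp CO X Y Z \<psi> \<phi> n) = (\<lambda>j i. \<Sum>k\<in>S. ev X (map (G n) Z) (t n k) j i)" for n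
    unfolding Comp_eq by (rule finsum_mor[OF X(1) Obj_G[OF X(3)] S]) (use t in blast)
  have "orb_ev X Z (Comp CO X Y Z \<psi> \<phi>) j i = coeff_comp orb_comp X Y Z (orb_ev Y Z \<psi>) (orb_ev X Y \<phi>) j i" for j i
  proof (cases "i < length X \<and> j < length Z")
    case False
    then show ?thesis by (auto simp: orb_ev_def[of X Y] orb_ev_def[of Y Z] orb_ev_def[of X Z] coeff_comp_def cong: if_cong)
  next
    case ij: True
    then have Vij: "X ! i \<in> V" "Z ! j \<in> V" using in_V X by blast+
    show ?thesis
    proof (cases "orb_supp (X ! i) (Z ! j)")
      case False
      then have "\<not> orb_comp (X ! i) q (Z ! j)" if "q \<in> V" for q
        using basic_morphisms.comp_supp[OF orb_basic_morphisms Vij(1) that Vij(2)] by blast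
      then have "coeff_comp orb_comp X Y Z (orb_ev Y Z \<psi>) (orb_ev X Y \<phi>) j i = 0"
        unfolding coeff_comp_def by (intro sum.neutral) (use in_V X in auto)
      then show ?thesis using False by (simp add: orb_ev_def)
    next
      case True
      then obtain n where n: "s (X ! i) (G n (Z ! j))" unfolding orb_supp_def by blast
      have dn: "deg (X ! i) (Z ! j) = n" using deg_eq[OF Vij n] .
      define a where "a k m = ev X (map (G k) Y) (\<phi> k) m i" for k m
      define b where "b k m = ev Y (map (G k) Z) (\<psi> k) j m" for k m
      have inner: "(\<Sum>k\<in>S. if c (X ! i) (G k (Y ! m)) (G n (Z ! j)) then b (n - k) m * a k m else 0) =
        (if orb_comp (X ! i) (Y ! m) (Z ! j) then orb_ev Y Z \<psi> j m * orb_ev X Y \<phi> m i else 0)"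
        if m: "m < length Y" for m
      proof (cases "orb_comp (X ! i) (Y ! m) (Z ! j)")
        case False
        then show ?thesis unfolding orb_comp_def by (auto intro!: sum.neutral)
      next
        case oc: True
        have Vm: "Y ! m \<in> V" using in_V X m by blast
        obtain k l where kl: "c (X ! i) (G k (Y ! m)) (G l (Z ! j))" using oc unfolding orb_comp_def by blast
        then have "l = n" using s_unique[OF Vij] n c_iff by blast
        then have k: "c (X ! i) (G k (Y ! m)) (G n (Z ! j))" using kl by simp
        have "s (Y ! m) (G (n - k) (Z ! j))"
          using k G_s[of k "Y ! m" "G (n - k) (Z ! j)"] unfolding c_iff G_shift by blast
        then have B: "b (n - k) m = orb_ev Y Z \<psi> j m"
          unfolding b_def ev_component[where \<phi> = \<psi>, OF X(2,3) \<psi>'] using m ij by simp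
        have A: "a k' m = (if k' = k then orb_ev X Y \<phi> m i else 0)" for k'
        proof -
          have "s (X ! i) (G k' (Y ! m)) \<longleftrightarrow> k' = k"
            using k s_unique[OF Vij(1) Vm, of k' k] c_iff by blast
          then show ?thesis
            unfolding a_def ev_component[where \<phi> = \<phi>, OF X(1,2) \<phi>'] using m ij by simp
        qed
        have A0: "orb_ev X Y \<phi> m i = 0" if "k \<notin> S"
        proof -
          have "\<phi> k = \<zero>\<^bsub>Hom C X (map (G k) Y)\<^esub>" using that by (simp add: S_def)
          then have "a k m = 0" using zero_mor[OF X(1) Obj_G[OF X(2)]] by (simp add: a_def)
          then show ?thesis using A[of k] by simp
        qed
        have "(\<Sum>k'\<in>S. if c (X ! i) (G k' (Y ! m)) (G n (Z ! j)) then b (n - k') m * a k' m else 0) =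
          (\<Sum>k'\<in>S. if k' = k then orb_ev Y Z \<psi> j m * orb_ev X Y \<phi> m i else 0)"
          by (intro sum.cong refl) (use k B A in auto)
        also have "\<dots> = orb_ev Y Z \<psi> j m * orb_ev X Y \<phi> m i"
          using S A0 by (cases "k \<in> S") simp_all
        finally show ?thesis using oc by simp
      qed
      have "orb_ev X Z (Comp CO X Y Z \<psi> \<phi>) j i = ev X (map (G n) Z) (Comp CO X Y Z \<psi> \<phi> n) j i"
        using ij True dn by (simp add: orb_ev_def)
      also have "\<dots> = (\<Sum>k\<in>S. ev X (map (G n) Z) (t n k) j i)" using f by simp
      also have "\<dots> = (\<Sum>k\<in>S. \<Sum>m<length Y. if c (X ! i) (G k (Y ! m)) (G n (Z ! j)) then b (n - k) m * a k m else 0)"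
        by (intro sum.cong refl) (use t ij in \<open>simp add: coeff_comp_def a_def b_def cong: if_cong\<close>)
      also have "\<dots> = (\<Sum>m<length Y. \<Sum>k\<in>S. if c (X ! i) (G k (Y ! m)) (G n (Z ! j)) then b (n - k) m * a k m else 0)"
        by (rule sum.swap)
      also have "\<dots> = coeff_comp orb_comp X Y Z (orb_ev Y Z \<psi>) (orb_ev X Y \<phi>) j i"
        unfolding coeff_comp_def by (intro sum.cong refl) (use inner in simp)
      finally show ?thesis .
    qed
  qed
  then show ?thesis using carrier_orbit[OF X(1,3)] f by (auto simp: fun_eq_iff)
qed

lemma orb_ev_concentrated:
  assumes X: "X \<in> Obj C" "Y \<in> Obj C" and f: "f \<in> carrier (Hom C X Y)"
  shows "(\<lambda>k. if k = 0 then f else \<zero>\<^bsub>Hom C X (map (G k) Y)\<^esub>) \<in> carrier (Hom CO X Y) \<and>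
    orb_ev X Y (\<lambda>k. if k = 0 then f else \<zero>\<^bsub>Hom C X (map (G k) Y)\<^esub>) = ev X Y f"
proof -
  define \<phi> where "\<phi> k = (if k = 0 then f else \<zero>\<^bsub>Hom C X (map (G k) Y)\<^esub>)" for k :: int
  have 1: "\<phi> k \<in> carrier (Hom C X (map (G k) Y))" for k
    using f zero_mor[OF X(1) Obj_G[OF X(2)]] by (simp add: \<phi>_def map_G_0)
  have "orb_ev X Y \<phi> j i = ev X Y f j i" for j i
  proof (cases "i < length X \<and> j < length Y \<and> orb_supp (X ! i) (Y ! j)")
    case True
    then obtain k where k: "s (X ! i) (G k (Y ! j))" unfolding orb_supp_def by blast
    then have d: "deg (X ! i) (Y ! j) = k" using deg_eq in_V X True by blast
    show ?thesis
    proof (cases "k = 0")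
      case True
      then show ?thesis using \<open>i < length X \<and> _\<close> d by (simp add: orb_ev_def \<phi>_def map_G_0)
    next
      case False
      then have "\<not> s (X ! i) (Y ! j)"
        using s_unique[of "X ! i" "Y ! j" k 0] k in_V X True by (auto simp: G_0)
      then have "ev X Y f j i = 0" using ev_supported[OF X f] by (auto simp: supported_def)
      then show ?thesis using False d zero_mor[OF X(1) Obj_G[OF X(2)]] by (simp add: orb_ev_def \<phi>_def)
    qed
  next
    case False
    then have "\<not> (i < length X \<and> j < length Y \<and> s (X ! i) (Y ! j))" unfolding orb_supp_def by (metis G_0)
    then have "ev X Y f j i = 0" using ev_supported[OF X f] by (auto simp: supported_def)
    then show ?thesis using False by (auto simp: orb_ev_def)
  qed
  then show ?thesis using 1 carrier_orbit[OF X] unfolding \<phi>_def by (auto simp: fun_eq_iff)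
qed

lemma orbit_mor_in:
  assumes X: "X \<in> Obj C" "Y \<in> Obj C" and f: "f \<in> carrier (Hom C X Y)"
  shows "orbit_mor C F X Y f \<in> carrier (Hom CO X Y) \<and> orb_ev X Y (orbit_mor C F X Y f) = ev X Y f"
  unfolding orbit_mor_def zpow_F by (rule orb_ev_concentrated[OF assms])

lemma orbit_is_matrix_model: "matrix_model V orb_supp orb_comp CO orb_ev"
proof -
  interpret o: basic_morphisms V orb_supp orb_comp by (rule orb_basic_morphisms)
  show ?thesis
  proof
    show "X \<in> Obj CO \<longleftrightarrow> set X \<subseteq> V" for X using Obj_iff by simp
  next
    fix X Y assume "X \<in> Obj CO" "Y \<in> Obj CO"
    then have X: "X \<in> Obj C" "Y \<in> Obj C" by simp_all
    show "bij_betw (orb_ev X Y) (carrier (Hom CO X Y)) {A. supported orb_supp X Y A}"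
      by (rule orb_bij[OF X])
    have z: "\<zero>\<^bsub>Hom CO X Y\<^esub> = (\<lambda>k. \<zero>\<^bsub>Hom C X (map (G k) Y)\<^esub>)"
      by (simp add: orbit_cat_def zpow_F)
    show "\<zero>\<^bsub>Hom CO X Y\<^esub> \<in> carrier (Hom CO X Y) \<and> orb_ev X Y \<zero>\<^bsub>Hom CO X Y\<^esub> = (\<lambda>j i. 0)"
      unfolding carrier_orbit[OF X] z
      using zero_mor[OF X(1) Obj_G[OF X(2)]] by (simp add: orb_ev_def fun_eq_iff)
    fix f g assume "f \<in> carrier (Hom CO X Y)" "g \<in> carrier (Hom CO X Y)"
    then have fg: "\<And>k. f k \<in> carrier (Hom C X (map (G k) Y))" "\<And>k. g k \<in> carrier (Hom C X (map (G k) Y))"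
      using carrier_orbit[OF X] by auto
    have a: "f \<oplus>\<^bsub>Hom CO X Y\<^esub> g = (\<lambda>k. f k \<oplus>\<^bsub>Hom C X (map (G k) Y)\<^esub> g k)"
      by (simp add: orbit_cat_def zpow_F)
    show "f \<oplus>\<^bsub>Hom CO X Y\<^esub> g \<in> carrier (Hom CO X Y) \<and>
      orb_ev X Y (f \<oplus>\<^bsub>Hom CO X Y\<^esub> g) = (\<lambda>j i. orb_ev X Y f j i + orb_ev X Y g j i)"
      unfolding carrier_orbit[OF X] a
      using add_mor[OF X(1) Obj_G[OF X(2)] fg] by (simp add: orb_ev_def fun_eq_iff)
  next
    fix X assume "X \<in> Obj CO"
    then have X: "X \<in> Obj C" by simp
    have "coeff_id s X = coeff_id orb_supp X"
    proof (intro ext)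
      fix j i
      have "s (X ! i) (X ! i) \<longleftrightarrow> orb_supp (X ! i) (X ! i)" if "i < length X"
      proof
        assume "orb_supp (X ! i) (X ! i)"
        then obtain k where k: "s (X ! i) (G k (X ! i))" unfolding orb_supp_def by blast
        then show "s (X ! i) (X ! i)"
          using comp_unit[of "X ! i" "G k (X ! i)"] in_V[OF X that] G_V c_iff by blast
      qed (metis orb_supp_def G_0)
      then show "coeff_id s X j i = coeff_id orb_supp X j i" by (auto simp: coeff_id_def)
    qed
    then show "Idn CO X \<in> carrier (Hom CO X X) \<and> orb_ev X X (Idn CO X) = coeff_id orb_supp X"
      using orb_ev_concentrated[OF X X, of "Idn C X"] id_mor[OF X] by (simp add: orbit_cat_def zpow_F cong: if_cong)
  next
    fix X Y Z f g
    assume "X \<in> Obj CO" "Y \<in> Obj CO" "Z \<in> Obj CO" "f \<in> carrier (Hom CO X Y)" "g \<in> carrier (Hom CO Y Z)"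
    then show "Comp CO X Y Z g f \<in> carrier (Hom CO X Z) \<and>
       orb_ev X Z (Comp CO X Y Z g f) = coeff_comp orb_comp X Y Z (orb_ev Y Z g) (orb_ev X Y f)"
      using orb_comp_mor by simp
  qed
qed

end

section \<open>The continuous derived category\<close>

type_synonym 'k CT_mor = "(int \<Rightarrow> 'k mat set) set"
type_synonym 'k B_cat = "('k, point list, 'k mat) lin_cat"
type_synonym 'k D_cat = "('k, point list, 'k mat set) lin_cat"
type_synonym 'k D2_cat = "('k, dpoint list, 'k mat set) lin_cat"
type_synonym 'k C_cat = "('k, dpoint list, int \<Rightarrow> 'k mat set) lin_cat"
type_synonym 'k CT_cat = "('k, dpoint list, 'k CT_mor) lin_cat"

definition comp_B :: "point \<Rightarrow> point \<Rightarrow> point \<Rightarrow> bool" where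
  "comp_B p q r \<longleftrightarrow> hom_supp p q \<and> hom_supp q r"

definition ev_B :: "point list \<Rightarrow> point list \<Rightarrow> 'k::field mat \<Rightarrow> nat \<Rightarrow> nat \<Rightarrow> 'k" where
  "ev_B X Y A j i = (if j < length Y \<and> i < length X then A $$ (j, i) else 0)"

lemma carrier_B:
  "A \<in> carrier (Hom (cat_B :: ('k::field) B_cat) X Y) \<longleftrightarrow>
    A \<in> carrier_mat (length Y) (length X) \<and> supported hom_supp X Y (ev_B X Y A)"
  by (auto simp: cat_B_def supported_def ev_B_def)

lemma ev_B_mult:
  assumes A: "A \<in> carrier (Hom (cat_B :: ('k::field) B_cat) X Y)"
    and B: "B \<in> carrier (Hom (cat_B :: 'k B_cat) Y Z)"
  shows "ev_B X Z (B * A) = coeff_comp comp_B X Y Z (ev_B Y Z B) (ev_B X Y A)"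
proof (intro ext)
  fix j i
  have dims: "A \<in> carrier_mat (length Y) (length X)" "B \<in> carrier_mat (length Z) (length Y)"
    and SA: "supported hom_supp X Y (ev_B X Y A)" and SB: "supported hom_supp Y Z (ev_B Y Z B)"
    using A B unfolding carrier_B by blast+
  show "ev_B X Z (B * A) j i = coeff_comp comp_B X Y Z (ev_B Y Z B) (ev_B X Y A) j i"
  proof (cases "j < length Z \<and> i < length X")
    case True
    have "ev_B X Z (B * A) j i = (\<Sum>k<length Y. B $$ (j, k) * A $$ (k, i))"
      using dims True by (simp add: ev_B_def scalar_prod_def lessThan_atLeast0)
    also have "\<dots> = coeff_comp comp_B X Y Z (ev_B Y Z B) (ev_B X Y A) j i"
      unfolding coeff_comp_def
    proof (intro sum.cong refl)
      fix k assume "k \<in> {..<length Y}"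
      then have e: "ev_B Y Z B j k = B $$ (j, k)" "ev_B X Y A k i = A $$ (k, i)"
        using True by (simp_all add: ev_B_def)
      show "B $$ (j, k) * A $$ (k, i) =
        (if comp_B (X ! i) (Y ! k) (Z ! j) then ev_B Y Z B j k * ev_B X Y A k i else 0)"
      proof (cases "B $$ (j, k) = 0 \<or> A $$ (k, i) = 0")
        case True
        then show ?thesis using e by auto
      next
        case False
        then have "hom_supp (Y ! k) (Z ! j)" "hom_supp (X ! i) (Y ! k)"
          using SA SB e unfolding supported_def by metis+
        then show ?thesis using e by (simp add: comp_B_def)
      qed
    qed
    finally show ?thesis .
  next
    case False
    then show ?thesis by (auto simp: ev_B_def coeff_comp_def cong: if_cong)
  qed
qed

lemma cat_B_model: "matrix_model UNIV hom_supp comp_B (cat_B :: ('k::field) B_cat) ev_B"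
proof
  fix p q r :: point assume "comp_B p q r"
  then show "hom_supp p q \<and> hom_supp q r \<and> hom_supp p r"
    using hom_supp_trans unfolding comp_B_def by blast
next
  fix p q :: point assume "hom_supp p q"
  then show "comp_B p p q \<and> comp_B p q q" by (simp add: comp_B_def)
next
  fix p q r t :: point
  show "(comp_B p q r \<and> comp_B p r t) = (comp_B q r t \<and> comp_B p q t)"
    using hom_supp_trans unfolding comp_B_def by blast
next
  fix X show "X \<in> Obj (cat_B :: ('k::field) B_cat) \<longleftrightarrow> set X \<subseteq> UNIV"
    by (simp add: cat_B_def)
next
  fix X :: "point list"
  have "1\<^sub>m (length X) $$ (j, i) = (if j = i then 1 else (0 :: 'k))" if "j < length X" "i < length X" for i j
    using that by simp
  then have "ev_B X X (1\<^sub>m (length X)) = (coeff_id hom_supp X :: nat \<Rightarrow> nat \<Rightarrow> 'k)"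
    by (auto simp: ev_B_def coeff_id_def fun_eq_iff)
  then show "Idn (cat_B :: ('k::field) B_cat) X \<in> carrier (Hom (cat_B :: ('k::field) B_cat) X X) \<and>
    ev_B X X (Idn (cat_B :: ('k::field) B_cat) X) = (coeff_id hom_supp X :: nat \<Rightarrow> nat \<Rightarrow> 'k)"
    unfolding carrier_B by (simp add: cat_B_def) (simp add: supported_def coeff_id_def)
next
  fix X Y :: "point list"
  let ?H = "Hom (cat_B :: ('k::field) B_cat) X Y"
  show "bij_betw (ev_B X Y) (carrier ?H) {A :: nat \<Rightarrow> nat \<Rightarrow> 'k. supported hom_supp X Y A}"
    unfolding bij_betw_def
  proof (rule conjI[OF inj_onI equalityI[OF subsetI subsetI]])
    fix A B assume AB: "A \<in> carrier ?H" "B \<in> carrier ?H" and e: "ev_B X Y A = ev_B X Y B"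
    have "A $$ (j, i) = B $$ (j, i)" if "j < length Y" "i < length X" for j i
      using fun_cong[OF fun_cong[OF e, of j], of i] that by (simp add: ev_B_def)
    then show "A = B" using AB unfolding carrier_B by (intro eq_matI) auto
  next
    fix A assume "A \<in> ev_B X Y ` carrier ?H"
    then show "A \<in> {A. supported hom_supp X Y A}" by (auto simp: carrier_B)
  next
    fix A :: "nat \<Rightarrow> nat \<Rightarrow> 'k" assume A: "A \<in> {A. supported hom_supp X Y A}"
    have "ev_B X Y (mat (length Y) (length X) (\<lambda>(j, i). A j i)) = A"
      using A by (auto simp: ev_B_def fun_eq_iff supported_def)
    moreover from this have "mat (length Y) (length X) (\<lambda>(j, i). A j i) \<in> carrier ?H"
      using A unfolding carrier_B by simp
    ultimately show "A \<in> ev_B X Y ` carrier ?H" by force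
  qed
  have "ev_B X Y (0\<^sub>m (length Y) (length X)) = (\<lambda>j i. 0 :: 'k)"
    by (auto simp: ev_B_def fun_eq_iff)
  then show "\<zero>\<^bsub>?H\<^esub> \<in> carrier ?H \<and> ev_B X Y \<zero>\<^bsub>?H\<^esub> = (\<lambda>j i. 0)"
    unfolding carrier_B by (simp add: cat_B_def module_mat_def supported_zero)
  fix A B assume AB: "A \<in> carrier ?H" "B \<in> carrier ?H"
  have a: "A \<oplus>\<^bsub>?H\<^esub> B = A + B" by (simp add: cat_B_def module_mat_def)
  have e: "ev_B X Y (A + B) = (\<lambda>j i. ev_B X Y A j i + ev_B X Y B j i)"
    using AB unfolding carrier_B by (auto simp: ev_B_def fun_eq_iff)
  have "supported hom_supp X Y (\<lambda>j i. ev_B X Y A j i + ev_B X Y B j i)"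
    using AB unfolding carrier_B supported_def by (metis add.right_neutral)
  then show "A \<oplus>\<^bsub>?H\<^esub> B \<in> carrier ?H \<and> ev_B X Y (A \<oplus>\<^bsub>?H\<^esub> B) = (\<lambda>j i. ev_B X Y A j i + ev_B X Y B j i)"
    unfolding a carrier_B e using AB by (simp add: carrier_B)
next
  fix X Y Z :: "point list" and A B :: "'k mat"
  assume A: "A \<in> carrier (Hom (cat_B :: ('k::field) B_cat) X Y)"
    and B: "B \<in> carrier (Hom (cat_B :: ('k::field) B_cat) Y Z)"
  have "supported hom_supp X Z (coeff_comp comp_B X Y Z (ev_B Y Z B) (ev_B X Y A))"
    unfolding supported_def
  proof (intro allI impI)
    fix j i assume "coeff_comp comp_B X Y Z (ev_B Y Z B) (ev_B X Y A) j i \<noteq> 0"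
    then obtain k where k: "comp_B (X ! i) (Y ! k) (Z ! j)" "ev_B Y Z B j k \<noteq> 0" "ev_B X Y A k i \<noteq> 0"
      unfolding coeff_comp_def by (auto elim!: sum.not_neutral_contains_not_neutral split: if_splits)
    then have "i < length X \<and> j < length Z" by (simp add: ev_B_def split: if_splits)
    then show "i < length X \<and> j < length Z \<and> hom_supp (X ! i) (Z ! j)"
      using hom_supp_trans k(1) unfolding comp_B_def by blast
  qed
  moreover have "B * A \<in> carrier_mat (length Z) (length X)"
    using A B unfolding carrier_B by auto
  moreover have "Comp (cat_B :: ('k::field) B_cat) X Y Z B A = B * A" by (simp add: cat_B_def)
  ultimately show "Comp (cat_B :: ('k::field) B_cat) X Y Z B A \<in> carrier (Hom (cat_B :: ('k::field) B_cat) X Z) \<and>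
    ev_B X Z (Comp (cat_B :: ('k::field) B_cat) X Y Z B A) =
    coeff_comp comp_B X Y Z (ev_B Y Z B) (ev_B X Y A)"
    unfolding carrier_B using ev_B_mult[OF A B] by simp
qed

definition comp_D :: "point \<Rightarrow> point \<Rightarrow> point \<Rightarrow> bool" where
  "comp_D p q r \<longleftrightarrow> supp_D p q \<and> supp_D q r \<and> supp_D p r"

definition ev_D :: "point list \<Rightarrow> point list \<Rightarrow> 'k::field mat set \<Rightarrow> nat \<Rightarrow> nat \<Rightarrow> 'k" where
  "ev_D X Y F = coeff_cut supp_D X Y (ev_B X Y (SOME A. A \<in> F))"

lemma quotient_B_pi: "quotient_model UNIV hom_supp comp_B (cat_B :: ('k::field) B_cat) ev_B B_pi {p. \<not> in_strip p}"
proof -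
  interpret matrix_model UNIV hom_supp comp_B "cat_B :: ('k::field) B_cat" ev_B
    by (rule cat_B_model)
  show ?thesis
  proof
    have "(0, pi) \<in> {p. \<not> in_strip p}" by (simp add: in_strip_def)
    then show "{p. \<not> in_strip p} \<noteq> {}" by blast
  next
    fix Z assume "set Z \<subseteq> {p. \<not> in_strip p}"
    then show "Z \<in> B_pi" by (auto simp: B_pi_def in_strip_def)
  next
    fix Z assume "Z \<in> B_pi"
    then have Q: "set Z \<subseteq> {p. \<not> in_strip p}" by (auto simp: B_pi_def in_strip_def)
    have O: "Z \<in> Obj (cat_B :: ('k::field) B_cat)" using Obj_iff by blast
    show "Z \<in> Obj (cat_B :: ('k::field) B_cat) \<and> (\<exists>Z'. set Z' \<subseteq> {p. \<not> in_strip p} \<and>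
      (\<exists>u\<in>carrier (Hom cat_B Z Z'). \<exists>v\<in>carrier (Hom cat_B Z' Z).
         Comp cat_B Z Z' Z v u = Idn (cat_B :: ('k::field) B_cat) Z))"
      using Q O id_mor[OF O] comp_id_mor[OF O O] by blast
  qed simp
qed

lemma quot_supp_B: "basic_morphisms.quot_supp hom_supp comp_B {p. \<not> in_strip p} = supp_D"
proof -
  interpret matrix_model UNIV hom_supp comp_B "cat_B :: rat B_cat" ev_B
    by (rule cat_B_model)
  show ?thesis
  proof (intro ext)
    fix p q
    show "quot_supp {p. \<not> in_strip p} p q = supp_D p q"
      unfolding quot_supp_def supp_D_iff_not_factoring using comp_B_def by blast
  qed
qed

lemma quot_comp_B: "basic_morphisms.quot_comp hom_supp comp_B {p. \<not> in_strip p} = comp_D"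
proof -
  interpret matrix_model UNIV hom_supp comp_B "cat_B :: rat B_cat" ev_B
    by (rule cat_B_model)
  show ?thesis
  proof (intro ext)
    fix p q r
    show "quot_comp {p. \<not> in_strip p} p q r = comp_D p q r"
      unfolding quot_comp_def quot_supp_B comp_D_def
      using comp_B_def supp_D_between[of p r q] supp_D_hom_supp by blast
  qed
qed

lemma quot_ev_B: "matrix_model.quot_ev hom_supp comp_B ev_B {p. \<not> in_strip p} = ev_D"
proof -
  interpret matrix_model UNIV hom_supp comp_B "cat_B :: 'a B_cat" ev_B
    by (rule cat_B_model)
  show ?thesis by (intro ext) (simp add: quot_ev_def quot_supp_B ev_D_def)
qed

lemma cat_D_model: "matrix_model {p. in_strip p} supp_D comp_D (cat_D :: ('k::field) D_cat) ev_D"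
proof -
  interpret quotient_model UNIV hom_supp comp_B "cat_B :: ('k::field) B_cat" ev_B B_pi "{p. \<not> in_strip p}"
    by (rule quotient_B_pi)
  have e: "{X. set X \<subseteq> {p. in_strip p}} = {X. \<forall>p\<in>set X. \<bar>snd p - fst p\<bar> < pi}"
    by (auto simp: in_strip_def)
  show ?thesis
    using matrix_model_restrict[OF quotient_is_matrix_model, of "{p. in_strip p}"]
    unfolding quot_supp_B quot_comp_B quot_ev_B e cat_D_def by simp
qed

lemma Hom_D: "Hom cat_D X Y = Hom (quot_cat cat_B B_pi) X Y"
  by (simp add: cat_D_def full_sub_def)

lemma carrier_D:
  "carrier (Hom (cat_D :: ('k::field) D_cat) X Y) =
    (\<lambda>A. {B \<in> carrier (Hom cat_B X Y). coeff_cut supp_D X Y (ev_B X Y B) = coeff_cut supp_D X Y (ev_B X Y A)}) `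
      carrier (Hom cat_B X Y)"
proof -
  interpret quotient_model UNIV hom_supp comp_B "cat_B :: ('k::field) B_cat" ev_B B_pi "{p. \<not> in_strip p}"
    by (rule quotient_B_pi)
  have "X \<in> Obj (cat_B :: ('k::field) B_cat)"
       "Y \<in> Obj (cat_B :: ('k::field) B_cat)"
    using Obj_iff by blast+
  then show ?thesis unfolding Hom_D carrier_quot using quot_mor_eq[of X Y] unfolding quot_supp_B
    by (intro image_cong) auto
qed

lemma supported_map:
  assumes "\<And>p q. s (g p) (g q) = s p q"
  shows "supported s (map g X) (map g Y) = supported s X Y"
  unfolding supported_def fun_eq_iff by (metis assms length_map nth_map)

lemma coeff_cut_map:
  assumes "\<And>p q. s (g p) (g q) = s p q"
  shows "coeff_cut s (map g X) (map g Y) = coeff_cut s X Y"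
  by (auto simp: coeff_cut_def fun_eq_iff assms)

lemma ev_B_map [simp]: "ev_B (map g X) (map g Y) = ev_B X Y"
  by (auto simp: ev_B_def fun_eq_iff)

lemma carrier_B_rot: "carrier (Hom cat_B (map (rot k) X) (map (rot k) Y)) = carrier (Hom cat_B X Y)"
  by (auto simp: carrier_B supported_map)

lemma carrier_D_rot: "carrier (Hom cat_D (map (rot k) X) (map (rot k) Y)) = carrier (Hom cat_D X Y)"
  by (simp add: carrier_D carrier_B_rot coeff_cut_map)

lemma ev_D_rot: "ev_D (map (rot k) X) (map (rot k) Y) = ev_D X Y"
  by (simp add: ev_D_def coeff_cut_map fun_eq_iff)

definition drot :: "int \<Rightarrow> dpoint \<Rightarrow> dpoint" where
  "drot k d = (rot k (fst d), if even k then snd d else \<not> snd d)"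

abbreviation strip2 :: "dpoint set" where "strip2 \<equiv> {d. in_strip (fst d)}"
abbreviation "supp_D2 \<equiv> \<lambda>d e :: dpoint. supp_D (fst d) (fst e)"
abbreviation "comp_D2 \<equiv> \<lambda>d e f :: dpoint. comp_D (fst d) (fst e) (fst f)"
abbreviation "ev_D2 \<equiv> \<lambda>X Y :: dpoint list. ev_D (map fst X) (map fst Y)"

lemma cat_D2_model: "matrix_model strip2 supp_D2 comp_D2 (cat_D2 :: ('k::field) D2_cat) ev_D2"
  using matrix_model_pullback[OF cat_D_model cat_D2_def] by simp

lemma orbit_D2: "orbit_model strip2 supp_D2 comp_D2 (cat_D2 :: ('k::field) D2_cat) ev_D2
  drot F_obj F_mor"
proof -
  interpret matrix_model strip2 supp_D2 comp_D2 "cat_D2 :: ('k::field) D2_cat" ev_D2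
    by (rule cat_D2_model)
  have m: "map fst (map (drot k) X) = map (rot k) (map fst X)" for k X
    by (simp add: drot_def)
  show ?thesis
  proof
    show "drot 0 d = d" for d by (simp add: drot_def)
    show "drot (k + l) d = drot k (drot l d)" for k l d by (auto simp: drot_def rot_add)
    show "drot k d \<in> strip2 \<longleftrightarrow> d \<in> strip2" for k d by (simp add: drot_def)
    show "supp_D2 (drot k d) (drot k e) = supp_D2 d e" for k d e by (simp add: drot_def)
    show "k = l" if "supp_D2 d (drot k e)" "supp_D2 d (drot l e)" for d e k l
      using that supp_D_rot_unique by (simp add: drot_def)
    show "comp_D2 d e f \<longleftrightarrow> supp_D2 d e \<and> supp_D2 e f \<and> supp_D2 d f" for d e f by (simp add: comp_D_def)
    show "F_obj = map (drot 1)"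
      by (auto simp: F_obj_def drot_def rot_def fun_eq_iff)
    show "F_mor = id" by (simp add: F_mor_def fun_eq_iff)
    show "carrier (Hom cat_D2 (map (drot k) X) (map (drot k) Y)) =
      carrier (Hom (cat_D2 :: ('k::field) D2_cat) X Y)" for k X Y
      unfolding cat_D2_def m lin_cat.simps by (simp only: m carrier_D_rot)
    show "ev_D2 (map (drot k) X) (map (drot k) Y) = (ev_D2 X Y :: 'k mat set \<Rightarrow> _)" for k X Y
      unfolding m by (rule ev_D_rot)
  qed
qed

section \<open>The continuous cluster category and its quotient by the cluster\<close>

interpretation D2: orbit_model strip2 supp_D2 comp_D2 "cat_D2 :: ('k::field) D2_cat"
  ev_D2 drot F_obj F_mor
  by (rule orbit_D2)

interpretation C: matrix_model strip2 D2.orb_supp D2.orb_comp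
  "cat_C :: ('k::field) C_cat" D2.orb_ev
  unfolding cat_C_def by (rule D2.orbit_is_matrix_model)

definition cluster_points :: "dpoint set" where
  "cluster_points = (\<lambda>t. (t, False)) ` std_cluster"

lemma concat_M: "concat (map M ps) = map (\<lambda>t. (t, False)) ps"
  by (induction ps) (simp_all add: M_def)

lemma quotient_add_T: "quotient_model strip2 D2.orb_supp D2.orb_comp
  (cat_C :: ('k::field) C_cat) D2.orb_ev (add_T TYPE('k)) cluster_points"
proof
  show sub: "cluster_points \<subseteq> strip2"
    using std_cluster_lift cluster_lift_in_strip by (auto simp: cluster_points_def)
  have "(0, 0) \<in> std_cluster"
    unfolding std_cluster_def by (rule CollectI, rule exI[of _ 0], rule exI[of _ 0]) simp
  then show "cluster_points \<noteq> {}" by (auto simp: cluster_points_def)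
  fix Z
  {
    assume Z: "set Z \<subseteq> cluster_points"
    then have O: "Z \<in> Obj (cat_C :: 'k C_cat)"
      using sub C.Obj_iff by blast
    have "concat (map M (map fst Z)) = Z"
      unfolding concat_M unfolding map_map using Z by (intro map_idI) (auto simp: cluster_points_def)
    then have "isomorphic_in (cat_C :: 'k C_cat) Z (concat (map M (map fst Z)))"
      unfolding isomorphic_in_def using C.id_mor[OF O] C.comp_id_mor[OF O O] by metis
    moreover have "set (map fst Z) \<subseteq> std_cluster" using Z by (auto simp: cluster_points_def)
    ultimately show "Z \<in> add_T TYPE('k)" using O unfolding add_T_def by blast
  next
    assume "Z \<in> add_T TYPE('k)"
    then obtain ps where *: "Z \<in> Obj (cat_C :: 'k C_cat)" "set ps \<subseteq> std_cluster"
      "isomorphic_in (cat_C :: 'k C_cat) Z (concat (map M ps))"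
      unfolding add_T_def by blast
    have "set (concat (map M ps)) \<subseteq> cluster_points" using *(2) unfolding concat_M cluster_points_def by auto
    then show "Z \<in> Obj (cat_C :: 'k C_cat) \<and> (\<exists>Z'. set Z' \<subseteq> cluster_points \<and>
       (\<exists>u\<in>carrier (Hom cat_C Z Z'). \<exists>v\<in>carrier (Hom cat_C Z' Z). Comp cat_C Z Z' Z v u =
          Idn (cat_C :: 'k C_cat) Z))"
      using *(1,3) unfolding isomorphic_in_def by blast
  }
qed

interpretation C_mod_T: quotient_model strip2 D2.orb_supp D2.orb_comp
  "cat_C :: ('k::field) C_cat" D2.orb_ev "add_T TYPE('k)" cluster_points
  by (rule quotient_add_T)

abbreviation "supp_CT2 \<equiv> \<lambda>d e :: dpoint. supp_CT (fst d) (fst e)"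
abbreviation "comp_CT2 \<equiv> \<lambda>d e f :: dpoint. comp_CT (fst d) (fst e) (fst f)"

lemma fst_drot: "fst (drot k d) = rot k (fst d)"
  by (simp add: drot_def)

lemma orb_supp_iff: "D2.orb_supp d e \<longleftrightarrow> (\<exists>k. supp_D (fst d) (rot k (fst e)))"
  unfolding D2.orb_supp_def fst_drot by (rule refl)

lemma orb_comp_iff: "D2.orb_comp d e f \<longleftrightarrow> (\<exists>k l. supp_D (fst d) (rot k (fst e)) \<and>
    supp_D (rot k (fst e)) (rot l (fst f)) \<and> supp_D (fst d) (rot l (fst f)))"
  unfolding D2.orb_comp_def fst_drot by (simp add: comp_D_def)

lemma quot_supp_C: "C.quot_supp cluster_points = supp_CT2"
proof (intro ext iffI)
  fix d e :: dpoint
  assume s: "C.quot_supp cluster_points d e"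
  then obtain k where k: "supp_D (fst d) (rot k (fst e))"
    unfolding C.quot_supp_def orb_supp_iff by blast
  have "\<not> (cluster_lift t \<and> hom_supp (fst d) t \<and> hom_supp t (rot k (fst e)))" for t
  proof
    assume t: "cluster_lift t \<and> hom_supp (fst d) t \<and> hom_supp t (rot k (fst e))"
    then obtain j t0 where t0: "t0 \<in> std_cluster" "t = rot j t0" using cluster_lift_std by blast
    have "D2.orb_comp d (t0, False) e"
      using supp_D_between[OF k, of t] t k t0(2) unfolding orb_comp_iff by auto
    then show False using s t0(1) unfolding C.quot_supp_def cluster_points_def by blast
  qed
  then show "supp_CT2 d e" using k unfolding supp_CT_def supp_T_def by blast
next
  fix d e :: dpoint
  assume "supp_CT2 d e"
  then obtain k where k: "supp_T (fst d) (rot k (fst e))" unfolding supp_CT_def by blast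
  have kD: "supp_D (fst d) (rot k (fst e))" using k supp_T_supp_D by blast
  have "\<not> D2.orb_comp d (t, False) e" if t: "t \<in> std_cluster" for t
  proof
    assume "D2.orb_comp d (t, False) e"
    then obtain j l where jl: "supp_D (fst d) (rot j t)" "supp_D (rot j t) (rot l (fst e))"
      "supp_D (fst d) (rot l (fst e))"
      unfolding orb_comp_iff by auto
    then have "l = k" using supp_D_rot_unique kD by blast
    then have "cluster_lift (rot j t) \<and> hom_supp (fst d) (rot j t) \<and> hom_supp (rot j t) (rot k (fst e))"
      using jl supp_D_hom_supp std_cluster_lift[OF t] by simp
    then show False using k unfolding supp_T_def by blast
  qed
  moreover have "D2.orb_supp d e" using kD unfolding orb_supp_iff by blast
  ultimately show "C.quot_supp cluster_points d e"
    unfolding C.quot_supp_def cluster_points_def by blast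
qed

lemma quot_comp_C: "C.quot_comp cluster_points = comp_CT2"
proof (intro ext iffI)
  fix d e f :: dpoint
  assume "C.quot_comp cluster_points d e f"
  then have 1: "D2.orb_comp d e f" and 2: "supp_CT2 d f"
    unfolding C.quot_comp_def quot_supp_C by blast+
  obtain j l where jl: "supp_D (fst d) (rot j (fst e))" "supp_D (rot j (fst e)) (rot l (fst f))"
      "supp_D (fst d) (rot l (fst f))"
    using 1 unfolding orb_comp_iff by blast
  obtain k where k: "supp_T (fst d) (rot k (fst f))" using 2 unfolding supp_CT_def by blast
  have "k = l" using supp_D_rot_unique jl(3) supp_T_supp_D[OF k] by blast
  then show "comp_CT2 d e f" using jl supp_D_hom_supp k unfolding comp_CT_def by blast
next
  fix d e f :: dpoint
  assume "comp_CT2 d e f"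
  then obtain j l where jl: "hom_supp (fst d) (rot j (fst e))" "hom_supp (rot j (fst e)) (rot l (fst f))"
      "supp_T (fst d) (rot l (fst f))" unfolding comp_CT_def by blast
  have "D2.orb_comp d e f"
    using supp_D_between[OF supp_T_supp_D[OF jl(3)] jl(1,2)] supp_T_supp_D[OF jl(3)]
    unfolding orb_comp_iff by blast
  moreover have "supp_CT2 d f" using jl(3) unfolding supp_CT_def by blast
  ultimately show "C.quot_comp cluster_points d e f" unfolding C.quot_comp_def quot_supp_C by blast
qed

definition ev_CT :: "dpoint list \<Rightarrow> dpoint list \<Rightarrow> ('k::field) CT_mor \<Rightarrow> nat \<Rightarrow> nat \<Rightarrow> 'k" where
  "ev_CT = C.quot_ev cluster_points"

lemma cat_CT_model: "matrix_model strip2 supp_CT2 comp_CT2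
  (cat_CT :: ('k::field) CT_cat) ev_CT"
  using C_mod_T.quotient_is_matrix_model unfolding quot_supp_C quot_comp_C ev_CT_def cat_CT_def .

text \<open>The basic morphism \<open>p \<rightarrow> q\<close> of \<open>\<B>\<close> gives a morphism of degree 0, so its image in \<open>\<C>/\<T>\<close> is
  nonzero iff the morphism space is nonzero and its degree is 0.\<close>

lemma supp_T_iff: "supp_T p q \<longleftrightarrow> supp_CT p q \<and> supp_D p q"
proof
  assume "supp_T p q"
  then show "supp_CT p q \<and> supp_D p q"
    unfolding supp_CT_def using supp_T_supp_D by (metis rot_0)
next
  assume "supp_CT p q \<and> supp_D p q"
  then obtain k where k: "supp_T p (rot k q)" "supp_D p (rot 0 q)" unfolding supp_CT_def by auto
  then have "k = 0" using supp_D_rot_unique supp_T_supp_D by blast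
  then show "supp_T p q" using k by simp
qed

lemma basic_mor_CT:
  assumes "in_strip p" "in_strip q" "hom_supp p q"
  shows "(basic_mor p q :: ('k::field) CT_mor) \<in> carrier (Hom cat_CT (M p) (M q)) \<and>
    ev_CT (M p) (M q) (basic_mor p q :: 'k CT_mor) =
      (\<lambda>j i. if j = 0 \<and> i = 0 \<and> supp_T p q then 1 else 0)"
proof -
  interpret B: quotient_model UNIV hom_supp comp_B "cat_B :: 'k B_cat" ev_B B_pi "{p. \<not> in_strip p}"
    by (rule quotient_B_pi)
  have OB: "X \<in> Obj (cat_B :: 'k B_cat)" for X using B.Obj_iff by blast
  define f where "f = quot_mor (cat_B :: 'k B_cat) B_pi [p] [q] (1\<^sub>m 1)"
  have one: "ev_B [p] [q] (1\<^sub>m 1 :: 'k mat) = (\<lambda>j i. if j = 0 \<and> i = 0 then 1 else 0)"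
    by (auto simp: ev_B_def fun_eq_iff)
  have 1: "(1\<^sub>m 1 :: 'k mat) \<in> carrier (Hom cat_B [p] [q])"
    unfolding carrier_B one using assms(3) by (auto simp: supported_def)
  have f: "f \<in> carrier (Hom cat_D [p] [q])"
    unfolding Hom_D B.carrier_quot f_def using 1 by blast
  have evf: "ev_D [p] [q] f = (\<lambda>j i. if j = 0 \<and> i = 0 \<and> supp_D p q then 1 else 0)"
    using B.quot_ev_quot_mor[OF OB OB 1] unfolding quot_ev_B quot_supp_B f_def[symmetric] one
    by (auto simp: coeff_cut_def fun_eq_iff)
  have OM: "M p \<in> Obj (cat_D2 :: 'k D2_cat)" "M q \<in> Obj (cat_D2 :: 'k D2_cat)"
    unfolding D2.Obj_iff using assms by (simp_all add: M_def)
  have f2: "f \<in> carrier (Hom cat_D2 (M p) (M q))" using f by (simp add: cat_D2_def M_def)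
  define g where "g = orbit_mor (cat_D2 :: 'k D2_cat) F_obj (M p) (M q) f"
  have g: "g \<in> carrier (Hom cat_C (M p) (M q))"
    "D2.orb_ev (M p) (M q) g = (\<lambda>j i. if j = 0 \<and> i = 0 \<and> supp_D p q then 1 else 0)"
    using D2.orbit_mor_in[OF OM f2] evf unfolding cat_C_def[symmetric] g_def by (simp_all add: M_def)
  have OC: "M p \<in> Obj (cat_C :: 'k C_cat)" "M q \<in> Obj (cat_C :: 'k C_cat)"
    unfolding C.Obj_iff using assms by (simp_all add: M_def)
  have b: "basic_mor p q = quot_mor (cat_C :: 'k C_cat) (add_T TYPE('k)) (M p) (M q) g"
    by (simp add: basic_mor_def g_def f_def)
  have "ev_CT (M p) (M q) (basic_mor p q :: 'k CT_mor) =
    coeff_cut supp_CT2 (M p) (M q) (\<lambda>j i. if j = 0 \<and> i = 0 \<and> supp_D p q then 1 else 0)"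
    using C_mod_T.quot_ev_quot_mor[OF OC g(1)] unfolding b ev_CT_def quot_supp_C g(2) .
  also have "\<dots> = (\<lambda>j i. if j = 0 \<and> i = 0 \<and> supp_T p q then 1 else 0)"
    by (auto simp: coeff_cut_def fun_eq_iff M_def supp_T_iff)
  finally show ?thesis unfolding cat_CT_def C_mod_T.carrier_quot b using g(1) by blast
qed

section \<open>A duality in linear algebra\<close>

text \<open>Induction on the rows. All right-hand sides on \<open>J\<close> are attained by hypothesis. If every solution
  of the homogeneous system on \<open>J\<close> also solved the new row, then this row would be a combination of
  the others, with coefficients given by its values on solutions for the unit vectors.\<close>

lemma solvable_if_rows_independent:
  fixes N :: "'a \<Rightarrow> 'b \<Rightarrow> 'k::field"
  assumes "finite J" "finite I"
    and "\<And>w. (\<And>i. i \<in> I \<Longrightarrow> (\<Sum>j\<in>J. w j * N j i) = 0) \<Longrightarrow> \<forall>j\<in>J. w j = 0"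
  shows "\<exists>x. \<forall>j\<in>J. (\<Sum>i\<in>I. N j i * x i) = v j"
  using assms(1,3)
proof (induction J arbitrary: v rule: finite_induct)
  case empty
  then show ?case by simp
next
  case (insert j0 J)
  define L where "L x j = (\<Sum>i\<in>I. N j i * x i)" for x j
  have L_lin: "L (\<lambda>i. y i - (\<Sum>j\<in>J. a j * z j i)) k = L y k - (\<Sum>j\<in>J. a j * L (z j) k)" for y a z k
  proof -
    have "L (\<lambda>i. y i - (\<Sum>j\<in>J. a j * z j i)) k = L y k - (\<Sum>i\<in>I. \<Sum>j\<in>J. a j * (N k i * z j i))"
      unfolding L_def by (simp add: right_diff_distrib sum_subtractf sum_distrib_left mult_ac)
    also have "(\<Sum>i\<in>I. \<Sum>j\<in>J. a j * (N k i * z j i)) = (\<Sum>j\<in>J. a j * L (z j) k)"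
      unfolding L_def sum_distrib_left by (rule sum.swap)
    finally show ?thesis .
  qed
  have solve: "\<exists>x. \<forall>j\<in>J. L x j = u j" for u
    unfolding L_def
  proof (rule insert.IH)
    fix w assume w: "\<And>i. i \<in> I \<Longrightarrow> (\<Sum>j\<in>J. w j * N j i) = 0"
    have "\<forall>j\<in>insert j0 J. (if j = j0 then 0 else w j) = 0"
    proof (rule insert.prems)
      fix i assume i: "i \<in> I"
      have "(\<Sum>j\<in>J. (if j = j0 then 0 else w j) * N j i) = (\<Sum>j\<in>J. w j * N j i)"
        by (rule sum.cong) (use insert.hyps in auto)
      then show "(\<Sum>j\<in>insert j0 J. (if j = j0 then 0 else w j) * N j i) = 0"
        using w[OF i] insert.hyps by simp
    qed
    then show "\<forall>j\<in>J. w j = 0" using insert.hyps by (metis insertCI)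
  qed
  have "\<exists>y. (\<forall>j\<in>J. L y j = 0) \<and> L y j0 \<noteq> 0"
  proof (rule ccontr)
    assume no: "\<not> ?thesis"
    obtain z where z: "\<And>j k. k \<in> J \<Longrightarrow> L (z j) k = (if k = j then 1 else 0)"
      using solve[of "\<lambda>k. if k = _ then 1 else 0"] by metis
    define w where "w j = (if j = j0 then 1 else - L (z j) j0)" for j
    have "\<forall>j\<in>insert j0 J. w j = 0"
    proof (rule insert.prems)
      fix i assume i: "i \<in> I"
      define y where "y = (\<lambda>i'. if i' = i then 1 else 0 :: 'k)"
      have Ly: "L y k = N k i" for k
      proof -
        have "L y k = (\<Sum>i'\<in>I. if i' = i then N k i else 0)"
          unfolding L_def y_def by (intro sum.cong) auto
        then show ?thesis using i assms(2) by simp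
      qed
      define y' where "y' = (\<lambda>i'. y i' - (\<Sum>j\<in>J. N j i * z j i'))"
      have Ly': "L y' k = N k i - (\<Sum>j\<in>J. N j i * L (z j) k)" for k
        unfolding y'_def L_lin Ly ..
      have "L y' k = 0" if k: "k \<in> J" for k
      proof -
        have "(\<Sum>j\<in>J. N j i * L (z j) k) = (\<Sum>j\<in>J. if j = k then N k i else 0)"
          by (intro sum.cong) (use z[OF k] in auto)
        then show ?thesis using k insert.hyps unfolding Ly' by simp
      qed
      then have "L y' j0 = 0" using no by blast
      moreover have "(\<Sum>j\<in>J. w j * N j i) = (\<Sum>j\<in>J. - (N j i * L (z j) j0))"
        by (intro sum.cong) (use insert.hyps in \<open>auto simp: w_def\<close>)
      ultimately show "(\<Sum>j\<in>insert j0 J. w j * N j i) = 0"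
        using insert.hyps unfolding Ly' by (simp add: w_def sum_negf)
    qed
    then show False by (simp add: w_def)
  qed
  then obtain y where y: "\<And>j. j \<in> J \<Longrightarrow> L y j = 0" "L y j0 \<noteq> 0" by blast
  obtain x where x: "\<And>j. j \<in> J \<Longrightarrow> L x j = v j" using solve by blast
  define a where "a = (v j0 - L x j0) / L y j0"
  have L2: "L (\<lambda>i. x i + a * y i) k = L x k + a * L y k" for k
    unfolding L_def by (simp add: distrib_left sum.distrib sum_distrib_left mult_ac)
  have "\<forall>j\<in>insert j0 J. L (\<lambda>i. x i + a * y i) j = v j"
    unfolding L2 using x y by (simp add: a_def)
  then show ?case unfolding L_def by (rule exI[of _ "\<lambda>i. x i + a * y i"])
qed

section \<open>Direct limits and the three conditions\<close>

locale direct_system =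
  fixes V :: "real \<Rightarrow> 'm set" and t :: "real \<Rightarrow> real \<Rightarrow> 'm \<Rightarrow> 'm"
  assumes t_in: "0 < \<gamma> \<Longrightarrow> \<gamma> < \<epsilon> \<Longrightarrow> v \<in> V \<epsilon> \<Longrightarrow> t \<epsilon> \<gamma> v \<in> V \<gamma>"
    and t_t: "0 < \<delta> \<Longrightarrow> \<delta> < \<gamma> \<Longrightarrow> \<gamma> < \<epsilon> \<Longrightarrow> v \<in> V \<epsilon> \<Longrightarrow> t \<gamma> \<delta> (t \<epsilon> \<gamma> v) = t \<epsilon> \<delta> v"
begin

lemma agree_below:
  assumes "0 < \<gamma>'" "\<gamma>' \<le> \<gamma>" "\<gamma> < \<epsilon>" "\<gamma> < \<delta>" "v \<in> V \<epsilon>" "w \<in> V \<delta>" "t \<epsilon> \<gamma> v = t \<delta> \<gamma> w"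
  shows "t \<epsilon> \<gamma>' v = t \<delta> \<gamma>' w"
proof (cases "\<gamma>' = \<gamma>")
  case False
  then show ?thesis using assms t_t[of \<gamma>' \<gamma> \<epsilon> v] t_t[of \<gamma>' \<gamma> \<delta> w] by simp
qed (use assms in simp)

lemma lim_class_self: "0 < \<epsilon> \<Longrightarrow> v \<in> V \<epsilon> \<Longrightarrow> (\<epsilon>, v) \<in> lim_class V t \<epsilon> v"
  by (auto simp: lim_class_def intro!: exI[of _ "\<epsilon> / 2"])

lemma lim_class_eq_iff:
  assumes "0 < \<epsilon>" "v \<in> V \<epsilon>" "0 < \<delta>" "w \<in> V \<delta>"
  shows "lim_class V t \<epsilon> v = lim_class V t \<delta> w \<longleftrightarrow> (\<exists>\<gamma>>0. \<gamma> < \<epsilon> \<and> \<gamma> < \<delta> \<and> t \<epsilon> \<gamma> v = t \<delta> \<gamma> w)"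
proof
  assume "lim_class V t \<epsilon> v = lim_class V t \<delta> w"
  then have "(\<delta>, w) \<in> lim_class V t \<epsilon> v" using lim_class_self assms by simp
  then show "\<exists>\<gamma>>0. \<gamma> < \<epsilon> \<and> \<gamma> < \<delta> \<and> t \<epsilon> \<gamma> v = t \<delta> \<gamma> w" by (auto simp: lim_class_def)
next
  have sub: "lim_class V t \<delta> w \<subseteq> lim_class V t \<epsilon> v"
    if 1: "0 < \<gamma>" "\<gamma> < \<epsilon>" "\<gamma> < \<delta>" "t \<epsilon> \<gamma> v = t \<delta> \<gamma> w" and vw: "v \<in> V \<epsilon>" "w \<in> V \<delta>"
    for \<epsilon> \<delta> v w \<gamma>
  proof
    fix x assume "x \<in> lim_class V t \<delta> w"
    then obtain \<zeta> u \<beta> where x: "x = (\<zeta>, u)" "\<zeta> > 0" "u \<in> V \<zeta>"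
      and 2: "0 < \<beta>" "\<beta> < \<delta>" "\<beta> < \<zeta>" "t \<delta> \<beta> w = t \<zeta> \<beta> u"
      by (auto simp: lim_class_def)
    have "t \<epsilon> (min \<gamma> \<beta>) v = t \<delta> (min \<gamma> \<beta>) w"
      by (rule agree_below[of _ \<gamma>]) (use 1 2 vw in auto)
    also have "\<dots> = t \<zeta> (min \<gamma> \<beta>) u"
      by (rule agree_below[of _ \<beta>]) (use 1 2 vw x in auto)
    finally show "x \<in> lim_class V t \<epsilon> v"
      unfolding lim_class_def x(1) using 1 2 x by (auto intro!: exI[of _ "min \<gamma> \<beta>"])
  qed
  assume "\<exists>\<gamma>>0. \<gamma> < \<epsilon> \<and> \<gamma> < \<delta> \<and> t \<epsilon> \<gamma> v = t \<delta> \<gamma> w"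
  then obtain \<gamma> where "0 < \<gamma>" "\<gamma> < \<epsilon>" "\<gamma> < \<delta>" "t \<epsilon> \<gamma> v = t \<delta> \<gamma> w" by blast
  then show "lim_class V t \<epsilon> v = lim_class V t \<delta> w"
    using sub[of \<gamma> \<epsilon> \<delta> v w] sub[of \<gamma> \<delta> \<epsilon> w v] assms by auto
qed

lemma lim_class_transition:
  assumes "0 < \<gamma>" "\<gamma> < \<epsilon>" "v \<in> V \<epsilon>"
  shows "lim_class V t \<gamma> (t \<epsilon> \<gamma> v) = lim_class V t \<epsilon> v"
  by (subst lim_class_eq_iff) (use assms t_in t_t[of "\<gamma> / 2" \<gamma> \<epsilon> v] in \<open>auto intro!: exI[of _ "\<gamma> / 2"]\<close>)

lemma lim_class_in: "0 < \<epsilon> \<Longrightarrow> v \<in> V \<epsilon> \<Longrightarrow> lim_class V t \<epsilon> v \<in> dir_lim V t"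
  by (auto simp: dir_lim_def)

lemma dir_lim_represented_below:
  assumes "\<kappa> \<in> dir_lim V t" "0 < e"
  obtains \<epsilon> v where "0 < \<epsilon>" "\<epsilon> < e" "v \<in> V \<epsilon>" "\<kappa> = lim_class V t \<epsilon> v"
proof -
  obtain \<epsilon>0 v where v: "\<epsilon>0 > 0" "v \<in> V \<epsilon>0" "\<kappa> = lim_class V t \<epsilon>0 v"
    using assms(1) by (auto simp: dir_lim_def)
  define \<epsilon> where "\<epsilon> = min \<epsilon>0 e / 2"
  have "0 < \<epsilon>" "\<epsilon> < \<epsilon>0" "\<epsilon> < e" using v assms(2) by (auto simp: \<epsilon>_def)
  then show ?thesis using that[of \<epsilon> "t \<epsilon>0 \<epsilon> v"] v t_in lim_class_transition by simp
qed

end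

locale direct_system_map = V: direct_system V t + W: direct_system W s
  for V :: "real \<Rightarrow> 'm set" and t and W :: "real \<Rightarrow> 'm set" and s +
  fixes \<phi> :: "real \<Rightarrow> 'm \<Rightarrow> 'm"
  assumes \<phi>_in: "0 < \<epsilon> \<Longrightarrow> v \<in> V \<epsilon> \<Longrightarrow> \<phi> \<epsilon> v \<in> W \<epsilon>"
    and \<phi>_t: "0 < \<gamma> \<Longrightarrow> \<gamma> < \<epsilon> \<Longrightarrow> v \<in> V \<epsilon> \<Longrightarrow> \<phi> \<gamma> (t \<epsilon> \<gamma> v) = s \<epsilon> \<gamma> (\<phi> \<epsilon> v)"
begin

lemma lim_map_class:
  assumes "0 < \<epsilon>" "v \<in> V \<epsilon>"
  shows "lim_map W s \<phi> (lim_class V t \<epsilon> v) = lim_class W s \<epsilon> (\<phi> \<epsilon> v)"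
proof -
  have "lim_class W s \<delta> (\<phi> \<delta> w) = lim_class W s \<epsilon> (\<phi> \<epsilon> v)" if w: "(\<delta>, w) \<in> lim_class V t \<epsilon> v" for \<delta> w
  proof -
    obtain \<gamma> where "\<delta> > 0" "w \<in> V \<delta>" "0 < \<gamma>" "\<gamma> < \<epsilon>" "\<gamma> < \<delta>" "t \<epsilon> \<gamma> v = t \<delta> \<gamma> w"
      using w by (auto simp: lim_class_def)
    then show ?thesis
      using \<phi>_t[of \<gamma> \<epsilon> v] \<phi>_t[of \<gamma> \<delta> w] \<phi>_in assms by (subst W.lim_class_eq_iff) auto
  qed
  then show ?thesis using V.lim_class_self[OF assms] unfolding lim_map_def by blast
qed

end

interpretation CT: matrix_model strip2 supp_CT2 comp_CT2
  "cat_CT :: ('k::field) CT_cat" ev_CT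
  by (rule cat_CT_model)

lemma M_Obj: "in_strip p \<Longrightarrow> M p \<in> Obj (cat_CT :: ('k::field) CT_cat)"
  unfolding CT.Obj_iff by (simp add: M_def)

text \<open>If a composite of two basic morphisms of degree 0 is nonzero, then it has degree 0 too. This makes
  the transition maps of the two limits functorial.\<close>

lemma basic_triple:
  assumes "hom_supp p q" "hom_supp q r"
  shows "comp_CT p q r \<and> supp_T p q \<and> supp_T q r \<longleftrightarrow> supp_T p r"
proof
  assume a: "comp_CT p q r \<and> supp_T p q \<and> supp_T q r"
  then obtain k l where kl: "hom_supp p (rot k q)" "hom_supp (rot k q) (rot l r)" "supp_T p (rot l r)"
    unfolding comp_CT_def by blast
  note D = supp_D_between[OF supp_T_supp_D[OF kl(3)] kl(1,2)]
  have "k = 0" using supp_D_rot_unique[of p k q 0] D(1) a supp_T_supp_D by auto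
  moreover from this have "l = 0" using supp_D_rot_unique[of q l r 0] D(2) a supp_T_supp_D by auto
  ultimately show "supp_T p r" using kl by simp
next
  assume "supp_T p r"
  then have "comp_CT p q r" using assms unfolding comp_CT_def by (metis rot_0)
  then show "comp_CT p q r \<and> supp_T p q \<and> supp_T q r"
    using supp_T_between[OF \<open>supp_T p r\<close> assms] by blast
qed

lemma coeff_comp_through_M: "coeff_comp c X (M q) Z B A j i = (if c (X ! i) (q, False) (Z ! j) then B j 0 * A 0 i else 0)"
  by (simp add: coeff_comp_def M_def)

lemma M_nth: "M p ! 0 = (p, False)"
  by (simp add: M_def)

lemma basic_comp:
  assumes "in_strip p" "in_strip q" "in_strip r" "hom_supp p q" "hom_supp q r"
  shows "Comp cat_CT (M p) (M q) (M r) (basic_mor q r) (basic_mor p q) = (basic_mor p r :: ('k::field) CT_mor)"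
proof -
  have pr: "hom_supp p r" using assms hom_supp_trans by blast
  note O = M_Obj[OF assms(1)] M_Obj[OF assms(2)] M_Obj[OF assms(3)]
  note b = basic_mor_CT[OF assms(1,2,4)] basic_mor_CT[OF assms(2,3,5)] basic_mor_CT[OF assms(1,3) pr]
  note c = CT.comp_mor[OF O b(1)[THEN conjunct1] b(2)[THEN conjunct1]]
  have "ev_CT (M p) (M r) (Comp cat_CT (M p) (M q) (M r) (basic_mor q r) (basic_mor p q)) j i =
    ev_CT (M p) (M r) (basic_mor p r :: 'k CT_mor) j i" for j i
  proof (cases "j = 0 \<and> i = 0")
    case True
    then show ?thesis using basic_triple[OF assms(4,5)]
      unfolding c[THEN conjunct2] b(1)[THEN conjunct2] b(2)[THEN conjunct2] b(3)[THEN conjunct2] coeff_comp_through_M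
      by (auto simp: M_nth)
  next
    case False
    then show ?thesis
      unfolding c[THEN conjunct2] b(1)[THEN conjunct2] b(2)[THEN conjunct2] b(3)[THEN conjunct2] coeff_comp_through_M
      by auto
  qed
  then show ?thesis by (intro CT.ev_eqI[OF O(1,3)]) (use c b in auto)
qed

lemma basic_shift:
  assumes "in_strip p" "e < e'"
  shows "(basic_mor (shift p e) (shift p e') :: ('k::field) CT_mor)
    \<in> carrier (Hom cat_CT (M (shift p e)) (M (shift p e')))"
  by (rule basic_mor_CT[THEN conjunct1]) (use assms in \<open>simp_all add: hom_supp_shift\<close>)

lemma basic_shift_comp:
  assumes "in_strip p" "e < e'" "e' < e''"
  shows "Comp cat_CT (M (shift p e)) (M (shift p e')) (M (shift p e''))
      (basic_mor (shift p e') (shift p e'')) (basic_mor (shift p e) (shift p e')) =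
    (basic_mor (shift p e) (shift p e'') :: ('k::field) CT_mor)"
  by (rule basic_comp) (use assms in \<open>simp_all add: hom_supp_shift\<close>)

lemma from_direct_system:
  assumes p: "in_strip p" and X: "X \<in> Obj (cat_CT :: ('k::field) CT_cat)"
  shows "direct_system (from_sys p X :: real \<Rightarrow> 'k CT_mor set) (from_trans p X)"
proof -
  have S: "in_strip (shift p e)" for e using p by simp
  note O = M_Obj[OF S]
  note b = basic_shift[OF p, where ?'k = 'k]
  show ?thesis
  proof
    fix \<gamma> \<epsilon> :: real and v :: "'k CT_mor" assume 1: "0 < \<gamma>" "\<gamma> < \<epsilon>" "v \<in> from_sys p X \<epsilon>"
    then have v: "v \<in> carrier (Hom cat_CT (M (shift p \<epsilon>)) X)" by (simp add: from_sys_def)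
    show "from_trans p X \<epsilon> \<gamma> v \<in> from_sys p X \<gamma>"
      unfolding from_trans_def from_sys_def using CT.comp_mor[OF O O X b[OF 1(2)] v] by blast
  next
    fix \<delta> \<gamma> \<epsilon> :: real and v :: "'k CT_mor"
    assume 1: "0 < \<delta>" "\<delta> < \<gamma>" "\<gamma> < \<epsilon>" "v \<in> from_sys p X \<epsilon>"
    then have v: "v \<in> carrier (Hom cat_CT (M (shift p \<epsilon>)) X)" by (simp add: from_sys_def)
    show "from_trans p X \<gamma> \<delta> (from_trans p X \<epsilon> \<gamma> v) = from_trans p X \<epsilon> \<delta> v"
      unfolding from_trans_def
      using CT.comp_assoc_mor[OF O O O X b[OF 1(2)] b[OF 1(3)] v]
      unfolding basic_shift_comp[OF p 1(2,3)] by simp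
  qed
qed

lemma to_direct_system:
  assumes p: "in_strip p" and X: "X \<in> Obj (cat_CT :: ('k::field) CT_cat)"
  shows "direct_system (to_sys X p :: real \<Rightarrow> 'k CT_mor set) (to_trans X p)"
proof -
  have S: "in_strip (shift p e)" for e using p by simp
  note O = M_Obj[OF S]
  note b = basic_shift[OF p, where ?'k = 'k]
  show ?thesis
  proof
    fix \<gamma> \<epsilon> :: real and v :: "'k CT_mor" assume 1: "0 < \<gamma>" "\<gamma> < \<epsilon>" "v \<in> to_sys X p \<epsilon>"
    then have v: "v \<in> carrier (Hom cat_CT X (M (shift p (- \<epsilon>))))" by (simp add: to_sys_def)
    show "to_trans X p \<epsilon> \<gamma> v \<in> to_sys X p \<gamma>"
      unfolding to_trans_def to_sys_def using CT.comp_mor[OF X O O v b[of "- \<epsilon>" "- \<gamma>"]] 1 by auto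
  next
    fix \<delta> \<gamma> \<epsilon> :: real and v :: "'k CT_mor"
    assume 1: "0 < \<delta>" "\<delta> < \<gamma>" "\<gamma> < \<epsilon>" "v \<in> to_sys X p \<epsilon>"
    then have v: "v \<in> carrier (Hom cat_CT X (M (shift p (- \<epsilon>))))" by (simp add: to_sys_def)
    have n: "- \<gamma> < - \<delta>" "- \<epsilon> < - \<gamma>" using 1 by simp_all
    show "to_trans X p \<gamma> \<delta> (to_trans X p \<epsilon> \<gamma> v) = to_trans X p \<epsilon> \<delta> v"
      unfolding to_trans_def
      using CT.comp_assoc_mor[OF X O O O v b[OF n(2)] b[OF n(1)]]
      unfolding basic_shift_comp[OF p n(2,1)] by simp
  qed
qed

context
  fixes X Y :: "dpoint list" and f :: "('k::field) CT_mor"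
  assumes X: "X \<in> Obj (cat_CT :: 'k CT_cat)"
    and Y: "Y \<in> Obj (cat_CT :: 'k CT_cat)"
    and f: "f \<in> carrier (Hom cat_CT X Y)"
begin

lemma from_direct_map:
  assumes p: "in_strip p"
  shows "direct_system_map (from_sys p X) (from_trans p X) (from_sys p Y) (from_trans p Y)
    (\<lambda>\<epsilon> g. Comp cat_CT (M (shift p \<epsilon>)) X Y f g)"
proof -
  have S: "in_strip (shift p e)" for e using p by simp
  note O = M_Obj[OF S]
  note b = basic_shift[OF p, where ?'k = 'k]
  interpret V: direct_system "from_sys p X :: real \<Rightarrow> 'k CT_mor set" "from_trans p X"
    by (rule from_direct_system[OF p X])
  interpret W: direct_system "from_sys p Y :: real \<Rightarrow> 'k CT_mor set" "from_trans p Y"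
    by (rule from_direct_system[OF p Y])
  show ?thesis
  proof
    fix \<epsilon> :: real and v :: "'k CT_mor" assume "0 < \<epsilon>" "v \<in> from_sys p X \<epsilon>"
    then show "Comp cat_CT (M (shift p \<epsilon>)) X Y f v \<in> from_sys p Y \<epsilon>"
      unfolding from_sys_def using CT.comp_mor[OF O X Y _ f] by blast
  next
    fix \<gamma> \<epsilon> :: real and v :: "'k CT_mor" assume 1: "0 < \<gamma>" "\<gamma> < \<epsilon>" "v \<in> from_sys p X \<epsilon>"
    then have v: "v \<in> carrier (Hom cat_CT (M (shift p \<epsilon>)) X)" by (simp add: from_sys_def)
    show "Comp cat_CT (M (shift p \<gamma>)) X Y f (from_trans p X \<epsilon> \<gamma> v) =
      from_trans p Y \<epsilon> \<gamma> (Comp cat_CT (M (shift p \<epsilon>)) X Y f v)"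
      unfolding from_trans_def using CT.comp_assoc_mor[OF O O X Y b[OF 1(2)] v f] .
  qed
qed

lemma to_direct_map:
  assumes p: "in_strip p"
  shows "direct_system_map (to_sys Y p) (to_trans Y p) (to_sys X p) (to_trans X p)
    (\<lambda>\<epsilon> g. Comp cat_CT X Y (M (shift p (- \<epsilon>))) g f)"
proof -
  have S: "in_strip (shift p e)" for e using p by simp
  note O = M_Obj[OF S]
  note b = basic_shift[OF p, where ?'k = 'k]
  interpret V: direct_system "to_sys Y p :: real \<Rightarrow> 'k CT_mor set" "to_trans Y p"
    by (rule to_direct_system[OF p Y])
  interpret W: direct_system "to_sys X p :: real \<Rightarrow> 'k CT_mor set" "to_trans X p"
    by (rule to_direct_system[OF p X])
  show ?thesis
  proof
    fix \<epsilon> :: real and v :: "'k CT_mor" assume "0 < \<epsilon>" "v \<in> to_sys Y p \<epsilon>"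
    then show "Comp cat_CT X Y (M (shift p (- \<epsilon>))) v f \<in> to_sys X p \<epsilon>"
      unfolding to_sys_def using CT.comp_mor[OF X Y O f] by blast
  next
    fix \<gamma> \<epsilon> :: real and v :: "'k CT_mor" assume 1: "0 < \<gamma>" "\<gamma> < \<epsilon>" "v \<in> to_sys Y p \<epsilon>"
    then have v: "v \<in> carrier (Hom cat_CT Y (M (shift p (- \<epsilon>))))" by (simp add: to_sys_def)
    show "Comp cat_CT X Y (M (shift p (- \<gamma>))) (to_trans Y p \<epsilon> \<gamma> v) f =
      to_trans X p \<epsilon> \<gamma> (Comp cat_CT X Y (M (shift p (- \<epsilon>))) v f)"
      unfolding to_trans_def using CT.comp_assoc_mor[OF X Y O O f v b[of "- \<epsilon>" "- \<gamma>"], symmetric] 1 by auto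
  qed
qed

lemma epi_imp_to_tau_inj:
  assumes p: "p \<in> std_cluster" and epi: "epi_in cat_CT X Y f"
  shows "inj_on (hom_to_tau_map X Y p f) (hom_to_tau Y p)"
proof (rule inj_onI)
  have ps: "in_strip p" using p std_cluster_lift cluster_lift_in_strip by blast
  interpret F: direct_system_map "to_sys Y p" "to_trans Y p" "to_sys X p" "to_trans X p"
    "\<lambda>\<epsilon> g. Comp cat_CT X Y (M (shift p (- \<epsilon>))) g f" by (rule to_direct_map[OF ps])
  fix \<kappa> \<mu> assume \<kappa>: "\<kappa> \<in> hom_to_tau Y p" and \<mu>: "\<mu> \<in> hom_to_tau Y p"
    and e: "hom_to_tau_map X Y p f \<kappa> = hom_to_tau_map X Y p f \<mu>"
  obtain \<epsilon> u where u: "0 < \<epsilon>" "u \<in> to_sys Y p \<epsilon>" "\<kappa> = lim_class (to_sys Y p) (to_trans Y p) \<epsilon> u"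
    using \<kappa> unfolding hom_to_tau_def dir_lim_def by blast
  obtain \<delta> v where v: "0 < \<delta>" "v \<in> to_sys Y p \<delta>" "\<mu> = lim_class (to_sys Y p) (to_trans Y p) \<delta> v"
    using \<mu> unfolding hom_to_tau_def dir_lim_def by blast
  obtain \<gamma> where \<gamma>: "0 < \<gamma>" "\<gamma> < \<epsilon>" "\<gamma> < \<delta>"
    "to_trans X p \<epsilon> \<gamma> (Comp cat_CT X Y (M (shift p (- \<epsilon>))) u f) =
     to_trans X p \<delta> \<gamma> (Comp cat_CT X Y (M (shift p (- \<delta>))) v f)"
    using F.W.lim_class_eq_iff[THEN iffD1, OF u(1) F.\<phi>_in[OF u(1,2)] v(1) F.\<phi>_in[OF v(1,2)]]
      e[unfolded hom_to_tau_map_def u(3) v(3) F.lim_map_class[OF u(1,2)] F.lim_map_class[OF v(1,2)]]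
    by blast
  have "Comp cat_CT X Y (M (shift p (- \<gamma>))) (to_trans Y p \<epsilon> \<gamma> u) f =
    Comp cat_CT X Y (M (shift p (- \<gamma>))) (to_trans Y p \<delta> \<gamma> v) f"
    using \<gamma>(4) F.\<phi>_t[OF \<gamma>(1,2) u(2)] F.\<phi>_t[OF \<gamma>(1,3) v(2)] by simp
  moreover have "M (shift p (- \<gamma>)) \<in> Obj (cat_CT :: 'k CT_cat)"
    by (rule M_Obj) (simp add: ps)
  moreover have "to_trans Y p \<epsilon> \<gamma> u \<in> carrier (Hom cat_CT Y (M (shift p (- \<gamma>))))"
    "to_trans Y p \<delta> \<gamma> v \<in> carrier (Hom cat_CT Y (M (shift p (- \<gamma>))))"
    using F.V.t_in[OF \<gamma>(1,2) u(2)] F.V.t_in[OF \<gamma>(1,3) v(2)] unfolding to_sys_def .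
  ultimately have "to_trans Y p \<epsilon> \<gamma> u = to_trans Y p \<delta> \<gamma> v" using epi unfolding epi_in_def by blast
  then show "\<kappa> = \<mu>"
    unfolding u(3) v(3) F.V.lim_class_eq_iff[OF u(1,2) v(1,2)] using \<gamma>(1-3) by blast
qed

text \<open>For small \<open>\<epsilon>\<close> write \<open>a\<close> and \<open>b\<close> for \<open>S\<close> moved by \<open>\<epsilon>\<close> and \<open>- \<epsilon>\<close>. The coefficients of
  morphisms \<open>a \<rightarrow> X\<close> and \<open>X \<rightarrow> b\<close> are indexed by the same summands of \<open>X\<close>, likewise for \<open>Y\<close>, and
  associativity of \<open>a \<rightarrow> X\<^sub>i \<rightarrow> Y\<^sub>j \<rightarrow> b\<close> shows that \<open>f\<close> acts on both sides through the same matrix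
  \<open>N\<close>. So injectivity on one side is independence of its rows, and surjectivity on the other side is
  solvability of the corresponding systems of linear equations.\<close>

lemma to_tau_inj_imp_from_tau_inv_surj:
  assumes p: "p \<in> std_cluster"
    and inj: "inj_on (hom_to_tau_map X Y p f) (hom_to_tau Y p)"
  shows "hom_from_tau_inv_map p X Y f ` hom_from_tau_inv p X = hom_from_tau_inv p Y"
proof -
  have pl: "cluster_lift p" using p std_cluster_lift by blast
  have ps: "in_strip p" using pl cluster_lift_in_strip by blast
  interpret F: direct_system_map "from_sys p X" "from_trans p X" "from_sys p Y" "from_trans p Y"
    "\<lambda>\<epsilon> g. Comp cat_CT (M (shift p \<epsilon>)) X Y f g" by (rule from_direct_map[OF ps])
  interpret T: direct_system_map "to_sys Y p" "to_trans Y p" "to_sys X p" "to_trans X p"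
    "\<lambda>\<epsilon> g. Comp cat_CT X Y (M (shift p (- \<epsilon>))) g f" by (rule to_direct_map[OF ps])
  show ?thesis
  proof (intro equalityI subsetI)
    fix \<kappa> assume "\<kappa> \<in> hom_from_tau_inv_map p X Y f ` hom_from_tau_inv p X"
    then obtain \<epsilon> v where v: "0 < \<epsilon>" "v \<in> from_sys p X \<epsilon>"
      "\<kappa> = hom_from_tau_inv_map p X Y f (lim_class (from_sys p X) (from_trans p X) \<epsilon> v)"
      unfolding hom_from_tau_inv_def dir_lim_def by blast
    then show "\<kappa> \<in> hom_from_tau_inv p Y"
      unfolding hom_from_tau_inv_def hom_from_tau_inv_map_def
      using F.lim_map_class[OF v(1,2)] F.W.lim_class_in[OF v(1) F.\<phi>_in[OF v(1,2)]] by simp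
  next
    fix \<kappa> :: "(real \<times> 'k CT_mor) set" assume \<kappa>: "\<kappa> \<in> hom_from_tau_inv p Y"
    obtain e1 where e1: "e1 > 0" "\<And>d. d \<in> set X \<union> set Y \<Longrightarrow> paired_within p (fst d) e1"
      using pairing_near_cluster_finite[OF pl, of "fst ` (set X \<union> set Y)"] X Y unfolding CT.Obj_iff by blast
    obtain e2 where e2: "e2 > 0" "\<And>\<epsilon> \<gamma>. 0 < \<gamma> \<Longrightarrow> \<gamma> < \<epsilon> \<Longrightarrow> \<epsilon> < e2 \<Longrightarrow>
      supp_T (shift p (- \<epsilon>)) (shift p (- \<gamma>))" using supp_T_near_cluster[OF pl] by blast
    have "0 < min e1 e2" using e1 e2 by simp
    then obtain \<epsilon> v where v: "0 < \<epsilon>" "\<epsilon> < min e1 e2" "v \<in> from_sys p Y \<epsilon>"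
      "\<kappa> = lim_class (from_sys p Y) (from_trans p Y) \<epsilon> v"
      by (rule F.W.dir_lim_represented_below[OF \<kappa>[unfolded hom_from_tau_inv_def]])
    define a b where "a = shift p \<epsilon>" and "b = shift p (- \<epsilon>)"
    have ab: "in_strip a" "in_strip b" using ps by (simp_all add: a_def b_def)
    note Oa = M_Obj[OF ab(1), where ?'k = 'k] and Ob = M_Obj[OF ab(2), where ?'k = 'k]
    have st: "comp_CT a (fst d) b" if "d \<in> set X \<union> set Y" "supp_CT (fst d) b \<or> supp_CT a (fst d)" for d
      using e1(2)[OF that(1)] that(2) v(1,2)
      unfolding a_def b_def paired_within_def min_less_iff_conj by blast
    have strip: "in_strip (fst d)" if "d \<in> set X \<union> set Y" for d
      using that X Y unfolding CT.Obj_iff by blast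
    have cs: "supp_CT a (fst d) \<and> supp_CT (fst d) b \<and> supp_CT a b" if "d \<in> set X \<union> set Y" "comp_CT a (fst d) b" for d
      using CT.comp_supp[of "(a, False)" d "(b, False)"] that strip ab by simp
    have XV: "X ! i \<in> set X \<union> set Y" if "i < length X" for i using that by simp
    have YV: "Y ! j \<in> set X \<union> set Y" if "j < length Y" for j using that by simp
    have v': "v \<in> carrier (Hom cat_CT (M a) Y)" using v(3) by (simp add: from_sys_def a_def)
    have vs: "supported supp_CT2 (M a) Y (ev_CT (M a) Y v)" by (rule CT.ev_supported[OF Oa Y v'])
    define J where "J = {j. j < length Y \<and> supp_CT a (fst (Y ! j))}"
    define I where "I = {i. i < length X \<and> supp_CT a (fst (X ! i))}"
    have fin: "finite J" "finite I" "J \<subseteq> {..<length Y}" "I \<subseteq> {..<length X}" by (auto simp: J_def I_def)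
    define N where "N j i = (if comp_CT a (fst (X ! i)) (fst (Y ! j)) then ev_CT X Y f j i else 0)" for j i
    have "\<exists>x. \<forall>j\<in>J. (\<Sum>i\<in>I. N j i * x i) = ev_CT (M a) Y v j 0"
    proof (rule solvable_if_rows_independent[OF fin(1,2)])
      fix w assume w: "\<And>i. i \<in> I \<Longrightarrow> (\<Sum>j\<in>J. w j * N j i) = 0"
      define W where "W k j = (if k = 0 \<and> j \<in> J then w j else 0)" for k :: nat and j
      have "supported supp_CT2 Y (M b) W"
        unfolding supported_def
      proof (intro allI impI)
        fix k j assume "W k j \<noteq> 0"
        then have *: "k = 0" "j \<in> J" by (auto simp: W_def split: if_splits)
        then have "j < length Y" "supp_CT a (fst (Y ! j))" by (auto simp: J_def)
        moreover from this have "supp_CT (fst (Y ! j)) b" using st[OF YV] cs[OF YV] by blast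
        ultimately show "j < length Y \<and> k < length (M b) \<and> supp_CT2 (Y ! j) (M b ! k)"
          using * by (simp add: M_def)
      qed
      then obtain u where u: "u \<in> carrier (Hom cat_CT Y (M b))" "ev_CT Y (M b) u = W"
        using CT.ev_obtain[OF Y Ob] by blast
      define z where "z = \<zero>\<^bsub>Hom (cat_CT :: 'k CT_cat) Y (M b)\<^esub>"
      have z: "z \<in> carrier (Hom cat_CT Y (M b))" "ev_CT Y (M b) z = (\<lambda>j i. 0)"
        using CT.zero_mor[OF Y Ob] unfolding z_def by blast+
      have uf: "ev_CT X (M b) (Comp cat_CT X Y (M b) u f) k i = 0" for k i
      proof (cases "k = 0 \<and> i < length X \<and> supp_CT (fst (X ! i)) b")
        case True
        then have i: "i \<in> I" "comp_CT a (fst (X ! i)) b" using st[OF XV] cs[OF XV] unfolding I_def by blast+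
        have "(if comp_CT2 (X ! i) (Y ! j) (M b ! k) then W k j * ev_CT X Y f j i else 0) =
          (if j \<in> J then w j * N j i else 0)" if j: "j < length Y" for j
        proof (cases "j \<in> J")
          case jJ: True
          then have "comp_CT a (fst (Y ! j)) b" using st[OF YV] unfolding J_def by blast
          \<comment> \<open>Both composites decide whether \<open>a \<rightarrow> X\<^sub>i \<rightarrow> Y\<^sub>j \<rightarrow> b\<close> is nonzero.\<close>
          then have "comp_CT (fst (X ! i)) (fst (Y ! j)) b \<longleftrightarrow> comp_CT a (fst (X ! i)) (fst (Y ! j))"
            using CT.comp_assoc[of "(a, False)" "X ! i" "Y ! j" "(b, False)"] i(2) ab
              strip[OF XV] strip[OF YV[OF j]] True by simp
          then show ?thesis using jJ True by (simp add: N_def W_def M_nth)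
        qed (simp add: W_def)
        then have "ev_CT X (M b) (Comp cat_CT X Y (M b) u f) k i = (\<Sum>j<length Y. if j \<in> J then w j * N j i else 0)"
          unfolding CT.comp_mor[OF X Y Ob f u(1), THEN conjunct2] u(2) coeff_comp_def by (intro sum.cong) auto
        also have "\<dots> = (\<Sum>j\<in>J. w j * N j i)"
          using fin by (simp add: sum.If_cases Int_absorb1)
        finally show ?thesis using w[OF i(1)] by simp
      next
        case False
        then have "\<not> (i < length X \<and> k < length (M b) \<and> supp_CT2 (X ! i) (M b ! k))"
          by (auto simp: M_def)
        then show ?thesis
          using CT.ev_supported[OF X Ob CT.comp_mor[OF X Y Ob f u(1), THEN conjunct1]]
          unfolding supported_def by blast
      qed
      have zf: "ev_CT X (M b) (Comp cat_CT X Y (M b) z f) k i = 0" for k i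
        unfolding CT.comp_mor[OF X Y Ob f z(1), THEN conjunct2] z(2) coeff_comp_def by (simp cong: if_cong)
      have "Comp cat_CT X Y (M b) u f = Comp cat_CT X Y (M b) z f"
        by (rule CT.ev_eqI[OF X Ob])
          (use uf zf CT.comp_mor[OF X Y Ob f u(1)] CT.comp_mor[OF X Y Ob f z(1)] in \<open>auto simp: fun_eq_iff\<close>)
      moreover have uz: "u \<in> to_sys Y p \<epsilon>" "z \<in> to_sys Y p \<epsilon>" using u z by (simp_all add: to_sys_def b_def)
      ultimately have "hom_to_tau_map X Y p f (lim_class (to_sys Y p) (to_trans Y p) \<epsilon> u) =
        hom_to_tau_map X Y p f (lim_class (to_sys Y p) (to_trans Y p) \<epsilon> z)"
        unfolding hom_to_tau_map_def T.lim_map_class[OF v(1) uz(1)] T.lim_map_class[OF v(1) uz(2)]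
        unfolding b_def by simp
      then have "lim_class (to_sys Y p) (to_trans Y p) \<epsilon> u = lim_class (to_sys Y p) (to_trans Y p) \<epsilon> z"
        using inj T.V.lim_class_in[OF v(1)] uz unfolding inj_on_def hom_to_tau_def by blast
      then obtain \<gamma> where \<gamma>: "0 < \<gamma>" "\<gamma> < \<epsilon>" "to_trans Y p \<epsilon> \<gamma> u = to_trans Y p \<epsilon> \<gamma> z"
        using T.V.lim_class_eq_iff[OF v(1) uz(1) v(1) uz(2)] by blast
      define g where "g = shift p (- \<gamma>)"
      have g: "in_strip g" using ps by (simp add: g_def)
      note Og = M_Obj[OF g, where ?'k = 'k]
      have "hom_supp b g" using \<gamma> unfolding b_def g_def by (intro hom_supp_shift) simp
      note B = basic_mor_CT[OF ab(2) g this, where ?'k = 'k]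
      have t: "supp_T b g" using e2(2)[OF \<gamma>(1,2)] v(2) by (simp add: b_def g_def)
      show "\<forall>j\<in>J. w j = 0"
      proof
        fix j assume j: "j \<in> J"
        then have jl: "j < length Y" "supp_CT a (fst (Y ! j))" by (auto simp: J_def)
        have "comp_CT (fst (Y ! j)) b g"
          using e1(2)[OF YV[OF jl(1)]] jl(2) v \<gamma> unfolding a_def b_def g_def paired_within_def by simp
        then have ev: "ev_CT Y (M g) (Comp cat_CT Y (M b) (M g) (basic_mor b g) x) 0 j = ev_CT Y (M b) x 0 j"
          if "x \<in> carrier (Hom cat_CT Y (M b))" for x :: "'k CT_mor"
          unfolding CT.comp_mor[OF Y Ob Og that B[THEN conjunct1], THEN conjunct2] coeff_comp_through_M
            B[THEN conjunct2] using t by (simp add: M_nth)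
        have "Comp cat_CT Y (M b) (M g) (basic_mor b g) u = Comp cat_CT Y (M b) (M g) (basic_mor b g) z"
          using \<gamma>(3) unfolding to_trans_def b_def g_def .
        then have "ev_CT Y (M b) u 0 j = ev_CT Y (M b) z 0 j" using ev[OF u(1)] ev[OF z(1)] by simp
        then show "w j = 0" using j unfolding u(2) z(2) by (simp add: W_def)
      qed
    qed
    then obtain x where x: "\<And>j. j \<in> J \<Longrightarrow> (\<Sum>i\<in>I. N j i * x i) = ev_CT (M a) Y v j 0" by blast
    have "supported supp_CT2 (M a) X (\<lambda>i k. if k = 0 \<and> i \<in> I then x i else 0)"
      by (auto simp: supported_def I_def M_def)
    then obtain h where h: "h \<in> carrier (Hom cat_CT (M a) X)"
      "ev_CT (M a) X h = (\<lambda>i k. if k = 0 \<and> i \<in> I then x i else 0)"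
      using CT.ev_obtain[OF Oa X] by blast
    note fh = CT.comp_mor[OF Oa X Y h(1) f]
    have "ev_CT (M a) Y (Comp cat_CT (M a) X Y f h) j k = ev_CT (M a) Y v j k" for j k
    proof (cases "k = 0 \<and> j \<in> J")
      case True
      have "ev_CT (M a) Y (Comp cat_CT (M a) X Y f h) j k = (\<Sum>i<length X. if i \<in> I then N j i * x i else 0)"
        unfolding fh[THEN conjunct2] h(2) coeff_comp_def using True
        by (intro sum.cong) (auto simp: N_def M_nth)
      also have "\<dots> = (\<Sum>i\<in>I. N j i * x i)" using fin by (simp add: sum.If_cases Int_absorb1)
      finally show ?thesis using x True by simp
    next
      case False
      then have "\<not> (k < length (M a) \<and> j < length Y \<and> supp_CT2 (M a ! k) (Y ! j))"
        by (auto simp: M_def J_def)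
      then show ?thesis
        using vs CT.ev_supported[OF Oa Y fh[THEN conjunct1]] unfolding supported_def by metis
    qed
    then have "Comp cat_CT (M a) X Y f h = v"
      by (intro CT.ev_eqI[OF Oa Y fh[THEN conjunct1] v']) (auto simp: fun_eq_iff)
    moreover have hs: "h \<in> from_sys p X \<epsilon>" using h(1) by (simp add: from_sys_def a_def)
    ultimately have "\<kappa> = hom_from_tau_inv_map p X Y f (lim_class (from_sys p X) (from_trans p X) \<epsilon> h)"
      unfolding hom_from_tau_inv_map_def F.lim_map_class[OF v(1) hs] v(4) a_def by simp
    then show "\<kappa> \<in> hom_from_tau_inv_map p X Y f ` hom_from_tau_inv p X"
      using F.V.lim_class_in[OF v(1) hs] unfolding hom_from_tau_inv_def by blast
  qed
qed

text \<open>Let \<open>g\<close> and \<open>h\<close> differ in the component \<open>Y\<^sub>j \<rightarrow> Z\<^sub>k\<close>, and let \<open>S\<close> detect it. The projection \<open>\<pi>\<close>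
  of \<open>Z\<close> to \<open>\<tau>S\<close> through \<open>Z\<^sub>k\<close> and the morphism \<open>\<iota>\<close> from \<open>\<tau>\<^sup>-\<^sup>1S\<close> to \<open>Y\<close> into \<open>Y\<^sub>j\<close> extract this
  component as the only coefficient of \<open>\<pi> g \<iota>\<close>. Since \<open>\<iota>\<close> factors through \<open>f\<close> in the limit,
  \<open>\<pi> g \<iota> = \<pi> h \<iota>\<close>.\<close>

lemma from_tau_inv_surj_imp_epi:
  assumes surj: "\<And>p. p \<in> std_cluster \<Longrightarrow>
    hom_from_tau_inv_map p X Y f ` hom_from_tau_inv p X = hom_from_tau_inv p Y"
  shows "epi_in cat_CT X Y f"
  unfolding epi_in_def
proof (intro conjI ballI impI)
  show "f \<in> carrier (Hom cat_CT X Y)" by (rule f)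
  fix Z and g h :: "'k CT_mor"
  assume Z: "Z \<in> Obj (cat_CT :: 'k CT_cat)"
    and g: "g \<in> carrier (Hom cat_CT Y Z)" and h: "h \<in> carrier (Hom cat_CT Y Z)"
    and gh: "Comp cat_CT X Y Z g f = Comp cat_CT X Y Z h f"
  show "g = h"
  proof (rule ccontr)
    assume "g \<noteq> h"
    then have "ev_CT Y Z g \<noteq> ev_CT Y Z h" using CT.ev_eqI[OF Y Z g h] by blast
    then obtain k j where kj: "ev_CT Y Z g k j \<noteq> ev_CT Y Z h k j" by (auto simp: fun_eq_iff)
    then have "ev_CT Y Z g k j \<noteq> 0 \<or> ev_CT Y Z h k j \<noteq> 0" by auto
    then have s: "j < length Y" "k < length Z" "supp_CT (fst (Y ! j)) (fst (Z ! k))"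
      using CT.ev_supported[OF Y Z g] CT.ev_supported[OF Y Z h] unfolding supported_def by blast+
    have yz: "in_strip (fst (Y ! j))" "in_strip (fst (Z ! k))"
      using Y Z nth_mem[OF s(1)] nth_mem[OF s(2)] unfolding CT.Obj_iff by blast+
    obtain p e0 where p: "p \<in> std_cluster" and e0: "e0 > 0"
      "\<And>\<epsilon>. 0 < \<epsilon> \<Longrightarrow> \<epsilon> < e0 \<Longrightarrow> comp_CT (fst (Y ! j)) (fst (Z ! k)) (shift p (- \<epsilon>))"
      using basic_morphism_detected_by_cluster[OF s(3) yz(2)] by blast
    have pl: "cluster_lift p" using p std_cluster_lift by blast
    have ps: "in_strip p" using pl cluster_lift_in_strip by blast
    obtain e1 where e1: "e1 > 0" "paired_within p (fst (Y ! j)) e1"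
      using pairing_near_cluster[OF pl yz(1)] by blast
    obtain e2 where e2: "e2 > 0" "\<And>\<epsilon> \<gamma>. 0 < \<gamma> \<Longrightarrow> \<gamma> < \<epsilon> \<Longrightarrow> \<epsilon> < e2 \<Longrightarrow>
      supp_T (shift p \<gamma>) (shift p \<epsilon>)" using supp_T_near_cluster[OF pl] by blast
    define \<epsilon> where "\<epsilon> = min e0 (min e1 e2) / 2"
    have \<epsilon>: "0 < \<epsilon>" "\<epsilon> < e0" "\<epsilon> < e1" "\<epsilon> < e2" using e0(1) e1(1) e2(1) by (auto simp: \<epsilon>_def)
    define a b where "a = shift p \<epsilon>" and "b = shift p (- \<epsilon>)"
    have ab: "in_strip a" "in_strip b" using ps by (simp_all add: a_def b_def)
    note Oa = M_Obj[OF ab(1), where ?'k = 'k] and Ob = M_Obj[OF ab(2), where ?'k = 'k]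
    have cyz: "comp_CT (fst (Y ! j)) (fst (Z ! k)) b" using e0(2) \<epsilon> by (simp add: b_def)
    then have sb: "supp_CT (fst (Z ! k)) b" "supp_CT (fst (Y ! j)) b"
      using CT.comp_supp[of "Y ! j" "Z ! k" "(b, False)"] yz ab by simp_all
    have "comp_CT a (fst (Y ! j)) b" using e1(2) \<epsilon> sb(2) by (simp add: a_def b_def paired_within_def)
    then have sa: "supp_CT a (fst (Y ! j))"
      using CT.comp_supp[of "(a, False)" "Y ! j" "(b, False)"] yz ab by simp
    have "supported supp_CT2 Z (M b) (\<lambda>m l. if m = 0 \<and> l = k then 1 else 0 :: 'k)"
      using s sb by (auto simp: supported_def M_def)
    then obtain \<pi> where \<pi>: "\<pi> \<in> carrier (Hom cat_CT Z (M b))"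
      "ev_CT Z (M b) \<pi> = (\<lambda>m l. if m = 0 \<and> l = k then 1 else 0 :: 'k)"
      using CT.ev_obtain[OF Z Ob] by blast
    have \<pi>g: "ev_CT Y (M b) (Comp cat_CT Y Z (M b) \<pi> x) 0 j = ev_CT Y Z x k j"
      if "x \<in> carrier (Hom cat_CT Y Z)" for x :: "'k CT_mor"
    proof -
      have "ev_CT Y (M b) (Comp cat_CT Y Z (M b) \<pi> x) 0 j = (\<Sum>l<length Z. if l = k then ev_CT Y Z x k j else 0)"
        unfolding CT.comp_mor[OF Y Z Ob that \<pi>(1), THEN conjunct2] \<pi>(2) coeff_comp_def
        using cyz by (intro sum.cong) (auto simp: M_nth)
      then show ?thesis using s by simp
    qed
    have "supported supp_CT2 (M a) Y (\<lambda>l m. if m = 0 \<and> l = j then 1 else 0 :: 'k)"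
      using s sa by (auto simp: supported_def M_def)
    then obtain \<iota> where \<iota>: "\<iota> \<in> carrier (Hom cat_CT (M a) Y)"
      "ev_CT (M a) Y \<iota> = (\<lambda>l m. if m = 0 \<and> l = j then 1 else 0 :: 'k)"
      using CT.ev_obtain[OF Oa Y] by blast
    interpret F: direct_system_map "from_sys p X" "from_trans p X" "from_sys p Y" "from_trans p Y"
      "\<lambda>\<epsilon> g. Comp cat_CT (M (shift p \<epsilon>)) X Y f g" by (rule from_direct_map[OF ps])
    have \<iota>s: "\<iota> \<in> from_sys p Y \<epsilon>" using \<iota>(1) by (simp add: from_sys_def a_def)
    have "lim_class (from_sys p Y) (from_trans p Y) \<epsilon> \<iota> \<in> hom_from_tau_inv_map p X Y f ` hom_from_tau_inv p X"
      unfolding surj[OF p] unfolding hom_from_tau_inv_def by (rule F.W.lim_class_in[OF \<epsilon>(1) \<iota>s])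
    then obtain \<delta> w where w: "0 < \<delta>" "w \<in> from_sys p X \<delta>" "lim_class (from_sys p Y) (from_trans p Y) \<epsilon> \<iota> =
      hom_from_tau_inv_map p X Y f (lim_class (from_sys p X) (from_trans p X) \<delta> w)"
      unfolding hom_from_tau_inv_def dir_lim_def by blast
    obtain \<gamma> where \<gamma>: "0 < \<gamma>" "\<gamma> < \<epsilon>" "\<gamma> < \<delta>"
      "from_trans p Y \<epsilon> \<gamma> \<iota> = from_trans p Y \<delta> \<gamma> (Comp cat_CT (M (shift p \<delta>)) X Y f w)"
      using F.W.lim_class_eq_iff[THEN iffD1, OF \<epsilon>(1) \<iota>s w(1) F.\<phi>_in[OF w(1,2)]]
        w(3)[unfolded hom_from_tau_inv_map_def F.lim_map_class[OF w(1,2)]] by blast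
    define c where "c = shift p \<gamma>"
    have c: "in_strip c" using ps by (simp add: c_def)
    note Oc = M_Obj[OF c, where ?'k = 'k]
    have "hom_supp c a" using \<gamma> unfolding a_def c_def by (intro hom_supp_shift) simp
    note B = basic_mor_CT[OF c ab(1) this, where ?'k = 'k]
    define \<iota>' where "\<iota>' = Comp cat_CT (M c) (M a) Y \<iota> (basic_mor c a)"
    note i = CT.comp_mor[OF Oc Oa Y B[THEN conjunct1] \<iota>(1), folded \<iota>'_def]
    have st: "comp_CT c a (fst (Y ! j))" using e1(2) \<epsilon> \<gamma> sa by (simp add: a_def c_def paired_within_def)
    have ct: "supp_T c a" using e2(2)[OF \<gamma>(1,2) \<epsilon>(4)] by (simp add: a_def c_def)
    have ev_\<iota>': "ev_CT (M c) Y \<iota>' l 0 = (if l = j then 1 else 0)" for l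
      unfolding i[THEN conjunct2] coeff_comp_through_M \<iota>(2) B[THEN conjunct2] using st ct by (simp add: M_nth)
    define w' where "w' = from_trans p X \<delta> \<gamma> w"
    have w': "w' \<in> carrier (Hom cat_CT (M c) X)"
      using F.V.t_in[OF \<gamma>(1,3) w(2)] unfolding w'_def from_sys_def c_def .
    have fw: "\<iota>' = Comp cat_CT (M c) X Y f w'"
      using \<gamma>(4) F.\<phi>_t[OF \<gamma>(1,3) w(2)] unfolding \<iota>'_def w'_def from_trans_def[of p Y \<epsilon> \<gamma>] a_def c_def by simp
    have cb: "comp_CT c (fst (Y ! j)) b"
    proof -
      have "supp_CT c (fst (Y ! j))" using CT.comp_supp[of "(c, False)" "(a, False)" "Y ! j"] st c ab yz by simp
      then show ?thesis using e1(2) \<gamma> \<epsilon> by (simp add: b_def c_def paired_within_def)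
    qed
    have key: "ev_CT (M c) (M b) (Comp cat_CT (M c) Y (M b) (Comp cat_CT Y Z (M b) \<pi> x) \<iota>') 0 0 = ev_CT Y Z x k j"
      if x: "x \<in> carrier (Hom cat_CT Y Z)" for x :: "'k CT_mor"
    proof -
      note px = CT.comp_mor[OF Y Z Ob x \<pi>(1), THEN conjunct1]
      have "ev_CT (M c) (M b) (Comp cat_CT (M c) Y (M b) (Comp cat_CT Y Z (M b) \<pi> x) \<iota>') 0 0 =
        (\<Sum>l<length Y. if l = j then ev_CT Y (M b) (Comp cat_CT Y Z (M b) \<pi> x) 0 j else 0)"
        unfolding CT.comp_mor[OF Oc Y Ob i[THEN conjunct1] px, THEN conjunct2] coeff_comp_def ev_\<iota>'
        using cb by (intro sum.cong) (auto simp: M_nth)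
      then show ?thesis using s(1) \<pi>g[OF x] by simp
    qed
    have eq: "Comp cat_CT (M c) Y (M b) (Comp cat_CT Y Z (M b) \<pi> x) \<iota>' =
      Comp cat_CT (M c) X (M b) (Comp cat_CT X Z (M b) \<pi> (Comp cat_CT X Y Z x f)) w'"
      if x: "x \<in> carrier (Hom cat_CT Y Z)" for x :: "'k CT_mor"
      unfolding fw CT.comp_assoc_mor[OF X Y Z Ob f x \<pi>(1)]
      by (rule CT.comp_assoc_mor[OF Oc X Y Ob w' f CT.comp_mor[OF Y Z Ob x \<pi>(1), THEN conjunct1]])
    show False using key[OF g] key[OF h] eq[OF g] eq[OF h] gh kj by simp
  qed
qed

end

theorem lemma2p5p2:
  fixes X Y :: "dpoint list"
    and f :: "(int \<Rightarrow> 'k::field mat set) set"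
  assumes "X \<in> Obj (cat_CT :: ('k, dpoint list, (int \<Rightarrow> 'k mat set) set) lin_cat)"
    and "Y \<in> Obj (cat_CT :: ('k, dpoint list, (int \<Rightarrow> 'k mat set) set) lin_cat)"
    and "f \<in> carrier (Hom cat_CT X Y)"
  shows "(epi_in cat_CT X Y f \<longleftrightarrow>
           (\<forall>p \<in> std_cluster. inj_on (hom_to_tau_map X Y p f) (hom_to_tau Y p))) \<and>
         (epi_in cat_CT X Y f \<longleftrightarrow>
           (\<forall>p \<in> std_cluster.
              hom_from_tau_inv_map p X Y f ` hom_from_tau_inv p X = hom_from_tau_inv p Y))"
  using epi_imp_to_tau_inj[OF assms] to_tau_inj_imp_from_tau_inv_surj[OF assms]
    from_tau_inv_surj_imp_epi[OF assms] by blast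

end
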